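(* Let $G$ be a connected chordal graph. Then the following statements are equivalent: (a) $G$ is a path graph; (b) for every clique separator $Q$ of $G$, the $Q$-attachedness graph of $G$ has no full antipodal triangle and has no subgraph isomorphic (as a 2-edge-colored graph) to any of the graphs in $\mathcal F_0$; (c) for every clique separator $Q$ of $G$, the $Q$-attachedness graph of $G^+$ has no subgraph isomorphic to any of the graphs in $\mathcal F_0$; (d) for every clique separator $Q$ of $G$, the $Q$-attachedness graph of $G$ has no full antipodal triangle and has no induced subgraph isomorphic to any of the graphs in $\mathcal F$; (e) for every clique separator $Q$ of $G$, the $Q$-attachedness graph of $G^+$ has no induced subgraph isomorphic to any of the graphs in $\mathcal F$.
   Context: All graphs are finite, simple and undirected. A graph $G$ is a path graph if there are a tree $T$, a collection $\mathcal P$ of paths of $T$ and a bijection $\phi:V(G)\to\mathcal P$ such that $u,v\in V(G)$ are adjacent if and only if the vertex sets of $\phi(u)$ and $\phi(v)$ intersect. Chordal: no induced cycle of length at least four. For a graph $G$ with $V(G)=\{v_1,\dots,v_n\}$, $G^+$ is the graph with vertex set $V(G)\cup\{v_1^+,\dots,v_n^+\}$ (new vertices) and edge set $E(G)\cup\{v_iv_i^+: i=1,\dots,n\}$. The word "clique" means an inclusion-wise maximal set of pairwise adjacent vertices. A clique separator of a connected graph $G$ is a clique $Q$ of $G$ such that $G-Q$ has at least two connected components (a clique separator of $G$ is also one of $G^+$). Let $V_1,\dots,V_s$ be the vertex sets of the components of $G-Q$, $\gamma_i=G[V_i\cup Q]$ and $\Gamma_Q=\{\gamma_1,\dots,\gamma_s\}$.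 A relevant clique of $\gamma\in\Gamma_Q$ is a clique $K$ of $\gamma$ with $K\cap Q\neq\emptyset$ and $K\neq Q$. For $v\in Q$, $\gamma$ is a neighboring subgraph of $v$ if $v$ belongs to some relevant clique of $\gamma$. A subset $W\subseteq\Gamma_Q$ is a neighboring set (pair, triple, ...) if there is $v\in Q$ such that every element of $W$ is a neighboring subgraph of $v$. Relations on $\Gamma_Q$. Attachedness: $\gamma\bowtie\gamma'$ iff there are relevant cliques $K$ of $\gamma$ and $K'$ of $\gamma'$ with $K\cap K'\cap Q\neq\emptyset$. Dominance: $\gamma\leq\gamma$ always; for $\gamma\ne\gamma'$, $\gamma\leq\gamma'$ iff $\gamma\bowtie\gamma'$ and for each relevant clique $K'$ of $\gamma'$ either $K\cap Q\subseteq K'\cap Q$ for every relevant clique $K$ of $\gamma$, or $K\cap K'\cap Q=\emptyset$ for every relevant clique $K$ of $\gamma$. Antipodality: $\gamma\leftrightarrow\gamma'$ iff $\gamma\bowtie\gamma'$, $\gamma\not\leq\gamma'$ and $\gamma'\not\leq\gamma$. Dominance is a preorder; let $\gamma\sim\gamma'$ iff $\gamma\leq\gamma'$ and $\gamma'\leq\gamma$. By convention $\Gamma_Q$ is identified with $\Gamma_Q/\!\sim$ (relations being those of representatives), so that $(\Gamma_Q,\leq)$ is a partial order. The $Q$-attachedness graph of $G$ is the simple graph with vertex set $\Gamma_Q$ in which distinct $\gamma,\gamma'$ are adjacent iff $\gamma\bowtie\gamma'$; its edges are 2-colored: an edge $\gamma\gamma'$ is an antipodal edge if $\gamma\leftrightarrow\gamma'$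 and a dominance edge otherwise (i.e. if $\gamma\leq\gamma'$ or $\gamma'\leq\gamma$). The same definitions apply with $G^+$ in place of $G$. A full antipodal triangle is a triangle of the $Q$-attachedness graph whose three edges are antipodal and whose three vertices form a neighboring triple. Isomorphisms of 2-edge-colored graphs preserve edge colors. The 2-edge-colored graphs, for integers $k\geq1$, $n\geq2$ (pairs not listed are non-adjacent): - $W^{(0)}_{2k+1}$: an antipodal cycle on $2k+1$ vertices plus a hub joined to all vertices of the cycle by dominance edges. - $W^{(1)}_{2k+1}$: an antipodal cycle on $2k+1$ vertices plus a hub joined to exactly one vertex of the cycle by an antipodal edge and to all other vertices of the cycle by dominance edges. - $F_{2n+1}$: an antipodal path $\gamma_1\gamma_2\cdots\gamma_{2n}$ plus a vertex $\gamma_0$ joined by antipodal edges to $\gamma_1$ and $\gamma_{2n}$ and by dominance edges to $\gamma_2,\dots,\gamma_{2n-1}$. - $\widetilde F_{2n+1}$: $F_{2n+1}$ plus the antipodal edge $\gamma_1\gamma_{2n}$. - $DF_{2n+1}$: an antipodal cycle $\gamma_0\gamma_1\cdots\gamma_{2n}\gamma_0$ plus the dominance edges $\gamma_0\gamma_j$ for $j\notin\{0,1,2n\}$ and $\gamma_1\gamma_j$ for $j\notin\{0,1,2\}$. $\mathcal F=\{W^{(0)}_{2k+1},W^{(1)}_{2k+1},F_{2n+1},\widetilde F_{2n+1},DF_{2n+1}: k\geq1,\ n\geq2\}$ and $\mathcal F_0=\{W^{(0)}_{2k+1},W^{(1)}_{2k+1},F_{2n+1}: k\geq1,\ n\geq2\}$.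 *)

theory Defs
  imports Main
begin

section \<open>Finite simple graphs\<close>

record 'a ugraph =
  verts :: "'a set"
  edges :: "'a set set"

definition simple_graph :: "'a ugraph \<Rightarrow> bool" where
  "simple_graph G \<longleftrightarrow> finite (verts G) \<and> (\<forall>e\<in>edges G. e \<subseteq> verts G \<and> card e = 2)"

definition adj :: "'a ugraph \<Rightarrow> 'a \<Rightarrow> 'a \<Rightarrow> bool" where
  "adj G u v \<longleftrightarrow> {u, v} \<in> edges G"

definition subgraph_of :: "'a ugraph \<Rightarrow> 'a ugraph \<Rightarrow> bool" where
  "subgraph_of H G \<longleftrightarrow> verts H \<subseteq> verts G \<and> edges H \<subseteq> edges G"

definition induced :: "'a ugraph \<Rightarrow> 'a set \<Rightarrow> 'a ugraph" where
  "induced G S = \<lparr>verts = S, edges = {e \<in> edges G. e \<subseteq> S}\<rparr>"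

definition connected_graph :: "'a ugraph \<Rightarrow> bool" where
  "connected_graph G \<longleftrightarrow> verts G \<noteq> {} \<and> (\<forall>u\<in>verts G. \<forall>v\<in>verts G. (adj G)\<^sup>*\<^sup>* u v)"

definition components :: "'a ugraph \<Rightarrow> 'a set set" where
  "components G = {{w \<in> verts G. (adj G)\<^sup>*\<^sup>* v w} | v. v \<in> verts G}"

definition is_path :: "'a ugraph \<Rightarrow> bool" where
  "is_path P \<longleftrightarrow> (\<exists>xs. xs \<noteq> [] \<and> distinct xs \<and> verts P = set xs \<and>
     edges P = {{xs ! i, xs ! Suc i} | i. Suc i < length xs})"

definition is_cycle :: "'a ugraph \<Rightarrow> bool" where
  "is_cycle C \<longleftrightarrow> (\<exists>xs. length xs \<ge> 3 \<and> distinct xs \<and> verts C = set xs \<and>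
     edges C = {{xs ! i, xs ! (Suc i mod length xs)} | i. i < length xs})"

definition is_tree :: "'a ugraph \<Rightarrow> bool" where
  "is_tree T \<longleftrightarrow> simple_graph T \<and> connected_graph T \<and> \<not> (\<exists>C. subgraph_of C T \<and> is_cycle C)"

definition chordal :: "'a ugraph \<Rightarrow> bool" where
  "chordal G \<longleftrightarrow> \<not> (\<exists>S \<subseteq> verts G. card S \<ge> 4 \<and> is_cycle (induced G S))"

text \<open>Paths are subgraphs of the tree, not vertex sequences, so a sequence and its reversal are
  the same path. Every finite tree is isomorphic to one with vertices in \<^typ>\<open>nat\<close>.\<close>

definition paths_of :: "'a ugraph \<Rightarrow> 'a ugraph set" where
  "paths_of T = {P. subgraph_of P T \<and> is_path P}"

definition path_graph :: "'a ugraph \<Rightarrow> bool" where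
  "path_graph G \<longleftrightarrow> (\<exists>(T :: nat ugraph) \<P> \<phi>. is_tree T \<and> \<P> \<subseteq> paths_of T \<and>
     bij_betw \<phi> (verts G) \<P> \<and>
     (\<forall>u\<in>verts G. \<forall>v\<in>verts G. u \<noteq> v \<longrightarrow>
        (adj G u v \<longleftrightarrow> verts (\<phi> u) \<inter> verts (\<phi> v) \<noteq> {})))"

text \<open>\<^term>\<open>Inl v\<close> is the old vertex \<open>v\<close> and \<^term>\<open>Inr v\<close> the new pendant vertex \<open>v\<^sup>+\<close>.\<close>

definition plus_graph :: "'a ugraph \<Rightarrow> ('a + 'a) ugraph" where
  "plus_graph G = \<lparr>verts = Inl ` verts G \<union> Inr ` verts G,
     edges = (`) Inl ` edges G \<union> {{Inl v, Inr v} | v. v \<in> verts G}\<rparr>"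


section \<open>Clique separators and the relations on the separated pieces\<close>

definition pairwise_adj :: "'a ugraph \<Rightarrow> 'a set \<Rightarrow> bool" where
  "pairwise_adj G K \<longleftrightarrow> K \<subseteq> verts G \<and> (\<forall>u\<in>K. \<forall>v\<in>K. u \<noteq> v \<longrightarrow> adj G u v)"

definition is_clique :: "'a ugraph \<Rightarrow> 'a set \<Rightarrow> bool" where
  "is_clique G K \<longleftrightarrow> pairwise_adj G K \<and> (\<forall>K'. pairwise_adj G K' \<and> K \<subseteq> K' \<longrightarrow> K' = K)"

definition clique_separator :: "'a ugraph \<Rightarrow> 'a set \<Rightarrow> bool" where
  "clique_separator G Q \<longleftrightarrow>
     is_clique G Q \<and> card (components (induced G (verts G - Q))) \<ge> 2"

definition Gamma :: "'a ugraph \<Rightarrow> 'a set \<Rightarrow> 'a ugraph set" where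
  "Gamma G Q = {induced G (C \<union> Q) | C. C \<in> components (induced G (verts G - Q))}"

definition relevant_clique :: "'a set \<Rightarrow> 'a ugraph \<Rightarrow> 'a set \<Rightarrow> bool" where
  "relevant_clique Q \<gamma> K \<longleftrightarrow> is_clique \<gamma> K \<and> K \<inter> Q \<noteq> {} \<and> K \<noteq> Q"

definition neighboring_subgraph :: "'a set \<Rightarrow> 'a \<Rightarrow> 'a ugraph \<Rightarrow> bool" where
  "neighboring_subgraph Q v \<gamma> \<longleftrightarrow> (\<exists>K. relevant_clique Q \<gamma> K \<and> v \<in> K)"

definition neighboring_set :: "'a ugraph \<Rightarrow> 'a set \<Rightarrow> 'a ugraph set \<Rightarrow> bool" where
  "neighboring_set G Q W \<longleftrightarrow> W \<subseteq> Gamma G Q \<and> (\<exists>v\<in>Q. \<forall>\<gamma>\<in>W. neighboring_subgraph Q v \<gamma>)"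

definition attached :: "'a set \<Rightarrow> 'a ugraph \<Rightarrow> 'a ugraph \<Rightarrow> bool" where
  "attached Q \<gamma> \<gamma>' \<longleftrightarrow>
     (\<exists>K K'. relevant_clique Q \<gamma> K \<and> relevant_clique Q \<gamma>' K' \<and> K \<inter> K' \<inter> Q \<noteq> {})"

definition dominated :: "'a set \<Rightarrow> 'a ugraph \<Rightarrow> 'a ugraph \<Rightarrow> bool" where
  "dominated Q \<gamma> \<gamma>' \<longleftrightarrow> \<gamma> = \<gamma>' \<or>
     (attached Q \<gamma> \<gamma>' \<and>
      (\<forall>K'. relevant_clique Q \<gamma>' K' \<longrightarrow>
         (\<forall>K. relevant_clique Q \<gamma> K \<longrightarrow> K \<inter> Q \<subseteq> K' \<inter> Q) \<or>
         (\<forall>K. relevant_clique Q \<gamma> K \<longrightarrow> K \<inter> K' \<inter> Q = {})))"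

definition antipodal :: "'a set \<Rightarrow> 'a ugraph \<Rightarrow> 'a ugraph \<Rightarrow> bool" where
  "antipodal Q \<gamma> \<gamma>' \<longleftrightarrow>
     attached Q \<gamma> \<gamma>' \<and> \<not> dominated Q \<gamma> \<gamma>' \<and> \<not> dominated Q \<gamma>' \<gamma>"

text \<open>The convention identifying \<open>\<Gamma>\<^sub>Q\<close> with \<open>\<Gamma>\<^sub>Q/\<sim>\<close> is rendered by taking equivalence classes.
  Relations between classes are those of representatives; since members of one class have the
  same relations (and are neighboring subgraphs of the same vertices), which representatives are
  used does not matter.\<close>

definition dom_equiv :: "'a ugraph \<Rightarrow> 'a set \<Rightarrow> ('a ugraph \<times> 'a ugraph) set" where
  "dom_equiv G Q = {(\<gamma>, \<gamma>'). \<gamma> \<in> Gamma G Q \<and> \<gamma>' \<in> Gamma G Q \<and>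
     dominated Q \<gamma> \<gamma>' \<and> dominated Q \<gamma>' \<gamma>}"

definition on_reps :: "('b \<Rightarrow> 'b \<Rightarrow> bool) \<Rightarrow> 'b set \<Rightarrow> 'b set \<Rightarrow> bool" where
  "on_reps R A B \<longleftrightarrow> (\<exists>a\<in>A. \<exists>b\<in>B. R a b)"


section \<open>Two-edge-colored graphs and the attachedness graph\<close>

record 'v cgraph =
  cverts :: "'v set"
  antip_edges :: "'v set set"
  dom_edges :: "'v set set"

definition attachedness_graph :: "'a ugraph \<Rightarrow> 'a set \<Rightarrow> 'a ugraph set cgraph" where
  "attachedness_graph G Q = (let V = Gamma G Q // dom_equiv G Q in
     \<lparr>cverts = V,
      antip_edges = {{A, B} | A B. A \<in> V \<and> B \<in> V \<and> A \<noteq> B \<and>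
        on_reps (attached Q) A B \<and> on_reps (antipodal Q) A B},
      dom_edges = {{A, B} | A B. A \<in> V \<and> B \<in> V \<and> A \<noteq> B \<and>
        on_reps (attached Q) A B \<and> \<not> on_reps (antipodal Q) A B}\<rparr>)"

definition has_full_antipodal_triangle :: "'a ugraph \<Rightarrow> 'a set \<Rightarrow> bool" where
  "has_full_antipodal_triangle G Q \<longleftrightarrow>
     (\<exists>A B C. {{A, B}, {B, C}, {A, C}} \<subseteq> antip_edges (attachedness_graph G Q) \<and>
        (\<exists>\<alpha>\<in>A. \<exists>\<beta>\<in>B. \<exists>\<gamma>\<in>C. neighboring_set G Q {\<alpha>, \<beta>, \<gamma>}))"

definition csubgraph_of :: "'v cgraph \<Rightarrow> 'v cgraph \<Rightarrow> bool" where
  "csubgraph_of H X \<longleftrightarrow> cverts H \<subseteq> cverts X \<and>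
     antip_edges H \<subseteq> antip_edges X \<and> dom_edges H \<subseteq> dom_edges X"

definition cinduced :: "'v cgraph \<Rightarrow> 'v set \<Rightarrow> 'v cgraph" where
  "cinduced X S = \<lparr>cverts = S, antip_edges = {e \<in> antip_edges X. e \<subseteq> S},
     dom_edges = {e \<in> dom_edges X. e \<subseteq> S}\<rparr>"

definition cisomorphic :: "'u cgraph \<Rightarrow> 'v cgraph \<Rightarrow> bool" where
  "cisomorphic H X \<longleftrightarrow> (\<exists>f. bij_betw f (cverts H) (cverts X) \<and>
     (`) f ` antip_edges H = antip_edges X \<and> (`) f ` dom_edges H = dom_edges X)"

definition has_csubgraph :: "'v cgraph \<Rightarrow> 'u cgraph \<Rightarrow> bool" where
  "has_csubgraph X H \<longleftrightarrow> (\<exists>Y. csubgraph_of Y X \<and> cisomorphic H Y)"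

definition has_induced_csubgraph :: "'v cgraph \<Rightarrow> 'u cgraph \<Rightarrow> bool" where
  "has_induced_csubgraph X H \<longleftrightarrow> (\<exists>S \<subseteq> cverts X. cisomorphic H (cinduced X S))"


section \<open>The forbidden two-edge-colored graphs\<close>

definition cycle_edges :: "nat \<Rightarrow> nat set set" where
  "cycle_edges m = {{i, Suc i mod m} | i. i < m}"

text \<open>The cycle of \<open>W0 k\<close> and \<open>W1 k\<close> is on \<open>0, \<dots>, 2k\<close>; the hub is \<open>2k + 1\<close>.
  All five families are indexed by \<open>k\<close> resp. \<open>n\<close>, not by the subscripts \<open>2k + 1\<close>, \<open>2n + 1\<close>.\<close>

definition W0 :: "nat \<Rightarrow> nat cgraph" where
  "W0 k = \<lparr>cverts = {0..2*k+1},
     antip_edges = cycle_edges (2*k+1),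
     dom_edges = {{2*k+1, i} | i. i \<le> 2*k}\<rparr>"

definition W1 :: "nat \<Rightarrow> nat cgraph" where
  "W1 k = \<lparr>cverts = {0..2*k+1},
     antip_edges = insert {2*k+1, 0} (cycle_edges (2*k+1)),
     dom_edges = {{2*k+1, i} | i. 1 \<le> i \<and> i \<le> 2*k}\<rparr>"

definition FF :: "nat \<Rightarrow> nat cgraph" where
  "FF n = \<lparr>cverts = {0..2*n},
     antip_edges = {{i, i + 1} | i. 1 \<le> i \<and> i < 2*n} \<union> {{0, 1}, {0, 2*n}},
     dom_edges = {{0, j} | j. 2 \<le> j \<and> j \<le> 2*n - 1}\<rparr>"

definition FF_tilde :: "nat \<Rightarrow> nat cgraph" where
  "FF_tilde n = (FF n)\<lparr>antip_edges := insert {1, 2*n} (antip_edges (FF n))\<rparr>"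

definition DF :: "nat \<Rightarrow> nat cgraph" where
  "DF n = \<lparr>cverts = {0..2*n},
     antip_edges = cycle_edges (2*n+1),
     dom_edges = {{0, j} | j. j \<le> 2*n \<and> j \<notin> {0, 1, 2*n}} \<union>
                 {{1, j} | j. j \<le> 2*n \<and> j \<notin> {0, 1, 2}}\<rparr>"

definition family_F :: "nat cgraph set" where
  "family_F = {W0 k | k. k \<ge> 1} \<union> {W1 k | k. k \<ge> 1} \<union> {FF n | n. n \<ge> 2} \<union>
     {FF_tilde n | n. n \<ge> 2} \<union> {DF n | n. n \<ge> 2}"

definition family_F0 :: "nat cgraph set" where
  "family_F0 = {W0 k | k. k \<ge> 1} \<union> {W1 k | k. k \<ge> 1} \<union> {FF n | n. n \<ge> 2}"

end

theory Submission
  imports Defs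
begin

text \<open>
  Call a colouring of the components of \<open>G - Q\<close> valid if antipodal components get different
  colours and every vertex of \<open>Q\<close> has neighbours in components of at most two colours. All
  five conditions amount to the existence of a valid colouring for every clique separator \<open>Q\<close>.

  A valid colouring excludes full antipodal triangles, and along an antipodal cycle or path the
  components with the colour of a hub must alternate, which excludes \<open>W0\<close>, \<open>W1\<close> and \<open>FF\<close>.
  Conversely, if a maximal \<open>u\<close> keeps its own colour, then the other components attached to \<open>u\<close>
  must admit a bipartition into colour \<open>u\<close> and not colour \<open>u\<close>; a shortest odd cycle violating
  this induces a member of \<open>family_F\<close>, and the bipartitions for all maximal \<open>u\<close> combine to a
  valid colouring.

  In a path representation, \<open>Q\<close> has a common node, and colouring the components by the branches
  at this node is valid. Conversely (Monma and Wei), valid colourings pass to the pieces of \<open>G\<close>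
  at \<open>Q\<close>, and clique trees of the pieces in which every vertex induces a path are glued along a
  valid colouring.

  In \<open>plus_graph G\<close> the new components are the single vertices pendant at \<open>Q\<close>. They are
  dominated by everything they are attached to, so they do not affect colourability, but they
  turn full antipodal triangles into wheels.
\<close>

text \<open>Of a component, only the sets \<open>K \<inter> Q\<close> for cliques \<open>K\<close>
  meeting it matter: their union decides attachment, their family decides dominance between distinct
  components. Hence the combinatorial half lives in the locale \<open>attachment_order\<close>,
  which keeps just the unions \<open>W\<close> and the order \<open>le\<close> and serves
  \<open>G\<close> and \<open>plus_graph G\<close> alike. The bipartitions at different maximal
  elements fit together because two maximal elements that share a vertex of \<open>Q\<close> are
  antipodal: without full antipodal triangles a vertex of \<open>Q\<close> meets at most two of
  them. Colours can be named after maximal elements, with one further colour per element for the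
  side that avoids it. The obstacle is an antipodal pair whose members are both antipodal to
  \<open>u\<close>: both must avoid the colour of \<open>u\<close>, so they do not constrain the
  bipartition at \<open>u\<close>. A shortest odd cycle of the bipartition problem may have such a
  pair as a chord and then is not induced in the antipodality graph. This exception produces
  \<open>FF_tilde\<close>, and it is where the analysis of odd cycles uses the absence of full
  triangles.\<close>

lemma ex_greatest_on_finite:
  fixes f :: "'i \<Rightarrow> nat"
  assumes "finite S" "S \<noteq> {}"
  shows "\<exists>x\<in>S. \<forall>y\<in>S. f y \<le> f x"
proof -
  have "Max (f ` S) \<in> f ` S" using assms by (intro Max_in) auto
  then obtain x where x: "x \<in> S" "Max (f ` S) = f x" by blast
  have "f y \<le> f x" if "y \<in> S" for y unfolding x(2)[symmetric] using assms(1) that by simp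
  then show ?thesis using x(1) by blast
qed

lemma card_le_2_of_subset_pair: "S \<subseteq> {a, b} \<Longrightarrow> card S \<le> 2"
  using card_mono[of "{a, b}" S] by (simp add: card_insert_if split: if_splits)

section \<open>Odd closed walks\<close>

text \<open>With an \<open>n\<close>-periodic function on all of \<open>nat\<close>, restarting a
  closed walk is a mere shift of the argument, and an arc may run past the end of a period. Vertices
  may repeat here; for shortest walks repetition is ruled out below.\<close>

definition odd_walk :: "('x \<Rightarrow> 'x \<Rightarrow> bool) \<Rightarrow> nat \<Rightarrow> (nat \<Rightarrow> 'x) \<Rightarrow> bool" where
  "odd_walk E n c \<longleftrightarrow> odd n \<and> (\<forall>i. E (c i) (c (Suc i))) \<and> (\<forall>i. c (i + n) = c i)"

definition min_odd_walk :: "('x \<Rightarrow> 'x \<Rightarrow> bool) \<Rightarrow> nat \<Rightarrow> (nat \<Rightarrow> 'x) \<Rightarrow> bool" where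
  "min_odd_walk E n c \<longleftrightarrow> odd_walk E n c \<and> (\<forall>m d. odd_walk E m d \<longrightarrow> n \<le> m)"

lemma odd_walk_of_relpowp:
  assumes "(E ^^ n) x x" "odd n"
  shows "\<exists>c. odd_walk E n c"
proof -
  obtain f where f: "f 0 = x" "f n = x" "\<forall>i<n. E (f i) (f (Suc i))"
    using assms(1) by (auto simp: relpowp_fun_conv)
  have n: "n > 0" using assms(2) by (simp add: odd_pos)
  have "E (f (i mod n)) (f (Suc i mod n))" for i
  proof (cases "Suc (i mod n) = n")
    case True
    then have "Suc i mod n = 0" by (simp add: mod_Suc)
    moreover have "E (f (i mod n)) (f (Suc (i mod n)))" using f(3) n by simp
    ultimately show ?thesis using True f(1,2) by simp
  next
    case False
    then have "Suc i mod n = Suc (i mod n)" by (simp add: mod_Suc)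
    then show ?thesis using f(3) n by simp
  qed
  then have "odd_walk E n (\<lambda>i. f (i mod n))" using assms(2) by (simp add: odd_walk_def)
  then show ?thesis by blast
qed

lemma odd_walk_relpowp:
  assumes "odd_walk E n c"
  shows "(E ^^ k) (c i) (c (i + k))"
proof (induction k)
  case (Suc k)
  then show ?case using assms by (auto simp: odd_walk_def)
qed simp

lemma odd_walk_shift: "odd_walk E n c \<Longrightarrow> odd_walk E n (\<lambda>i. c (i + s))"
  by (simp add: odd_walk_def add.assoc add.commute[of s] add.left_commute)
     (metis add.assoc add.commute)

lemma min_odd_walk_shift: "min_odd_walk E n c \<Longrightarrow> min_odd_walk E n (\<lambda>i. c (i + s))"
  by (simp add: min_odd_walk_def odd_walk_shift)

lemma odd_walk_mult: "odd_walk E n c \<Longrightarrow> c (i + k * n) = c i"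
proof (induction k)
  case (Suc k)
  have "c (i + Suc k * n) = c (i + k * n + n)" by (simp add: algebra_simps)
  then show ?case using Suc by (simp add: odd_walk_def)
qed simp

lemma odd_walk_mod: "odd_walk E n c \<Longrightarrow> c (i mod n) = c i"
  by (metis odd_walk_mult mod_div_decomp add.commute)

text \<open>Without odd closed walks, colour \<open>x\<close> by whether a walk of even length leads
  to it from the root of its component. If both ends of an edge had even walks, these and the edge
  would form an odd closed walk at the root; if \<open>x\<close> has only odd ones, the edge extends
  one of them to an even walk to \<open>y\<close>.\<close>

lemma bipartite_or_min_odd_walk:
  assumes "symp E"
  shows "(\<exists>g :: 'x \<Rightarrow> bool. \<forall>x y. E x y \<longrightarrow> g x \<noteq> g y) \<or> (\<exists>n c. min_odd_walk E n c)"
proof (cases "\<exists>n x. odd n \<and> (E ^^ n) x x")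
  case True
  then obtain n c where "odd_walk E n c" using odd_walk_of_relpowp by metis
  then have ex: "\<exists>n. \<exists>c. odd_walk E n c" by blast
  define n where "n = (LEAST n. \<exists>c. odd_walk E n c)"
  have "\<exists>c. odd_walk E n c" unfolding n_def by (rule LeastI_ex[OF ex])
  moreover have "n \<le> m" if "odd_walk E m d" for m d
    unfolding n_def by (rule Least_le) (use that in blast)
  ultimately show ?thesis unfolding min_odd_walk_def by blast
next
  case False
  \<comment> \<open>The predicate under the choice is the same for adjacent vertices, so
    \<open>rt\<close> is literally constant on components.\<close>
  define rt where "rt x = (SOME r. E\<^sup>*\<^sup>* r x)" for x
  have sym: "(E ^^ n) x y \<Longrightarrow> (E ^^ n) y x" for n x y
  proof (induction n arbitrary: y)
    case (Suc n)
    then obtain z where "(E ^^ n) x z" "E z y" by auto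
    then have "E y z" "(E ^^ n) z x" using Suc assms by (auto dest: sympD)
    then show ?case by (rule relpowp_Suc_I2)
  qed simp
  have sym2: "E\<^sup>*\<^sup>* x y \<Longrightarrow> E\<^sup>*\<^sup>* y x" for x y
    using sym by (metis rtranclp_power)
  have rt: "E\<^sup>*\<^sup>* (rt x) x" for x unfolding rt_def by (rule someI[of "\<lambda>r. E\<^sup>*\<^sup>* r x" x]) simp
  have rt_eq: "rt x = rt y" if "E x y" for x y
  proof -
    have "E\<^sup>*\<^sup>* r x \<longleftrightarrow> E\<^sup>*\<^sup>* r y" for r
      using that assms by (meson sympD rtranclp.rtrancl_into_rtrancl)
    then show ?thesis by (simp add: rt_def)
  qed
  define g where "g x \<longleftrightarrow> (\<exists>n. even n \<and> (E ^^ n) (rt x) x)" for x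
  have "g x \<noteq> g y" if e: "E x y" for x y
  proof
    assume eq: "g x = g y"
    show False
    proof (cases "g x")
      case True
      then obtain n m where nm: "even n" "(E ^^ n) (rt x) x" "even m" "(E ^^ m) (rt x) y"
        using eq rt_eq[OF e] unfolding g_def by metis
      then have "(E ^^ (Suc n)) (rt x) y" using e by auto
      then have "(E ^^ (Suc n + m)) (rt x) (rt x)" using sym[OF nm(4)] by (metis relpowp_trans)
      then show False using False nm by (metis even_Suc even_add)
    next
      case f: False
      obtain n where n: "(E ^^ n) (rt x) x" using rt by (metis rtranclp_power)
      then have "odd n" using f g_def by blast
      moreover have "(E ^^ (Suc n)) (rt y) y" using n e rt_eq[OF e] by auto
      ultimately have "g y" unfolding g_def by (metis even_Suc)
      then show False using eq f by simp
    qed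
  qed
  then show ?thesis by blast
qed

lemma min_odd_walk_le:
  assumes "min_odd_walk E n c" "(E ^^ m) x x" "odd m"
  shows "n \<le> m"
  using assms odd_walk_of_relpowp unfolding min_odd_walk_def by metis

text \<open>A repetition cuts the walk into two closed walks whose lengths sum to \<open>n\<close>;
  one of them is odd and shorter.\<close>

lemma min_odd_walk_inj:
  assumes c: "min_odd_walk E n c" and "i < j" "j < i + n"
  shows "c i \<noteq> c j"
proof
  assume eq: "c i = c j"
  have w: "odd_walk E n c" using c by (simp add: min_odd_walk_def)
  then have "(E ^^ (j - i)) (c i) (c j)" "(E ^^ (i + n - j)) (c j) (c i)"
    using odd_walk_relpowp[OF w, of "j - i" i] odd_walk_relpowp[OF w, of "i + n - j" j] assms
    by (auto simp: odd_walk_def)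
  moreover have "odd n" using w by (simp add: odd_walk_def)
  then have "odd (j - i) \<or> odd (i + n - j)" using assms(2,3) by presburger
  ultimately show False using min_odd_walk_le[OF c, of "j - i" "c i"] min_odd_walk_le[OF c, of "i + n - j" "c i"] eq assms
    by (auto; linarith)
qed

text \<open>A chord closes each of the two arcs between its ends. The lengths of the arcs sum to
  \<open>n\<close>, so one of the two new closed walks is odd; minimality of \<open>n\<close> then
  leaves a single edge for the other arc.\<close>

lemma min_odd_walk_chordless:
  assumes c: "min_odd_walk E n c" and "i < j" "j < i + n" "E (c i) (c j)" "symp E"
  shows "j = Suc i \<or> Suc j = i + n"
proof (rule ccontr)
  assume no: "\<not> ?thesis"
  have w: "odd_walk E n c" using c by (simp add: min_odd_walk_def)
  have ji: "E (c j) (c i)" using assms by (meson sympD)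
  have "(E ^^ (j - i)) (c i) (c j)" "(E ^^ (i + n - j)) (c j) (c i)"
    using odd_walk_relpowp[OF w, of "j - i" i] odd_walk_relpowp[OF w, of "i + n - j" j] w assms
    by (auto simp: odd_walk_def)
  then have "(E ^^ (Suc (j - i))) (c i) (c i)" "(E ^^ (Suc (i + n - j))) (c j) (c j)"
    using ji assms(4) by auto
  moreover have "odd n" using w by (simp add: odd_walk_def)
  then have "odd (Suc (j - i)) \<or> odd (Suc (i + n - j))" using assms(2,3) by presburger
  ultimately have "n \<le> Suc (j - i) \<or> n \<le> Suc (i + n - j)"
    using min_odd_walk_le[OF c] by blast
  then show False using no assms by linarith
qed

section \<open>Colourings of attachment orders\<close>

text \<open>Isomorphism onto an induced subgraph is an equality of sets of sets. This form reduces
  it to a case check over index pairs \<open>i < j\<close>; the two well-formedness assumptions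
  exclude edges, such as singletons, that the check would not see.\<close>

lemma has_induced_csubgraphI:
  fixes c :: "nat \<Rightarrow> 'x" and H :: "nat cgraph"
  assumes wf: "\<And>e. e \<in> antip_edges H \<union> dom_edges H \<Longrightarrow>
                 \<exists>i j. i < j \<and> i \<in> cverts H \<and> j \<in> cverts H \<and> e = {i, j}"
    and wf': "\<And>e. e \<in> antip_edges X \<union> dom_edges X \<Longrightarrow> \<exists>x y. x \<noteq> y \<and> e = {x, y}"
    and X: "c ` cverts H \<subseteq> cverts X"
    and inj: "\<And>i j. i < j \<Longrightarrow> i \<in> cverts H \<Longrightarrow> j \<in> cverts H \<Longrightarrow> c i \<noteq> c j"
    and ant: "\<And>i j. i < j \<Longrightarrow> i \<in> cverts H \<Longrightarrow> j \<in> cverts H \<Longrightarrow>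
        {i, j} \<in> antip_edges H \<longleftrightarrow> {c i, c j} \<in> antip_edges X"
    and dom: "\<And>i j. i < j \<Longrightarrow> i \<in> cverts H \<Longrightarrow> j \<in> cverts H \<Longrightarrow>
        {i, j} \<in> dom_edges H \<longleftrightarrow> {c i, c j} \<in> dom_edges X"
  shows "has_induced_csubgraph X H"
proof -
  let ?S = "c ` cverts H"
  have i: "inj_on c (cverts H)" using inj by (metis inj_onI linorder_neqE_nat)
  have im: "(`) c ` E = {e \<in> F. e \<subseteq> ?S}"
    if wE: "\<And>e. e \<in> E \<Longrightarrow> \<exists>i j. i < j \<and> i \<in> cverts H \<and> j \<in> cverts H \<and> e = {i, j}"
      and wF: "\<And>e. e \<in> F \<Longrightarrow> \<exists>x y. x \<noteq> y \<and> e = {x, y}"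
      and eq: "\<And>i j. i < j \<Longrightarrow> i \<in> cverts H \<Longrightarrow> j \<in> cverts H \<Longrightarrow> {i, j} \<in> E \<longleftrightarrow> {c i, c j} \<in> F"
    for E :: "nat set set" and F
  proof (intro equalityI subsetI)
    fix e assume "e \<in> (`) c ` E"
    then obtain i j where "i < j" "i \<in> cverts H" "j \<in> cverts H" "{i, j} \<in> E" "e = c ` {i, j}"
      using wE by (metis (no_types) imageE)
    then show "e \<in> {e \<in> F. e \<subseteq> ?S}" using eq[of i j] by simp
  next
    fix e assume e: "e \<in> {e \<in> F. e \<subseteq> ?S}"
    then obtain x y where xy: "x \<noteq> y" "e = {x, y}" using wF[of e] by auto
    have "x \<in> ?S" "y \<in> ?S" using e xy by auto
    then obtain i j where ij: "x = c i" "y = c j" "i \<in> cverts H" "j \<in> cverts H" by blast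
    have "i \<noteq> j" using xy ij by auto
    then consider "i < j" | "j < i" by linarith
    then have "{i, j} \<in> E"
    proof cases
      case 1
      then show ?thesis using eq[of i j] e ij xy by simp
    next
      case 2
      then show ?thesis using eq[of j i] e ij xy by (simp add: insert_commute)
    qed
    moreover have "e = c ` {i, j}" using xy ij by simp
    ultimately show "e \<in> (`) c ` E" by blast
  qed
  have "(`) c ` antip_edges H = {e \<in> antip_edges X. e \<subseteq> ?S}"
    by (rule im[OF wf wf' ant]) auto
  moreover have "(`) c ` dom_edges H = {e \<in> dom_edges X. e \<subseteq> ?S}"
    by (rule im[OF wf wf' dom]) auto
  ultimately show ?thesis unfolding has_induced_csubgraph_def cisomorphic_def cinduced_def
    using X i by (intro exI[of _ ?S] conjI exI[of _ c]) (simp_all add: bij_betw_def)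
qed

lemma cycle_edges_iff:
  assumes "i < j" "j < m"
  shows "{i, j} \<in> cycle_edges m \<longleftrightarrow> j = Suc i \<or> i = 0 \<and> Suc j = m"
proof
  assume "{i, j} \<in> cycle_edges m"
  then obtain a where a: "a < m" "{i, j} = {a, Suc a mod m}" by (auto simp: cycle_edges_def)
  show "j = Suc i \<or> i = 0 \<and> Suc j = m"
  proof (cases "Suc a = m")
    case True
    then have "{i, j} = {a, 0}" using a by simp
    then show ?thesis using True assms by (auto simp: doubleton_eq_iff)
  next
    case False
    then have "{i, j} = {a, Suc a}" using a by simp
    then show ?thesis using assms by (auto simp: doubleton_eq_iff)
  qed
next
  assume "j = Suc i \<or> i = 0 \<and> Suc j = m"
  then show "{i, j} \<in> cycle_edges m"
  proof
    assume "j = Suc i"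
    then have "{i, j} = {i, Suc i mod m} \<and> i < m" using assms by simp
    then show ?thesis unfolding cycle_edges_def by blast
  next
    assume "i = 0 \<and> Suc j = m"
    then have "{i, j} = {j, Suc j mod m} \<and> j < m" using assms by auto
    then show ?thesis unfolding cycle_edges_def by blast
  qed
qed

lemma cycle_edges_wf:
  assumes "e \<in> cycle_edges m" "m \<ge> 2"
  shows "\<exists>i j. i < j \<and> j < m \<and> e = {i, j}"
proof -
  obtain a where a: "a < m" "e = {a, Suc a mod m}" using assms by (auto simp: cycle_edges_def)
  show ?thesis
  proof (cases "Suc a = m")
    case True
    then have "e = {0, a}" "0 < a" using a assms by auto
    then show ?thesis using a by blast
  next
    case False
    then show ?thesis using a by (intro exI[of _ a] exI[of _ "Suc a"]) auto
  qed
qed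

lemma has_induced_imp_has_csubgraph:
  assumes "has_induced_csubgraph X H"
  shows "has_csubgraph X H"
proof -
  obtain S where S: "S \<subseteq> cverts X" "cisomorphic H (cinduced X S)"
    using assms unfolding has_induced_csubgraph_def by blast
  then have "csubgraph_of (cinduced X S) X" by (simp add: csubgraph_of_def cinduced_def)
  then show ?thesis using S(2) unfolding has_csubgraph_def by blast
qed

lemma has_csubgraph_trans:
  assumes "has_csubgraph X H" "cverts K = cverts H" "antip_edges K \<subseteq> antip_edges H"
    "dom_edges K \<subseteq> dom_edges H"
  shows "has_csubgraph X K"
proof -
  obtain Y f where Y: "csubgraph_of Y X" and f: "bij_betw f (cverts H) (cverts Y)"
    "(`) f ` antip_edges H = antip_edges Y" "(`) f ` dom_edges H = dom_edges Y"
    using assms(1) unfolding has_csubgraph_def cisomorphic_def by (elim exE conjE) (rule that)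
  define Z where
    "Z = \<lparr>cverts = cverts Y, antip_edges = (`) f ` antip_edges K, dom_edges = (`) f ` dom_edges K\<rparr>"
  have "antip_edges Z \<subseteq> antip_edges Y" "dom_edges Z \<subseteq> dom_edges Y"
    using image_mono[OF assms(3), of "(`) f"] image_mono[OF assms(4), of "(`) f"] f
    by (simp_all add: Z_def)
  moreover have "cverts Z = cverts Y" by (simp add: Z_def)
  ultimately have "csubgraph_of Z X"
    using Y unfolding csubgraph_of_def by (metis order_trans)
  moreover have "cisomorphic K Z" unfolding cisomorphic_def
    by (rule exI[of _ f]) (use f assms(2) in \<open>simp add: Z_def\<close>)
  ultimately show ?thesis unfolding has_csubgraph_def by blast
qed

text \<open>The elements model classes of components of \<open>G - Q\<close>: \<open>W x\<close>
  stands for the vertices of \<open>Q\<close> attached to \<open>x\<close>, \<open>le\<close> for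
  dominance. Attachment is \<open>W x \<inter> W y \<noteq> {}\<close>; for comparable elements it
  follows from \<open>W_mono\<close> and \<open>W_ne\<close>, so that only \<open>ap\<close> has to
  mention it.\<close>

locale attachment_order =
  fixes X :: "'x set" and W :: "'x \<Rightarrow> 'q set" and le :: "'x \<Rightarrow> 'x \<Rightarrow> bool"
  assumes fin: "finite X"
    and W_ne: "x \<in> X \<Longrightarrow> W x \<noteq> {}"
    and le_refl: "x \<in> X \<Longrightarrow> le x x"
    and le_trans: "x \<in> X \<Longrightarrow> y \<in> X \<Longrightarrow> z \<in> X \<Longrightarrow> le x y \<Longrightarrow> le y z \<Longrightarrow> le x z"
    and le_antisym: "x \<in> X \<Longrightarrow> y \<in> X \<Longrightarrow> le x y \<Longrightarrow> le y x \<Longrightarrow> x = y"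
    and W_mono: "x \<in> X \<Longrightarrow> y \<in> X \<Longrightarrow> le x y \<Longrightarrow> W x \<subseteq> W y"
begin

definition ap :: "'x \<Rightarrow> 'x \<Rightarrow> bool" where
  "ap x y \<longleftrightarrow> W x \<inter> W y \<noteq> {} \<and> \<not> le x y \<and> \<not> le y x"

definition agraph :: "'x cgraph" where
  "agraph = \<lparr>cverts = X,
     antip_edges = {{x, y} | x y. x \<in> X \<and> y \<in> X \<and> ap x y},
     dom_edges = {{x, y} | x y. x \<in> X \<and> y \<in> X \<and> x \<noteq> y \<and> (le x y \<or> le y x)}\<rparr>"

definition valid :: "('x \<Rightarrow> 'c) \<Rightarrow> bool" where
  "valid f \<longleftrightarrow> (\<forall>x\<in>X. \<forall>y\<in>X. ap x y \<longrightarrow> f x \<noteq> f y) \<and>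
     (\<forall>v. card (f ` {x \<in> X. v \<in> W x}) \<le> 2)"

definition full_triangle :: bool where
  "full_triangle \<longleftrightarrow> (\<exists>x\<in>X. \<exists>y\<in>X. \<exists>z\<in>X. ap x y \<and> ap y z \<and> ap x z \<and> W x \<inter> W y \<inter> W z \<noteq> {})"

lemma ap_sym: "ap x y \<Longrightarrow> ap y x" by (auto simp: ap_def)

lemma ap_commute: "ap x y \<longleftrightarrow> ap y x" using ap_sym by blast

lemma ap_irrefl: "x \<in> X \<Longrightarrow> \<not> ap x x" by (simp add: ap_def le_refl)

lemma antip_iff: "{x, y} \<in> antip_edges agraph \<longleftrightarrow> x \<in> X \<and> y \<in> X \<and> ap x y"
  by (auto simp: agraph_def doubleton_eq_iff ap_commute)

lemma dom_iff: "{x, y} \<in> dom_edges agraph \<longleftrightarrow> x \<in> X \<and> y \<in> X \<and> x \<noteq> y \<and> (le x y \<or> le y x)"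
  by (auto simp: agraph_def doubleton_eq_iff)

lemma agraph_wf: "e \<in> antip_edges agraph \<union> dom_edges agraph \<Longrightarrow> \<exists>x y. x \<noteq> y \<and> e = {x, y}"
  by (auto simp: agraph_def) (metis ap_irrefl)

lemma cverts_agraph [simp]: "cverts agraph = X" by (simp add: agraph_def)

text \<open>\<open>W\<close> grows along \<open>le\<close>, so \<open>z\<close> remains attached to
  \<open>y\<close>; and \<open>y\<close> cannot be dominated by \<open>z\<close>, as transitivity
  would place \<open>x\<close> below \<open>z\<close>.\<close>

lemma le_ap:
  assumes "x \<in> X" "y \<in> X" "z \<in> X" "le x y" "ap x z"
  shows "le z y \<or> ap z y"
proof -
  have "W z \<inter> W y \<noteq> {}" using W_mono[of x y] assms unfolding ap_def by blast
  then show ?thesis using assms le_trans[of x y z] unfolding ap_def by blast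
qed

text \<open>Iterates \<open>le_ap\<close>: along an antipodal path, domination by \<open>y\<close>
  can only be lost at a vertex antipodal to \<open>y\<close>. This is the engine of the cycle
  arguments below.\<close>

lemma le_propagate:
  assumes X: "\<And>i. c i \<in> X" and y: "y \<in> X" and le: "le (c a) y" and ab: "a \<le> b"
    and ap: "\<And>i. a \<le> i \<Longrightarrow> i < b \<Longrightarrow> ap (c i) (c (Suc i))"
    and no: "\<And>i. a < i \<Longrightarrow> i \<le> b \<Longrightarrow> \<not> ap (c i) y"
  shows "le (c b) y"
  using ab ap no
proof (induction rule: dec_induct)
  case (step n)
  have "le (c n) y" by (rule step.IH) (use step in auto)
  then show ?case using le_ap[OF X y X, of n "Suc n"] step by auto
qed (use le in simp)

end

section \<open>Edges of the forbidden graphs as ordered pairs of indices\<close>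

lemma FF_simps:
  assumes "i < j" "j \<le> 2 * k" "k \<ge> 2"
  shows "{i, j} \<in> antip_edges (FF k) \<longleftrightarrow> j = Suc i \<or> i = 0 \<and> j = 2 * k"
    and "{i, j} \<in> dom_edges (FF k) \<longleftrightarrow> i = 0 \<and> 2 \<le> j \<and> j < 2 * k"
    and "{i, j} \<in> antip_edges (FF_tilde k) \<longleftrightarrow>
           j = Suc i \<or> i = 0 \<and> j = 2 * k \<or> i = 1 \<and> j = 2 * k"
    and "{i, j} \<in> dom_edges (FF_tilde k) \<longleftrightarrow> i = 0 \<and> 2 \<le> j \<and> j < 2 * k"
  using assms by (auto simp: FF_def FF_tilde_def doubleton_eq_iff)

lemma DF_simps:
  assumes "i < j" "j \<le> 2 * k" "k \<ge> 2"
  shows "{i, j} \<in> antip_edges (DF k) \<longleftrightarrow> j = Suc i \<or> i = 0 \<and> j = 2 * k"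
    and "{i, j} \<in> dom_edges (DF k) \<longleftrightarrow> i = 0 \<and> 2 \<le> j \<and> j < 2 * k \<or> i = 1 \<and> 3 \<le> j"
proof -
  show "{i, j} \<in> antip_edges (DF k) \<longleftrightarrow> j = Suc i \<or> i = 0 \<and> j = 2 * k"
    using assms cycle_edges_iff[of i j "2 * k + 1"] by (simp add: DF_def)
  show "{i, j} \<in> dom_edges (DF k) \<longleftrightarrow> i = 0 \<and> 2 \<le> j \<and> j < 2 * k \<or> i = 1 \<and> 3 \<le> j"
    using assms unfolding DF_def by (auto simp: doubleton_eq_iff)
qed

lemma cycle_edges_less: "{i, j} \<in> cycle_edges m \<Longrightarrow> m > 0 \<Longrightarrow> j < m"
  by (auto simp: cycle_edges_def doubleton_eq_iff)

lemma W0_simps: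
  assumes "i < j" "j \<le> 2 * k + 1"
  shows "{i, j} \<in> antip_edges (W0 k) \<longleftrightarrow> j \<le> 2 * k \<and> (j = Suc i \<or> i = 0 \<and> j = 2 * k)"
    and "{i, j} \<in> dom_edges (W0 k) \<longleftrightarrow> j = 2 * k + 1"
proof -
  have c: "{i, j} \<in> cycle_edges (2 * k + 1) \<longleftrightarrow> j \<le> 2 * k \<and> (j = Suc i \<or> i = 0 \<and> j = 2 * k)"
    using assms cycle_edges_iff[of i j "2 * k + 1"] cycle_edges_less[of i j "2 * k + 1"]
    by (cases "j < 2 * k + 1") auto
  show "{i, j} \<in> antip_edges (W0 k) \<longleftrightarrow> j \<le> 2 * k \<and> (j = Suc i \<or> i = 0 \<and> j = 2 * k)"
    using c assms by (simp add: W0_def)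
  show "{i, j} \<in> dom_edges (W0 k) \<longleftrightarrow> j = 2 * k + 1"
    using assms by (auto simp: W0_def doubleton_eq_iff)
qed

lemma W1_simps:
  assumes "i < j" "j \<le> 2 * k + 1"
  shows "{i, j} \<in> antip_edges (W1 k) \<longleftrightarrow>
           j \<le> 2 * k \<and> (j = Suc i \<or> i = 0 \<and> j = 2 * k) \<or> i = 0 \<and> j = 2 * k + 1"
    and "{i, j} \<in> dom_edges (W1 k) \<longleftrightarrow> j = 2 * k + 1 \<and> 1 \<le> i"
proof -
  have c: "{i, j} \<in> cycle_edges (2 * k + 1) \<longleftrightarrow> j \<le> 2 * k \<and> (j = Suc i \<or> i = 0 \<and> j = 2 * k)"
    using assms cycle_edges_iff[of i j "2 * k + 1"] cycle_edges_less[of i j "2 * k + 1"]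
    by (cases "j < 2 * k + 1") auto
  show "{i, j} \<in> antip_edges (W1 k) \<longleftrightarrow>
           j \<le> 2 * k \<and> (j = Suc i \<or> i = 0 \<and> j = 2 * k) \<or> i = 0 \<and> j = 2 * k + 1"
    using c assms by (auto simp: W1_def doubleton_eq_iff)
  show "{i, j} \<in> dom_edges (W1 k) \<longleftrightarrow> j = 2 * k + 1 \<and> 1 \<le> i"
    using assms by (auto simp: W1_def doubleton_eq_iff)
qed

lemma cverts_family:
  "cverts (FF k) = {0..2*k}" "cverts (FF_tilde k) = {0..2*k}" "cverts (DF k) = {0..2*k}"
  "cverts (W0 k) = {0..2*k+1}" "cverts (W1 k) = {0..2*k+1}"
  by (simp_all add: FF_def FF_tilde_def DF_def W0_def W1_def)

lemma family_F_cases: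
  assumes "H \<in> family_F"
  obtains k where "H = W0 k" "k \<ge> 1" | k where "H = W1 k" "k \<ge> 1" | k where "H = FF k" "k \<ge> 2"
    | k where "H = FF_tilde k" "k \<ge> 2" | k where "H = DF k" "k \<ge> 2"
  using assms unfolding family_F_def by blast

definition ordered_edge :: "nat cgraph \<Rightarrow> nat set \<Rightarrow> bool" where
  "ordered_edge H e \<longleftrightarrow> (\<exists>i j. i < j \<and> i \<in> cverts H \<and> j \<in> cverts H \<and> e = {i, j})"

lemma ordered_edgeI:
  "i \<noteq> j \<Longrightarrow> i \<in> cverts H \<Longrightarrow> j \<in> cverts H \<Longrightarrow> ordered_edge H {i, j}"
  unfolding ordered_edge_def by (metis insert_commute linorder_neqE_nat)

lemma cycle_edges_ordered:
  assumes "e \<in> cycle_edges m" "m \<ge> 2" "{0..<m} \<subseteq> cverts H"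
  shows "ordered_edge H e"
proof -
  obtain i j where "i < j" "j < m" "e = {i, j}" using cycle_edges_wf assms by blast
  then show ?thesis using assms(3) by (intro ordered_edgeI[of i j, folded \<open>e = _\<close>]) auto
qed

lemma family_F_wf:
  assumes "H \<in> family_F" "e \<in> antip_edges H \<union> dom_edges H"
  shows "ordered_edge H e"
  using assms(1)
proof (cases rule: family_F_cases)
  case K: (1 k)
  have "e \<in> cycle_edges (2 * k + 1) \<Longrightarrow> ordered_edge H e"
    by (rule cycle_edges_ordered[of e "2 * k + 1" H]) (use K in \<open>auto simp: cverts_family\<close>)
  then show ?thesis using K assms(2)
    by (auto simp: W0_def intro!: ordered_edgeI)
next
  case K: (2 k)
  have "e \<in> cycle_edges (2 * k + 1) \<Longrightarrow> ordered_edge H e"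
    by (rule cycle_edges_ordered[of e "2 * k + 1" H]) (use K in \<open>auto simp: cverts_family\<close>)
  then show ?thesis using K assms(2)
    by (auto simp: W1_def intro!: ordered_edgeI)
next
  case (3 k)
  then show ?thesis using assms(2) by (auto simp: FF_def intro!: ordered_edgeI)
next
  case (4 k)
  then show ?thesis using assms(2) by (auto simp: FF_def FF_tilde_def intro!: ordered_edgeI)
next
  case K: (5 k)
  have "e \<in> cycle_edges (2 * k + 1) \<Longrightarrow> ordered_edge H e"
    by (rule cycle_edges_ordered[of e "2 * k + 1" H]) (use K in \<open>auto simp: cverts_family\<close>)
  then show ?thesis using K assms(2)
    by (auto simp: DF_def intro!: ordered_edgeI)
qed

section \<open>Odd antipodal cycles with a dominance chord or a hub\<close>

context attachment_order
begin

definition forbidden :: bool where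
  "forbidden \<longleftrightarrow> (\<exists>H\<in>family_F. has_induced_csubgraph agraph H)"

lemma forbiddenI:
  assumes "H \<in> family_F"
    and "\<And>i. i \<in> cverts H \<Longrightarrow> c i \<in> X"
    and "\<And>i j. i < j \<Longrightarrow> i \<in> cverts H \<Longrightarrow> j \<in> cverts H \<Longrightarrow> c i \<noteq> c j"
    and "\<And>i j. i < j \<Longrightarrow> i \<in> cverts H \<Longrightarrow> j \<in> cverts H \<Longrightarrow>
          {i, j} \<in> antip_edges H \<longleftrightarrow> ap (c i) (c j)"
    and "\<And>i j. i < j \<Longrightarrow> i \<in> cverts H \<Longrightarrow> j \<in> cverts H \<Longrightarrow>
          {i, j} \<in> dom_edges H \<longleftrightarrow> le (c i) (c j) \<or> le (c j) (c i)"
  shows forbidden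
proof -
  have "has_induced_csubgraph agraph H"
  proof (rule has_induced_csubgraphI[where c = c])
    show "c ` cverts H \<subseteq> cverts agraph" using assms(2) by auto
    show "\<exists>i j. i < j \<and> i \<in> cverts H \<and> j \<in> cverts H \<and> e = {i, j}"
      if "e \<in> antip_edges H \<union> dom_edges H" for e
      using family_F_wf[OF assms(1) that] by (simp add: ordered_edge_def)
  qed (use assms agraph_wf in \<open>auto simp: antip_iff dom_iff\<close>)
  then show ?thesis using assms(1) unfolding forbidden_def by blast
qed

text \<open>Induced refers to the antipodality graph only: dominance chords are left open, since
  they decide which forbidden graph appears.\<close>

definition induced_cycle :: "nat \<Rightarrow> (nat \<Rightarrow> 'x) \<Rightarrow> bool" where
  "induced_cycle n c \<longleftrightarrow> odd n \<and> (\<forall>i. c (i + n) = c i) \<and> (\<forall>i. c i \<in> X) \<and>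
     (\<forall>i j. i < j \<and> j < i + n \<longrightarrow> c i \<noteq> c j \<and>
        (ap (c i) (c j) \<longleftrightarrow> j = Suc i \<or> Suc j = i + n))"

lemma induced_cycle_shift:
  assumes "induced_cycle n c"
  shows "induced_cycle n (\<lambda>i. c (i + s))"
proof -
  have "c (i + n + s) = c (i + s)" for i
    using assms unfolding induced_cycle_def by (metis add.assoc add.commute)
  then show ?thesis using assms unfolding induced_cycle_def by (simp add: add.commute add.left_commute)
qed

text \<open>Apart from \<open>0\<close> itself, the positions not antipodal to position
  \<open>0\<close> are \<open>2, ..., n - 2\<close>, which form an arc. Domination by
  \<open>c 0\<close> spreads from one of them over the whole arc, in both directions.\<close>

lemma induced_cycle_top:
  assumes c: "induced_cycle n c" and "le (c a) (c 0)" "2 \<le> a" "a + 2 \<le> n" "2 \<le> k" "k + 2 \<le> n"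
  shows "le (c k) (c 0)"
proof -
  have X: "c i \<in> X" for i using c by (simp add: induced_cycle_def)
  have ap: "ap (c i) (c (Suc i))" if "Suc i < n" for i
    using c that unfolding induced_cycle_def by simp
  have no: "\<not> ap (c i) (c 0)" if "2 \<le> i" "i + 2 \<le> n" for i
  proof -
    have "\<not> ap (c 0) (c i)" using c that unfolding induced_cycle_def by auto
    then show ?thesis using ap_sym by blast
  qed
  show ?thesis
  proof (cases "a \<le> k")
    case True
    show ?thesis by (rule le_propagate[of c _ a]) (use X assms True ap no in auto)
  next
    case False
    \<comment> \<open>\<open>le_propagate\<close> runs towards larger indices, so the descent from
      \<open>a\<close> to \<open>k\<close> uses the reversed sequence; \<open>a - (a - k)\<close> is
      \<open>k\<close>.\<close>
    have "le (c (a - (a - k))) (c 0)"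
    proof (rule le_propagate[of "\<lambda>i. c (a - i)" _ 0])
      show "ap (c (a - i)) (c (a - Suc i))" if "i < a - k" for i
      proof -
        have "Suc (a - Suc i) = a - i" "Suc (a - Suc i) < n" using that assms(4) by linarith+
        then show ?thesis using ap[of "a - Suc i"] ap_sym by simp
      qed
    qed (use X assms False no in auto)
    then show ?thesis using False by simp
  qed
qed

text \<open>A chordless odd antipodal cycle with a dominance chord: the dominating vertex dominates
  all the vertices but its two neighbours on the cycle, by propagating \<open>le_ap\<close> along the
  cycle. Since dominance is antisymmetric, at most two (consecutive) vertices dominate
  something, so that the cycle induces \<open>FF\<close> or \<open>DF\<close>.\<close>

lemma induced_cycle_dominance:
  assumes c: "induced_cycle n c" and n: "n \<ge> 5" and le: "le (c i) (c j)" "c i \<noteq> c j"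
  shows forbidden
proof -
  define top where "top d b \<longleftrightarrow> (\<exists>a. 2 \<le> a \<and> a + 2 \<le> n \<and> le (d (a + b)) (d b))" for d :: "nat \<Rightarrow> 'x" and b
  have X: "c i \<in> X" for i using c by (simp add: induced_cycle_def)
  have odd: "odd n" using c by (simp add: induced_cycle_def)
  define k where "k = n div 2"
  have k: "n = 2 * k + 1" "k \<ge> 2" using odd n by (auto simp: k_def elim!: oddE)
  have topI: "top d b" if d: "induced_cycle n d" and "le (d i) (d b)" "d i \<noteq> d b" for d i b
  proof -
    have per: "d (i + n) = d i" for i using d by (simp add: induced_cycle_def)
    have ch: "i < j \<Longrightarrow> j < i + n \<Longrightarrow> ap (d i) (d j) \<longleftrightarrow> j = Suc i \<or> Suc j = i + n" for i j
      using d unfolding induced_cycle_def by blast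
    have perm: "d (i + m * n) = d i" for i m
      by (induction m) (simp_all add: per add.assoc[symmetric] add.commute[of n])
    have "\<exists>a<n. d i = d (a + b)"
    proof -
      \<comment> \<open>Modulo \<open>n\<close>, \<open>b * (n - 1)\<close> is \<open>- b\<close>.
        So \<open>?a\<close> is the forward distance from \<open>b\<close> to \<open>i\<close> on
        the cycle, also when \<open>i < b\<close>.\<close>
      let ?a = "(i + b * (n - 1)) mod n"
      have "d (?a + b) = d (?a + b + ((i + b * (n - 1)) div n) * n)" by (rule perm[symmetric])
      also have "?a + b + ((i + b * (n - 1)) div n) * n = i + b * (n - 1) + b"
        by (metis add.assoc add.commute mod_div_mult_eq)
      also have "\<dots> = i + b * n" using n by (cases n) auto
      also have "d \<dots> = d i" using perm by simp
      finally show ?thesis using n by (intro exI[of _ ?a]) auto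
    qed
    then obtain a where a: "a < n" "d i = d (a + b)" by blast
    have nap: "\<not> ap (d (a + b)) (d b)" using that a by (auto simp: ap_def)
    have "a \<noteq> 0" using that a by (intro notI) simp
    moreover have "ap (d b) (d (Suc b))" using ch[of b "Suc b"] n by auto
    moreover have "ap (d b) (d (b + n - 1))" using ch[of b "b + n - 1"] n by auto
    ultimately have "a \<noteq> 0" "a \<noteq> 1" "a \<noteq> n - 1" using nap n ap_sym by (auto simp: add.commute)
    then have "2 \<le> a" "a + 2 \<le> n" using a by auto
    then show ?thesis using a that unfolding top_def by auto
  qed
  have topD: "le (d (m + b)) (d b)" if "top d b" "2 \<le> m" "m + 2 \<le> n" "induced_cycle n d" for d b m
    using that induced_cycle_top[OF induced_cycle_shift[OF that(4), of b]] unfolding top_def by auto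
  define d where "d = (\<lambda>i. c (i + j))"
  have d: "induced_cycle n d" unfolding d_def by (rule induced_cycle_shift[OF c])
  have td: "top d 0" using topI[OF c le] unfolding top_def d_def by simp
  \<comment> \<open>Normal form: only the positions \<open>0\<close> and \<open>1\<close> can
    dominate anything. Position \<open>1\<close> then decides between \<open>DF k\<close> and
    \<open>FF k\<close>.\<close>
  have main: forbidden if e: "induced_cycle n e" and t0: "top e 0"
    and t1: "\<And>b. 2 \<le> b \<Longrightarrow> b < n \<Longrightarrow> \<not> top e b" for e
  proof -
    have eX: "\<And>i. e i \<in> X" and en: "\<And>i j. i < j \<Longrightarrow> j < n \<Longrightarrow> e i \<noteq> e j"
      and ea: "\<And>i j. i < j \<Longrightarrow> j < n \<Longrightarrow> ap (e i) (e j) \<longleftrightarrow> j = Suc i \<or> i = 0 \<and> Suc j = n"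
      using e unfolding induced_cycle_def by auto
    have le0: "le (e m) (e 0)" if "2 \<le> m" "m + 2 \<le> n" for m using topD[OF t0 that e] by simp
    have nole: "\<not> le (e i) (e b)" if "2 \<le> b" "b < n" "i < n" "i \<noteq> b" for i b
      using topI[OF e, of i b] t1[OF that(1,2)] that en by (metis linorder_neqE_nat)
    show ?thesis
    proof (cases "top e 1")
      case True
      have le1: "le (e m) (e 1)" if "3 \<le> m" "m < n" for m
        using topD[OF True _ _ e, of "m - 1"] that by simp
      have no01: "\<not> le (e 0) (e 1)" "\<not> le (e 1) (e 0)" using ea[of 0 1] n by (auto simp: ap_def)
      have no12: "\<not> le (e 1) (e 2)" "\<not> le (e 2) (e 1)" using ea[of 1 2] n by (auto simp: ap_def)
      have no0: "\<not> le (e 0) (e (n - 1))" "\<not> le (e (n - 1)) (e 0)" using ea[of 0 "n - 1"] n by (auto simp: ap_def)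
      show ?thesis
      proof (rule forbiddenI[of "DF k" e])
        show "DF k \<in> family_F" using k unfolding family_F_def by blast
        fix i j assume ij: "i < j" "i \<in> cverts (DF k)" "j \<in> cverts (DF k)"
        then have j: "j \<le> 2 * k" "j < n" using k by (auto simp: cverts_family)
        show "e i \<noteq> e j" using en ij j by blast
        show "({i, j} \<in> antip_edges (DF k)) = ap (e i) (e j)"
          using DF_simps(1)[OF ij(1) j(1) k(2)] ea[OF ij(1) j(2)] k by auto
        consider "i = 0" "j = 1" | "i = 0" "j = n - 1" | "i = 0" "2 \<le> j" "j + 2 \<le> n"
          | "i = 1" "j = 2" | "i = 1" "3 \<le> j" | "2 \<le> i" using ij j by linarith
        then show "({i, j} \<in> dom_edges (DF k)) = (le (e i) (e j) \<or> le (e j) (e i))"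
          unfolding DF_simps(2)[OF ij(1) j(1) k(2)]
        proof cases
          case 6
          then show "(i = 0 \<and> 2 \<le> j \<and> j < 2 * k \<or> i = 1 \<and> 3 \<le> j) = (le (e i) (e j) \<or> le (e j) (e i))"
            using nole[of i j] nole[of j i] ij j by auto
        qed (use no01 no12 no0 le0 le1 ij j k n in auto)
      qed (use eX in simp)
    next
      case False
      have nole1: "\<not> le (e i) (e 1)" if "i < n" "i \<noteq> 1" for i
        using topI[OF e, of i 1] False that en[of i 1] en[of 1 i] n by (cases "i < 1") auto
      have no0: "\<not> le (e 0) (e (n - 1))" "\<not> le (e (n - 1)) (e 0)" using ea[of 0 "n - 1"] n by (auto simp: ap_def)
      have no01: "\<not> le (e 0) (e 1)" "\<not> le (e 1) (e 0)" using ea[of 0 1] n by (auto simp: ap_def)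
      show ?thesis
      proof (rule forbiddenI[of "FF k" e])
        show "FF k \<in> family_F" using k unfolding family_F_def by blast
        fix i j assume ij: "i < j" "i \<in> cverts (FF k)" "j \<in> cverts (FF k)"
        then have j: "j \<le> 2 * k" "j < n" using k by (auto simp: cverts_family)
        show "e i \<noteq> e j" using en ij j by blast
        show "({i, j} \<in> antip_edges (FF k)) = ap (e i) (e j)"
          using FF_simps(1)[OF ij(1) j(1) k(2)] ea[OF ij(1) j(2)] k by auto
        consider "i = 0" "j = 1" | "i = 0" "j = n - 1" | "i = 0" "2 \<le> j" "j + 2 \<le> n"
          | "i = 1" | "2 \<le> i" using ij j by linarith
        then show "({i, j} \<in> dom_edges (FF k)) = (le (e i) (e j) \<or> le (e j) (e i))"
          unfolding FF_simps(2)[OF ij(1) j(1) k(2)]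
        proof cases
          case 4
          then show "(i = 0 \<and> 2 \<le> j \<and> j < 2 * k) = (le (e i) (e j) \<or> le (e j) (e i))"
            using nole[of j i] nole1[of j] ij j nole[of i j] by auto
        next
          case 5
          then show "(i = 0 \<and> 2 \<le> j \<and> j < 2 * k) = (le (e i) (e j) \<or> le (e j) (e i))"
            using nole[of i j] nole[of j i] ij j by auto
        qed (use no01 no0 le0 ij j k n in auto)
      qed (use eX in simp)
    qed
  qed
  have dX: "\<And>i. d i \<in> X" and dper: "\<And>i. d (i + n) = d i" and dn: "\<And>i j. i < j \<Longrightarrow> j < i + n \<Longrightarrow> d i \<noteq> d j"
    using d unfolding induced_cycle_def by auto
  \<comment> \<open>Two dominating positions at distance at least two in both directions would
    dominate each other, against antisymmetry.\<close>
  have anti: "\<not> (top d a \<and> top d b)" if "a + 2 \<le> b" "b + 2 \<le> a + n" for a b :: nat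
  proof
    assume t: "top d a \<and> top d b"
    have "le (d (b - a + a)) (d a)" using topD[of d a "b - a"] t d that by auto
    moreover have "le (d (a + n - b + b)) (d b)" using topD[of d b "a + n - b"] t d that by auto
    ultimately have "d a = d b" using that dper[of a] le_antisym dX by simp
    then show False using dn[of a b] that n by simp
  qed
  show ?thesis
  proof (cases "top d (n - 1)")
    case False
    have "\<not> top d b" if "2 \<le> b" "b < n" for b
    proof (cases "b = n - 1")
      case f: False
      then show ?thesis using anti[of 0 b] td that by auto
    qed (use False in simp)
    then show ?thesis using main[OF d td] by blast
  next
    case True
    \<comment> \<open>When position \<open>n - 1\<close> dominates as well, restarting the cycle
      there moves the two dominating positions to \<open>0\<close> and \<open>1\<close>.\<close>
    define e where "e = (\<lambda>i. d (i + (n - 1)))"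
    have e: "induced_cycle n e" unfolding e_def by (rule induced_cycle_shift[OF d])
    have te: "top e b \<longleftrightarrow> top d (b + (n - 1))" for b by (simp add: top_def e_def add.assoc)
    have "\<not> top e b" if "2 \<le> b" "b < n" for b
    proof
      assume t: "top e b"
      show False
      proof (cases "b = n - 1")
        case False
        then have "n - 1 + 2 \<le> b + (n - 1)" "b + (n - 1) + 2 \<le> n - 1 + n" using that by linarith+
        then show False using t True te anti[of "n - 1" "b + (n - 1)"] by blast
      next
        case b: True
        have "d (i + (n - 2 + n)) = d (i + (n - 2))" for i
          using dper[of "i + (n - 2)"] by (simp add: add.assoc)
        moreover have "b + (n - 1) = n - 2 + n" using b n by auto
        ultimately have "top d (n - 2)" using t te[of b] unfolding top_def by (metis (no_types, lifting) add.left_neutral)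
        moreover have "0 + 2 \<le> n - 2" "n - 2 + 2 \<le> 0 + n" using n by linarith+
        ultimately show False using anti[of 0 "n - 2"] td by blast
      qed
    qed
    moreover have "top e 0" using True te[of 0] by simp
    ultimately show ?thesis using main[OF e] by blast
  qed
qed

end

section \<open>The bipartition problem at a maximal element\<close>

context attachment_order
begin

definition maximal :: "'x \<Rightarrow> bool" where
  "maximal u \<longleftrightarrow> u \<in> X \<and> (\<forall>y\<in>X. le u y \<longrightarrow> y = u)"

text \<open>A dominance chord on a cycle of length at least five already yields a forbidden graph,
  and a triangle has no chords. Otherwise the cycle carries antipodal edges only, and
  \<open>u\<close> completes it to \<open>W0\<close> or \<open>W1\<close>, according to the relation
  of \<open>c 0\<close> to \<open>u\<close>.\<close>

lemma induced_cycle_hub: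
  assumes c: "induced_cycle n c" and n: "n \<ge> 3" and u: "u \<in> X"
    and hub: "\<And>i. i < n \<Longrightarrow> i \<noteq> 0 \<Longrightarrow> le (c i) u \<and> c i \<noteq> u"
    and hub0: "le (c 0) u \<and> c 0 \<noteq> u \<or> ap (c 0) u"
  shows forbidden
proof (cases "n \<ge> 5 \<and> (\<exists>i j. le (c i) (c j) \<and> c i \<noteq> c j)")
  case True
  then show ?thesis using induced_cycle_dominance[OF c] by blast
next
  case False
  have odd: "odd n" and cX: "\<And>i. c i \<in> X" and cn: "\<And>i j. i < j \<Longrightarrow> j < n \<Longrightarrow> c i \<noteq> c j"
    and ca: "\<And>i j. i < j \<Longrightarrow> j < n \<Longrightarrow> ap (c i) (c j) \<longleftrightarrow> j = Suc i \<or> i = 0 \<and> Suc j = n"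
    using c unfolding induced_cycle_def by auto
  define k where "k = n div 2"
  have k: "n = 2 * k + 1" "k \<ge> 1" using odd n by (auto simp: k_def elim!: oddE)
  have nole: "\<not> le (c i) (c j) \<and> \<not> le (c j) (c i)" if "i < j" "j < n" for i j
  proof (cases "n \<ge> 5")
    case True
    then show ?thesis using False cn[OF that] by metis
  next
    case f: False
    then have "n = 3" using k by presburger
    then have "ap (c i) (c j)" using ca[OF that] that by auto
    then show ?thesis by (simp add: ap_def)
  qed
  \<comment> \<open>\<open>n = 2 * k + 1\<close> is the index of the hub in \<open>W0 k\<close> and
    \<open>W1 k\<close>.\<close>
  define e where "e i = (if i = n then u else c i)" for i
  have en: "e i \<noteq> e j" if "i < j" "j \<le> n" for i j
    using that cn[of i j] hub[of i] hub0 ap_irrefl[OF u] by (cases "i = 0") (auto simp: e_def)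
  from hub0 show ?thesis
  proof
    assume h: "le (c 0) u \<and> c 0 \<noteq> u"
    have hub': "le (c i) u" if "i < n" for i using hub[of i] h that by (cases "i = 0") auto
    show ?thesis
    proof (rule forbiddenI[of "W0 k" e])
      show "W0 k \<in> family_F" using k unfolding family_F_def by blast
      fix i j assume ij: "i < j" "i \<in> cverts (W0 k)" "j \<in> cverts (W0 k)"
      then have j: "j \<le> 2 * k + 1" by (auto simp: cverts_family)
      show "e i \<noteq> e j" using en ij j k by simp
      show "({i, j} \<in> antip_edges (W0 k)) = ap (e i) (e j)"
        unfolding W0_simps(1)[OF ij(1) j] using ca[of i j] hub'[of i] ij j k by (auto simp: e_def ap_def)
      show "({i, j} \<in> dom_edges (W0 k)) = (le (e i) (e j) \<or> le (e j) (e i))"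
        unfolding W0_simps(2)[OF ij(1) j] using nole[of i j] hub'[of i] ij j k by (auto simp: e_def)
    qed (use u cX in \<open>simp add: e_def\<close>)
  next
    assume h: "ap (c 0) u"
    have hub': "le (c i) u" if "i < n" "i \<noteq> 0" for i using hub[of i] that by auto
    show ?thesis
    proof (rule forbiddenI[of "W1 k" e])
      show "W1 k \<in> family_F" using k unfolding family_F_def by blast
      fix i j assume ij: "i < j" "i \<in> cverts (W1 k)" "j \<in> cverts (W1 k)"
      then have j: "j \<le> 2 * k + 1" by (auto simp: cverts_family)
      show "e i \<noteq> e j" using en ij j k by simp
      show "({i, j} \<in> antip_edges (W1 k)) = ap (e i) (e j)"
        unfolding W1_simps(1)[OF ij(1) j] using ca[of i j] hub'[of i] h ij j k by (auto simp: e_def ap_def)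
      show "({i, j} \<in> dom_edges (W1 k)) = (le (e i) (e j) \<or> le (e j) (e i))"
        unfolding W1_simps(2)[OF ij(1) j] using nole[of i j] hub'[of i] h ij j k by (cases "j = n"; cases "i = 0") (auto simp: e_def ap_def)
    qed (use u cX in \<open>simp add: e_def\<close>)
  qed
qed

text \<open>In a valid colouring the vertices antipodal to a maximal \<open>u\<close> do not get the colour of \<open>u\<close>.
  So the colour of \<open>u\<close> is used by one side of a bipartition of the antipodality graph on the
  vertices attached to \<open>u\<close>, where edges between two vertices antipodal to \<open>u\<close> are dropped.\<close>

definition local_edge :: "'x \<Rightarrow> 'x \<Rightarrow> 'x \<Rightarrow> bool" where
  "local_edge u x y \<longleftrightarrow> x \<in> X \<and> y \<in> X \<and> ap x y \<and>
     (le x u \<or> ap x u) \<and> (le y u \<or> ap y u) \<and> \<not> (ap x u \<and> ap y u)"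

lemma local_edge_sym: "symp (local_edge u)"
  by (auto simp: symp_def local_edge_def ap_sym)

context
  fixes u n c
  assumes u: "maximal u" and c: "min_odd_walk (local_edge u) n c"
begin

lemma local_walk:
  "odd n" "n \<ge> 3" "c (i + n) = c i" "c i \<in> X" "le (c i) u \<or> ap (c i) u"
  "local_edge u (c i) (c (Suc i))"
proof -
  have w: "odd_walk (local_edge u) n c" using c by (simp add: min_odd_walk_def)
  then show "odd n" "c (i + n) = c i" and e: "local_edge u (c i) (c (Suc i))" by (simp_all add: odd_walk_def)
  then show "c i \<in> X" "le (c i) u \<or> ap (c i) u" by (simp_all add: local_edge_def)
  have "n \<noteq> 1"
  proof
    assume "n = 1"
    then have "c 1 = c 0" using w unfolding odd_walk_def by (metis add_0)
    moreover have "ap (c 0) (c 1)" "c 0 \<in> X" using w unfolding odd_walk_def local_edge_def by auto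
    ultimately show False using ap_irrefl by metis
  qed
  then show "n \<ge> 3" using \<open>odd n\<close> by (cases n) (auto elim!: oddE)
qed

lemma local_walk_chordless:
  assumes "i < j" "j < i + n"
  shows "c i \<noteq> c j" "local_edge u (c i) (c j) \<longleftrightarrow> j = Suc i \<or> Suc j = i + n"
proof -
  show "c i \<noteq> c j" by (rule min_odd_walk_inj[OF c assms])
  have "local_edge u (c j) (c (Suc j))" by (rule local_walk)
  then have "Suc j = i + n \<Longrightarrow> local_edge u (c i) (c j)"
    using local_walk(3)[of i] local_edge_sym by (metis sympD)
  then show "local_edge u (c i) (c j) \<longleftrightarrow> j = Suc i \<or> Suc j = i + n"
    using min_odd_walk_chordless[OF c assms _ local_edge_sym] local_walk(6) by blast
qed

text \<open>On the vertices of the walk, local edges and antipodal pairs differ only in pairs whose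
  members are both antipodal to \<open>u\<close>. Once no such pair is antipodal, chordlessness for
  \<open>local_edge\<close> is chordlessness for \<open>ap\<close>.\<close>

lemma local_walk_induced_cycle:
  assumes "\<And>i j. i < j \<Longrightarrow> j < i + n \<Longrightarrow> ap (c i) (c j) \<Longrightarrow> \<not> (ap (c i) u \<and> ap (c j) u)"
  shows "induced_cycle n c"
  unfolding induced_cycle_def
  using local_walk local_walk_chordless assms unfolding local_edge_def
  by (intro conjI allI impI) (blast+)

text \<open>An odd arc between two vertices antipodal to \<open>u\<close> closes up through
  \<open>u\<close> with two further edges, so by minimality it has at least \<open>n - 2\<close>
  edges. The other arc then has exactly two, and its middle vertex can be replaced by
  \<open>u\<close>.\<close>

lemma local_walk_via_max:
  assumes "i < j" "j < i + n" "ap (c i) u" "ap (c j) u"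
  shows "\<exists>d. min_odd_walk (local_edge u) n d \<and> d 0 = u"
proof -
  let ?E = "local_edge u"
  have uX: "u \<in> X" "le u u" using u le_refl by (auto simp: maximal_def)
  have Eu: "?E u (c a)" "?E (c a) u" if "ap (c a) u" for a
    using that uX local_walk(4) ap_irrefl ap_sym unfolding local_edge_def by blast+
  have w: "odd_walk ?E n c" using c by (simp add: min_odd_walk_def)
  have cn: "c (a + m * n) = c a" for a m by (rule odd_walk_mult[OF w])
  have arc: "n \<le> m + 2" if "odd m" "ap (c a) u" "ap (c (a + m)) u" for a m
  proof -
    have "(?E ^^ m) (c a) (c (a + m))" by (rule odd_walk_relpowp[OF w])
    then have "(?E ^^ Suc m) u (c (a + m))" using Eu(1)[OF that(2)] relpowp_Suc_I2 by metis
    then have "(?E ^^ Suc (Suc m)) u u" using Eu(2)[OF that(3)] relpowp_Suc_I by metis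
    then show ?thesis using min_odd_walk_le[OF c, of "Suc (Suc m)" u] that(1) by simp
  qed
  have "\<exists>s. ap (c s) u \<and> ap (c (s + 2)) u"
  proof (cases "odd (j - i)")
    case True
    then have "n \<le> j - i + 2" using arc[of "j - i" i] assms by simp
    then have "i + n = j + 2" using True assms local_walk(1) by presburger
    then show ?thesis using assms local_walk(3)[of i] by metis
  next
    case False
    then have "odd (i + n - j)" using local_walk(1) assms by presburger
    then have "n \<le> i + n - j + 2" using arc[of "i + n - j" j] assms local_walk(3)[of i] by simp
    then have "j = i + 2" using False assms by presburger
    then show ?thesis using assms by blast
  qed
  then obtain s where s: "ap (c s) u" "ap (c (s + 2)) u" by blast
  \<comment> \<open>The replaced position \<open>s + 1\<close> becomes position \<open>0\<close> of
    the new walk.\<close>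
  define d where "d k = (if k mod n = 0 then u else c (s + 1 + k))" for k
  have "?E (d k) (d (Suc k))" for k
  proof -
    consider "k mod n = 0" | "Suc k mod n = 0" | "k mod n \<noteq> 0" "Suc k mod n \<noteq> 0" by blast
    then show ?thesis
    proof cases
      case 1
      then obtain m where m: "k = m * n" by (metis dvdE mod_eq_0_iff_dvd mult.commute)
      then have "Suc k mod n \<noteq> 0" using local_walk(2) by (auto simp: mod_Suc)
      moreover have "c (s + 1 + Suc k) = c (s + 2)" using cn[of "s + 2" m] m by simp
      ultimately show ?thesis using 1 Eu(1)[OF s(2)] by (simp add: d_def)
    next
      case 2
      then obtain m where m: "Suc k = m * n" by (metis dvdE mod_eq_0_iff_dvd mult.commute)
      have "k mod n \<noteq> 0" using 2 local_walk(2) by (auto simp: mod_Suc split: if_splits)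
      moreover have sk: "s + 1 + k = s + m * n" using m by simp
      have "c (s + 1 + k) = c s" unfolding sk by (rule cn)
      ultimately show ?thesis using 2 Eu(2)[OF s(1)] by (simp add: d_def)
    next
      case 3
      then show ?thesis using local_walk(6)[of "s + 1 + k"] by (simp add: d_def)
    qed
  qed
  moreover have "d (k + n) = d k" for k
    using local_walk(3)[of "s + 1 + k"] by (simp add: d_def add.assoc)
  ultimately have "odd_walk ?E n d" using local_walk(1) by (simp add: odd_walk_def)
  then have "min_odd_walk ?E n d" using c by (simp add: min_odd_walk_def)
  moreover have "d 0 = u" by (simp add: d_def)
  ultimately show ?thesis by blast
qed

text \<open>The two neighbours \<open>c 1\<close> and \<open>c (n - 1)\<close> of \<open>u\<close>
  are the only vertices of the walk antipodal to \<open>u\<close>, and \<open>u\<close> dominates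
  all others. If these two are not antipodal, the cycle is induced and has a dominance chord at
  \<open>u\<close>. If they are, no dominance beyond that by \<open>u\<close> can occur, which
  leaves \<open>FF_tilde\<close>.\<close>

lemma local_walk_through_max:
  assumes c0: "c 0 = u" and nf: "\<not> full_triangle"
  shows forbidden
proof -
  have uX: "u \<in> X" and uu: "le u u" and umax: "\<And>y. y \<in> X \<Longrightarrow> le u y \<Longrightarrow> y = u"
    using u le_refl by (auto simp: maximal_def)
  have cX: "c i \<in> X" for i by (rule local_walk)
  have cne: "c i \<noteq> c j" if "i < j" "j < n" for i j using local_walk_chordless(1)[of i j] that by simp
  have ce: "local_edge u (c i) (c j) \<longleftrightarrow> j = Suc i \<or> i = 0 \<and> Suc j = n" if "i < j" "j < n" for i j
    using local_walk_chordless(2)[of i j] that by auto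
  have a1: "ap (c i) u" if "i = 1 \<or> Suc i = n" for i
  proof -
    have "local_edge u u (c i)" using ce[of 0 i] that local_walk(2) c0 by auto
    moreover have "\<not> le (c i) u \<or> \<not> ap u (c i)" by (auto simp: ap_def)
    ultimately show ?thesis unfolding local_edge_def by blast
  qed
  \<comment> \<open>In a triangle \<open>c 1\<close> and \<open>c 2\<close> would both be antipodal
    to \<open>u\<close>, and such pairs are not local edges.\<close>
  have "n \<noteq> 3"
  proof
    assume "n = 3"
    then have "local_edge u (c 1) (c 2)" "ap (c 1) u" "ap (c 2) u" using ce[of 1 2] a1 by auto
    then show False by (simp add: local_edge_def)
  qed
  then have n5: "n \<ge> 5" using local_walk(1,2) by presburger
  have inner: "le (c i) u \<and> c i \<noteq> u \<and> \<not> ap (c i) u" if "2 \<le> i" "i + 2 \<le> n" for i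
  proof -
    have "\<not> local_edge u u (c i)" using ce[of 0 i] c0 that by auto
    then have "\<not> ap (c i) u" using uX uu cX ap_irrefl[OF uX] unfolding local_edge_def by (metis ap_sym)
    then show ?thesis using local_walk(5)[of i] cne[of 0 i] c0 that by auto
  qed
  have eq: "local_edge u (c i) (c j) \<longleftrightarrow> ap (c i) (c j)" if "2 \<le> i" "i + 2 \<le> n" for i j
    using inner[OF that] local_walk(5) cX unfolding local_edge_def by blast
  have eq': "local_edge u (c j) (c i) \<longleftrightarrow> ap (c j) (c i)" if "2 \<le> i" "i + 2 \<le> n" for i j
    using inner[OF that] local_walk(5) cX unfolding local_edge_def by blast
  show ?thesis
  proof (cases "ap (c 1) (c (n - 1))")
    case False
    have "induced_cycle n c"
    proof (rule local_walk_induced_cycle)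
      fix i j assume ij: "i < j" "j < i + n" "ap (c i) (c j)"
      show "\<not> (ap (c i) u \<and> ap (c j) u)"
      proof
        assume a: "ap (c i) u \<and> ap (c j) u"
        have per: "c (k mod n) = c k" for k
          using c odd_walk_mod by (auto simp: min_odd_walk_def)
        have m: "k mod n = 1 \<or> Suc (k mod n) = n" if "ap (c k) u" for k
        proof -
          have "k mod n < n" using local_walk(2) by simp
          moreover have "k mod n \<noteq> 0" using that per[of k] c0 ap_irrefl[OF uX] by metis
          moreover have "\<not> (2 \<le> k mod n \<and> k mod n + 2 \<le> n)" using inner[of "k mod n"] that per[of k] by auto
          ultimately show ?thesis by linarith
        qed
        have "c i \<noteq> c j" using local_walk_chordless(1)[OF ij(1,2)] .
        then have "i mod n \<noteq> j mod n" using per by metis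
        then have "{i mod n, j mod n} = {1, n - 1}" using m[of i] m[of j] a local_walk(2) by auto
        then show False using False ij(3) per[of i] per[of j] ap_sym by (auto simp: doubleton_eq_iff)
      qed
    qed
    moreover have "le (c 2) (c 0)" "c 2 \<noteq> c 0" using inner[of 2] c0 n5 by auto
    ultimately show ?thesis using induced_cycle_dominance n5 by blast
  next
    case ap1: True
    \<comment> \<open>A common vertex of \<open>W (c i)\<close> and \<open>W z\<close> also lies in
      \<open>W y\<close> and \<open>W u\<close> by monotonicity, so \<open>y\<close>,
      \<open>z\<close> and \<open>u\<close> would form a full antipodal triangle.\<close>
    have tri: False if tr: "2 \<le> i" "i + 2 \<le> n" "{y, z} = {c 1, c (n - 1)}" "le (c i) y" "ap (c i) z" for i y z
    proof -
      have yz: "y \<in> X" "z \<in> X" "ap y u" "ap z u" "ap y z"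
        using tr(3) a1[of 1] a1[of "n - 1"] cX ap1 ap_sym local_walk(2) by (auto simp: doubleton_eq_iff)
      obtain v where v: "v \<in> W (c i)" "v \<in> W z" using tr(5) by (auto simp: ap_def)
      have "v \<in> W y" "v \<in> W u" using W_mono[of "c i"] v tr(4) inner[OF tr(1,2)] yz cX uX by blast+
      then have full_triangle unfolding full_triangle_def using yz uX v ap_sym by blast
      then show False using nf by simp
    qed
    \<comment> \<open>Propagation carries the dominance to \<open>c (n - 2)\<close>, which is
      antipodal to \<open>c (n - 1)\<close>: the situation of \<open>tri\<close>. \<open>dn'\<close>
      is the mirror image.\<close>
    have dn: "\<not> le (c i) (c 1)" if i: "3 \<le> i" "i + 2 \<le> n" for i
    proof
      assume l: "le (c i) (c 1)"
      have "le (c (n - 2)) (c 1)"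
      proof (rule le_propagate[of c _ i])
        show "ap (c k) (c (Suc k))" for k using local_walk(6)[of k] by (simp add: local_edge_def)
        show "\<not> ap (c k) (c 1)" if "i < k" "k \<le> n - 2" for k
        proof -
          have "2 \<le> k" "k + 2 \<le> n" using that i by linarith+
          then show ?thesis using eq'[of k 1] ce[of 1 k] that i ap_sym by auto
        qed
      qed (use cX l i in auto)
      moreover have "ap (c (n - 2)) (c (n - 1))"
        using local_walk(6)[of "n - 2"] n5 by (simp add: local_edge_def Suc_diff_le numeral_2_eq_2 Suc_diff_Suc)
      moreover have "2 \<le> n - 2" "n - 2 + 2 \<le> n" using n5 by linarith+
      ultimately show False using tri[of "n - 2" "c 1" "c (n - 1)"] by blast
    qed
    have dn': "\<not> le (c i) (c (n - 1))" if i: "2 \<le> i" "i + 3 \<le> n" for i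
    proof
      assume l: "le (c i) (c (n - 1))"
      have "le (c (i - (i - 2))) (c (n - 1))"
      proof (rule le_propagate[of "\<lambda>k. c (i - k)" _ 0])
        show "ap (c (i - k)) (c (i - Suc k))" if "0 \<le> k" "k < i - 2" for k
        proof -
          have "Suc (i - Suc k) = i - k" using that by linarith
          then show ?thesis using local_walk(6)[of "i - Suc k"] ap_sym by (simp add: local_edge_def)
        qed
        show "\<not> ap (c (i - k)) (c (n - 1))" if "0 < k" "k \<le> i - 2" for k
        proof -
          have "2 \<le> i - k" "i - k + 2 \<le> n" "i - k < n - 1" "n - 1 < n" "n - 1 \<noteq> Suc (i - k)" "i - k \<noteq> 0"
            using that i by linarith+
          then show ?thesis using eq[of "i - k" "n - 1"] ce[of "i - k" "n - 1"] by auto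
        qed
      qed (use cX l i in auto)
      then have "le (c 2) (c (n - 1))" using i by simp
      moreover have "ap (c 2) (c 1)"
        using local_walk(6)[of 1] ap_sym by (simp add: local_edge_def numeral_2_eq_2)
      ultimately show False using tri[of 2 "c (n - 1)" "c 1"] n5 by (auto simp: insert_commute)
    qed
    \<comment> \<open>Otherwise \<open>y\<close> would lie below \<open>c i\<close> and hence below
      \<open>u\<close>, to which it is antipodal.\<close>
    have out: "\<not> le y (c i)" if "ap y u" "y \<in> X" "2 \<le> i" "i + 2 \<le> n" for i y
      using inner[OF that(3,4)] that le_trans[OF that(2) cX uX, of i] by (auto simp: ap_def)
    have nap: "\<not> ap (c i) (c j)" if "2 \<le> i \<and> i + 2 \<le> n \<or> 2 \<le> j \<and> j + 2 \<le> n" "Suc i < j" "j < n" for i j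
      using eq[of i j] eq'[of j i] ce[of i j] that by auto
    \<comment> \<open>A dominance between inner vertices is pushed to the end \<open>c 2\<close> of
      the inner arc. There \<open>le_ap\<close> relates \<open>c 1\<close> to \<open>c j\<close>,
      which \<open>out\<close> and \<open>nap\<close> forbid; \<open>gt\<close> uses the other
      end.\<close>
    have lt: "\<not> le (c i) (c j)" if ij: "2 \<le> i" "i < j" "j + 2 \<le> n" for i j
    proof
      assume l: "le (c i) (c j)"
      have "le (c (i - (i - 2))) (c j)"
      proof (rule le_propagate[of "\<lambda>k. c (i - k)" _ 0])
        show "ap (c (i - k)) (c (i - Suc k))" if "0 \<le> k" "k < i - 2" for k
        proof -
          have "Suc (i - Suc k) = i - k" using that by linarith
          then show ?thesis using local_walk(6)[of "i - Suc k"] ap_sym by (simp add: local_edge_def)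
        qed
        show "\<not> ap (c (i - k)) (c j)" if "0 < k" "k \<le> i - 2" for k
          by (rule nap) (use ij that in auto)
      qed (use cX l ij in auto)
      then have "le (c 2) (c j)" using ij by simp
      moreover have "ap (c 2) (c 1)"
        using local_walk(6)[of 1] ap_sym by (simp add: local_edge_def numeral_2_eq_2)
      ultimately have "le (c 1) (c j) \<or> ap (c 1) (c j)" using le_ap cX by blast
      then show False using out[of "c 1" j] nap[of 1 j] a1[of 1] cX ij by auto
    qed
    have gt: "\<not> le (c j) (c i)" if ij: "2 \<le> i" "i < j" "j + 2 \<le> n" for i j
    proof
      assume l: "le (c j) (c i)"
      have "le (c (n - 2)) (c i)"
      proof (rule le_propagate[of c _ j])
        show "ap (c k) (c (Suc k))" for k using local_walk(6)[of k] by (simp add: local_edge_def)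
        show "\<not> ap (c k) (c i)" if "j < k" "k \<le> n - 2" for k
          using nap[of i k] ij that ap_sym by fastforce
      qed (use cX l ij in auto)
      moreover have "ap (c (n - 2)) (c (n - 1))"
        using local_walk(6)[of "n - 2"] n5 by (simp add: local_edge_def Suc_diff_le numeral_2_eq_2 Suc_diff_Suc)
      ultimately have "le (c (n - 1)) (c i) \<or> ap (c (n - 1)) (c i)" using le_ap cX by blast
      then show False using out[of "c (n - 1)" i] nap[of i "n - 1"] a1[of "n - 1"] cX ij ap_sym by fastforce
    qed
    define k where "k = n div 2"
    have k: "n = 2 * k + 1" "k \<ge> 2" using local_walk(1) n5 by (auto simp: k_def elim!: oddE)
    have aps: "ap (c i) (c (Suc i))" for i using local_walk(6)[of i] by (simp add: local_edge_def)
    have apd: "ap x y \<Longrightarrow> \<not> le x y \<and> \<not> le y x" for x y by (simp add: ap_def)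
    show ?thesis
    proof (rule forbiddenI[of "FF_tilde k" c])
      show "FF_tilde k \<in> family_F" using k unfolding family_F_def by blast
      fix i j assume ij: "i < j" "i \<in> cverts (FF_tilde k)" "j \<in> cverts (FF_tilde k)"
      then have j: "j \<le> 2 * k" "j < n" using k by (auto simp: cverts_family)
      show "c i \<noteq> c j" using cne ij j by blast
      have "i = 0 \<and> (j = 1 \<or> Suc j = n) \<or> (i = 0 \<and> 2 \<le> j \<and> j + 2 \<le> n) \<or> j = Suc i
        \<or> (i = 1 \<and> j = n - 1) \<or> (i = 1 \<and> 3 \<le> j \<and> j + 2 \<le> n)
        \<or> (2 \<le> i \<and> Suc i < j \<and> j + 2 \<le> n) \<or> (2 \<le> i \<and> j = n - 1 \<and> i + 3 \<le> n)"
        using ij(1) j n5 by presburger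
      then consider (e1) "i = 0" "j = 1 \<or> Suc j = n" | (d) "i = 0" "2 \<le> j" "j + 2 \<le> n" | (e2) "j = Suc i"
        | (e3) "i = 1" "j = n - 1" | (n1) "i = 1" "3 \<le> j" "j + 2 \<le> n"
        | (n2) "2 \<le> i" "Suc i < j" "j + 2 \<le> n" | (n3) "2 \<le> i" "j = n - 1" "i + 3 \<le> n"
        by blast
      then have "(({i, j} \<in> antip_edges (FF_tilde k)) = ap (c i) (c j)) \<and>
        (({i, j} \<in> dom_edges (FF_tilde k)) = (le (c i) (c j) \<or> le (c j) (c i)))"
      proof cases
        case e1
        then have "ap (c i) (c j)" using a1[of j] c0 ap_sym by auto
        then show ?thesis unfolding FF_simps(3,4)[OF ij(1) j(1) k(2)]
          using e1 k apd by auto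
      next
        case d
        then have "le (c j) (c i)" "\<not> ap (c i) (c j)" using inner[of j] c0 ap_sym by auto
        then show ?thesis unfolding FF_simps(3,4)[OF ij(1) j(1) k(2)]
          using d k by auto
      next
        case e2
        have "ap (c i) (c j)" using aps e2 by simp
        then show ?thesis unfolding FF_simps(3,4)[OF ij(1) j(1) k(2)]
          using e2 k apd by auto
      next
        case e3
        then have "ap (c i) (c j)" using ap1 by simp
        then show ?thesis unfolding FF_simps(3,4)[OF ij(1) j(1) k(2)]
          using e3 k apd by auto
      next
        case n1
        then have "\<not> ap (c i) (c j)" "\<not> le (c i) (c j)" "\<not> le (c j) (c i)"
          using nap[of 1 j] out[of "c 1" j] dn[of j] a1[of 1] cX by auto
        then show ?thesis unfolding FF_simps(3,4)[OF ij(1) j(1) k(2)]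
          using n1 k by auto
      next
        case n2
        then have "\<not> ap (c i) (c j)" "\<not> le (c i) (c j)" "\<not> le (c j) (c i)"
          using nap[of i j] lt[of i j] gt[of i j] by auto
        then show ?thesis unfolding FF_simps(3,4)[OF ij(1) j(1) k(2)]
          using n2 k by auto
      next
        case n3
        then have "\<not> ap (c i) (c j)" "\<not> le (c i) (c j)" "\<not> le (c j) (c i)"
          using nap[of i j] out[of "c j" i] dn'[of i] a1[of j] cX by auto
        then show ?thesis unfolding FF_simps(3,4)[OF ij(1) j(1) k(2)]
          using n3 k by auto
      qed
      then show "({i, j} \<in> antip_edges (FF_tilde k)) = ap (c i) (c j)"
        "({i, j} \<in> dom_edges (FF_tilde k)) = (le (c i) (c j) \<or> le (c j) (c i))" by blast+
    qed (use cX in simp)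
  qed
qed

end

end

section \<open>Construction of valid colourings, and what they exclude\<close>

lemma has_csubgraph_map:
  assumes "has_csubgraph X H"
  obtains c where "\<And>i. i \<in> cverts H \<Longrightarrow> c i \<in> cverts X"
    "\<And>i j. {i, j} \<in> antip_edges H \<Longrightarrow> {c i, c j} \<in> antip_edges X"
    "\<And>i j. {i, j} \<in> dom_edges H \<Longrightarrow> {c i, c j} \<in> dom_edges X"
proof -
  obtain Y f where Y: "csubgraph_of Y X" and f: "bij_betw f (cverts H) (cverts Y)"
    "(`) f ` antip_edges H = antip_edges Y" "(`) f ` dom_edges H = dom_edges Y"
    using assms unfolding has_csubgraph_def cisomorphic_def by (elim exE conjE) (rule that)
  show ?thesis
  proof (rule that[of f])
    show "f i \<in> cverts X" if "i \<in> cverts H" for i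
      using that f(1) Y by (auto simp: csubgraph_of_def bij_betw_def)
    have im: "f ` {i, j} = {f i, f j}" for i j by simp
    show "{f i, f j} \<in> antip_edges X" if "{i, j} \<in> antip_edges H" for i j
      using imageI[OF that, of "(`) f"] f(2) Y unfolding csubgraph_of_def im by blast
    show "{f i, f j} \<in> dom_edges X" if "{i, j} \<in> dom_edges H" for i j
      using imageI[OF that, of "(`) f"] f(3) Y unfolding csubgraph_of_def im by blast
  qed
qed

lemma card_le_2_two:
  assumes "card S \<le> 2" "finite S" "a \<in> S" "b \<in> S" "a \<noteq> b" "z \<in> S"
  shows "z = a \<or> z = b"
proof (rule ccontr)
  assume "\<not> ?thesis"
  then have "card {a, b, z} = 3" using assms by auto
  moreover have "card {a, b, z} \<le> card S" using assms by (intro card_mono) auto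
  ultimately show False using assms(1) by simp
qed

lemma alternate_parity:
  assumes "\<And>i. a \<le> i \<Longrightarrow> i < a + m \<Longrightarrow> P (Suc i) \<longleftrightarrow> \<not> P i"
  shows "P (a + m) \<longleftrightarrow> (P a \<longleftrightarrow> even m)"
  using assms
proof (induction m)
  case (Suc m)
  then show ?case using Suc.prems[of "a + m"] by auto
qed simp

context attachment_order
begin

text \<open>A shortest odd closed walk of local edges passes through \<open>u\<close>, or meets two
  vertices antipodal to \<open>u\<close> and can be rerouted through \<open>u\<close>, or meets at
  most one such vertex. In the last case it is an induced cycle with hub \<open>u\<close>, restarted
  so that the exceptional vertex is at position \<open>0\<close>.\<close>

lemma local_bipartite:
  assumes u: "maximal u" and nf: "\<not> forbidden" "\<not> full_triangle"
  shows "\<exists>g. (\<forall>x y. local_edge u x y \<longrightarrow> g x \<noteq> g y) \<and> g u"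
proof -
  have False if c: "min_odd_walk (local_edge u) n c" for n c
  proof -
    have thr: False if "min_odd_walk (local_edge u) n d" "d 0 = u" for d
      using local_walk_through_max[OF u that nf(2)] nf(1) by simp
    have nu: "c i \<noteq> u" for i using thr[OF min_odd_walk_shift[OF c, of i]] by auto
    have na: "\<not> (ap (c i) u \<and> ap (c j) u)" if "i < j" "j < i + n" for i j
      using local_walk_via_max[OF u c that] thr by blast
    have hub: forbidden if d: "min_odd_walk (local_edge u) n d" and "\<And>i. 0 < i \<Longrightarrow> i < n \<Longrightarrow> \<not> ap (d i) u"
      "\<And>i j. i < j \<Longrightarrow> j < i + n \<Longrightarrow> \<not> (ap (d i) u \<and> ap (d j) u)" "\<And>i. d i \<noteq> u" for d
    proof (rule induced_cycle_hub[of n d u])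
      show "induced_cycle n d" using local_walk_induced_cycle[OF u d] that(3) by blast
      show "n \<ge> 3" by (rule local_walk[OF u d])
      show "u \<in> X" using u by (simp add: maximal_def)
      show "le (d i) u \<and> d i \<noteq> u" if "i < n" "i \<noteq> 0" for i
        using \<open>\<And>i. 0 < i \<Longrightarrow> i < n \<Longrightarrow> \<not> ap (d i) u\<close>[of i] local_walk(5)[OF u d, of i] \<open>\<And>i. d i \<noteq> u\<close> that by auto
      show "le (d 0) u \<and> d 0 \<noteq> u \<or> ap (d 0) u"
        using local_walk(5)[OF u d, of 0] \<open>\<And>i. d i \<noteq> u\<close> by auto
    qed
    show False
    proof (cases "\<exists>s. ap (c s) u")
      case True
      then obtain s where "ap (c s) u" by blast
      then have "\<not> ap (c (i + s)) u" if "0 < i" "i < n" for i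
        using na[of s "i + s"] that by (auto simp: add.commute)
      then show False using hub[OF min_odd_walk_shift[OF c, of s]] nu na nf(1) by auto
    next
      case False
      then show False using hub[OF c] nu na nf(1) by blast
    qed
  qed
  then obtain g :: "'x \<Rightarrow> bool" where g: "\<forall>x y. local_edge u x y \<longrightarrow> g x \<noteq> g y"
    using bipartite_or_min_odd_walk[OF local_edge_sym[of u]] by blast
  show ?thesis
  proof (cases "g u")
    case False
    then show ?thesis using g by (intro exI[of _ "\<lambda>x. \<not> g x"]) auto
  qed (use g in blast)
qed

lemma ex_maximal:
  assumes "x \<in> X"
  shows "\<exists>u. maximal u \<and> le x u"
  using assms
proof (induction "card {y \<in> X. le x y}" arbitrary: x rule: less_induct)
  case less
  show ?case
  proof (cases "maximal x")
    case True
    then show ?thesis using le_refl less by blast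
  next
    case False
    then obtain y where y: "y \<in> X" "le x y" "y \<noteq> x" using less by (auto simp: maximal_def)
    have "{z \<in> X. le y z} \<subset> {z \<in> X. le x z}"
      using y less le_trans[of x y] le_antisym[of x y] le_refl[of x] by blast
    then have "card {z \<in> X. le y z} < card {z \<in> X. le x z}" using fin by (intro psubset_card_mono) auto
    then obtain u where "maximal u" "le y u" using less(1)[of y] y by blast
    then show ?thesis using le_trans[of x y u] y less by (auto simp: maximal_def)
  qed
qed

text \<open>\<open>(u, True)\<close> is the colour of the maximal element \<open>u\<close>, and
  \<open>(u, False)\<close> serves the opposite side among the elements whose only maximal upper
  bound is \<open>u\<close>. Below two maximal elements \<open>u\<close> and \<open>w\<close>, the
  colours \<open>(u, True)\<close> and \<open>(w, True)\<close> act as opposites, and the side with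
  respect to one of the two decides.\<close>

theorem valid_coloring_exists:
  assumes nf: "\<not> forbidden" "\<not> full_triangle"
  shows "\<exists>f :: 'x \<Rightarrow> nat. valid f"
proof -
  have "\<forall>u. \<exists>g. maximal u \<longrightarrow> (\<forall>x y. local_edge u x y \<longrightarrow> g x \<noteq> g y) \<and> g u"
  proof
    fix u
    show "\<exists>g. maximal u \<longrightarrow> (\<forall>x y. local_edge u x y \<longrightarrow> g x \<noteq> g y) \<and> g u"
      using local_bipartite[OF _ nf, of u] by (cases "maximal u") simp_all
  qed
  from choice[OF this] obtain g where
    g': "\<And>u. maximal u \<Longrightarrow> (\<forall>x y. local_edge u x y \<longrightarrow> g u x \<noteq> g u y) \<and> g u u" by blast
  have g: "\<And>u x y. maximal u \<Longrightarrow> local_edge u x y \<Longrightarrow> g u x \<noteq> g u y" and gu: "\<And>u. maximal u \<Longrightarrow> g u u"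
    using g' by blast+
  define U where "U x = {u. maximal u \<and> le x u}" for x
  \<comment> \<open>The choice depends on the set of maximal upper bounds alone, so that elements
    with the same two bounds consult the same bipartition.\<close>
  define pk where "pk S = (SOME u. u \<in> S)" for S :: "'x set"
  define f where "f x = (let u = pk (U x) in if U x = {u} then (u, g u x)
      else if g u x then (u, True) else (SOME w. w \<in> U x \<and> w \<noteq> u, True))" for x
  have mX: "u \<in> X" if "maximal u" for u using that by (simp add: maximal_def)
  have mx: "ap u w" if "maximal u" "maximal w" "v \<in> W u" "v \<in> W w" "u \<noteq> w" for u w v
    using that by (auto simp: maximal_def ap_def)
  \<comment> \<open>Distinct maximal elements that share \<open>v\<close> are antipodal, so three of
    them would form a full triangle.\<close>
  have three: "u1 = u2 \<or> u1 = u3 \<or> u2 = u3" if "maximal u1" "maximal u2" "maximal u3"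
    "v \<in> W u1" "v \<in> W u2" "v \<in> W u3" for u1 u2 u3 v
    using that mx mX nf(2) unfolding full_triangle_def by blast
  have UW: "v \<in> W u" if "u \<in> U x" "x \<in> X" "v \<in> W x" for u x v
    using that W_mono[of x u] mX by (auto simp: U_def)
  have Ucases: "(\<exists>u. U x = {u} \<and> f x = (u, g u x)) \<or>
    (\<exists>u w. u \<noteq> w \<and> U x = {u, w} \<and> u = pk {u, w} \<and> f x = (if g u x then u else w, True))"
    if x: "x \<in> X" for x
  proof -
    obtain v where v: "v \<in> W x" using W_ne x by blast
    have ne: "U x \<noteq> {}" using ex_maximal x by (auto simp: U_def)
    then have pk: "pk (U x) \<in> U x" unfolding pk_def by (simp add: some_in_eq)
    show ?thesis
    proof (cases "U x = {pk (U x)}")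
      case True
      then show ?thesis by (intro disjI1 exI[of _ "pk (U x)"]) (simp add: f_def Let_def)
    next
      case False
      then obtain w where w: "w \<in> U x" "w \<noteq> pk (U x)" using pk by blast
      have only: "z = w" if "z \<in> U x" "z \<noteq> pk (U x)" for z
        using three[of z w "pk (U x)"] that w pk UW[OF _ x v] by (auto simp: U_def)
      have U: "U x = {pk (U x), w}" using only pk w by blast
      moreover have "(SOME z. z \<in> U x \<and> z \<noteq> pk (U x)) = w"
        using w only by (intro some_equality) blast+
      ultimately have "f x = (if g (pk (U x)) x then pk (U x) else w, True)"
        using False by (simp add: f_def Let_def)
      then show ?thesis using w U by (intro disjI2 exI[of _ "pk (U x)"] exI[of _ w]) auto
    qed
  qed
  have apmax: "ap x w" if "x \<in> X" "maximal w" "w \<notin> U x" "v \<in> W x" "v \<in> W w" for x w v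
  proof -
    have "\<not> le w x" using that(1,2,3) le_refl[of x] unfolding maximal_def U_def by fastforce
    then show ?thesis using that by (auto simp: ap_def U_def)
  qed
  \<comment> \<open>\<open>x\<close> and \<open>u\<close> are both antipodal to \<open>w\<close>,
    hence on the same side at \<open>u\<close>. So \<open>(u, False)\<close> is absent from every
    vertex of \<open>Q\<close> that meets a second maximal element, which keeps the number of
    colours there at two.\<close>
  have gT: "g u x" if x: "x \<in> X" and U: "U x = {u}" and w: "maximal w" "w \<noteq> u" "v \<in> W x" "v \<in> W w" for x u w v
  proof -
    have u: "maximal u" "le x u" using U by (auto simp: U_def)
    have "ap u w" using mx[of u w v] u w UW[of u x v] x U by blast
    moreover have "ap x w" using apmax[of x w v] x U w by blast
    ultimately have "local_edge u u w" "local_edge u x w"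
      using u w x mX le_refl ap_irrefl ap_sym unfolding local_edge_def ap_def by blast+
    then show ?thesis using g[OF u(1)] gu[OF u(1)] by blast
  qed
  have loc: "local_edge u x y" if "u \<in> U x" "u \<in> U y" "x \<in> X" "y \<in> X" "ap x y" for u x y
    using that by (auto simp: local_edge_def U_def ap_def)
  have ne1: "f x \<noteq> f y" if xy: "x \<in> X" "y \<in> X" "ap x y" and U: "U x = {u}" "f x = (u, g u x)"
    and y2: "a \<noteq> b" "U y = {a, b}" "f y = (if g a y then a else b, True)" for x y u a b
  proof -
    obtain v where v: "v \<in> W x" "v \<in> W y" using xy by (auto simp: ap_def)
    have m: "maximal u" "maximal a" "maximal b" using U y2 by (auto simp: U_def)
    have vv: "v \<in> W u" "v \<in> W a" "v \<in> W b" using UW v xy U(1) y2(2) by blast+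
    have "u = a \<or> u = b" using three[OF m vv] y2 by blast
    then show ?thesis
    proof
      assume ua: "u = a"
      then have "g u x" using gT[OF xy(1) U(1) m(3), of v] v vv y2 by blast
      moreover have "local_edge u x y" using loc ua xy U(1) y2(2) by blast
      ultimately have "\<not> g a y" using g[OF m(1)] ua by blast
      then show ?thesis using U y2 ua by simp
    next
      \<comment> \<open>Here \<open>u\<close> is not the bound consulted for \<open>y\<close>. But
        \<open>x\<close> is antipodal to \<open>a\<close>, so at \<open>a\<close> it is opposite
        both to \<open>a\<close> and to \<open>y\<close>; hence \<open>y\<close> gets the colour of
        \<open>a\<close>.\<close>
      assume ub: "u = b"
      have "ap x a" using apmax[OF xy(1) m(2), of v] U y2 ub v vv by blast
      have "local_edge a a x" "local_edge a y x"
        using \<open>ap x a\<close> xy y2(2) m(2) mX le_refl ap_sym ap_irrefl unfolding local_edge_def U_def ap_def by blast+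
      then have "g a y" using g[OF m(2)] gu[OF m(2)] by blast
      then show ?thesis using U y2 ub by simp
    qed
  qed
  have proper: "f x \<noteq> f y" if xy: "x \<in> X" "y \<in> X" "ap x y" for x y
  proof -
    obtain v where v: "v \<in> W x" "v \<in> W y" using xy by (auto simp: ap_def)
    consider (11) u w where "U x = {u}" "f x = (u, g u x)" "U y = {w}" "f y = (w, g w y)"
      | (12) u a b where "U x = {u}" "f x = (u, g u x)" "a \<noteq> b" "U y = {a, b}" "f y = (if g a y then a else b, True)"
      | (21) u a b where "U y = {u}" "f y = (u, g u y)" "a \<noteq> b" "U x = {a, b}" "f x = (if g a x then a else b, True)"
      | (22) a b a' b' where "a \<noteq> b" "U x = {a, b}" "a = pk {a, b}" "f x = (if g a x then a else b, True)"
         "a' \<noteq> b'" "U y = {a', b'}" "a' = pk {a', b'}" "f y = (if g a' y then a' else b', True)"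
      using Ucases[OF xy(1)] Ucases[OF xy(2)] by (elim disjE exE conjE) blast+
    then show ?thesis
    proof cases
      case 11
      show ?thesis
      proof (cases "u = w")
        case True
        then have "local_edge u x y" using loc 11 xy by blast
        then show ?thesis using g 11 True by (auto simp: U_def)
      qed (use 11 in auto)
    next
      case 12
      then show ?thesis using ne1[OF xy] by blast
    next
      case 21
      then show ?thesis using ne1[OF xy(2,1) ap_sym[OF xy(3)]] by metis
    next
      case 22
      have m: "maximal a" "maximal b" "maximal a'" "maximal b'" using 22 by (auto simp: U_def)
      have vv: "v \<in> W a" "v \<in> W b" "v \<in> W a'" "v \<in> W b'" using UW v xy 22(2,6) by blast+
      have "a' = a \<or> a' = b" "b' = a \<or> b' = b"
        using three[OF m(1,2,3) vv(1,2,3)] three[OF m(1,2,4) vv(1,2,4)] 22(1) by blast+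
      then have eq: "{a, b} = {a', b'}" using 22(1,5) by blast
      then have "a' = a" using 22(3,7) by simp
      moreover have "b' = b" using eq calculation 22(1) by (auto simp: doubleton_eq_iff)
      moreover have "local_edge a x y" using loc 22(2,6) xy calculation by blast
      then have "g a x \<noteq> g a y" using g m(1) by blast
      ultimately show ?thesis using 22(1,4,8) by auto
    qed
  qed
  have two: "card (f ` {x \<in> X. v \<in> W x}) \<le> 2" for v
  proof (cases "\<exists>u w. maximal u \<and> maximal w \<and> v \<in> W u \<and> v \<in> W w \<and> u \<noteq> w")
    case True
    then obtain u w where uw: "maximal u" "maximal w" "v \<in> W u" "v \<in> W w" "u \<noteq> w" by blast
    have "f x \<in> {(u, True), (w, True)}" if x: "x \<in> X" "v \<in> W x" for x
    proof -
      have sub: "z = u \<or> z = w" if "z \<in> U x" for z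
        using three[OF _ uw(1,2) _ uw(3,4), of z] UW[OF that x] that uw(5) by (auto simp: U_def)
      from Ucases[OF x(1)] show ?thesis
      proof (elim disjE exE conjE)
        fix z assume z: "U x = {z}" "f x = (z, g z x)"
        then have "z = u \<or> z = w" using sub by blast
        then have "g z x" using gT[OF x(1) z(1), of w v] gT[OF x(1) z(1), of u v] uw x by blast
        then show ?thesis using z \<open>z = u \<or> z = w\<close> by auto
      next
        fix a b assume z: "U x = {a, b}" "f x = (if g a x then a else b, True)"
        then have "a = u \<or> a = w" "b = u \<or> b = w" using sub by blast+
        then show ?thesis using z by auto
      qed
    qed
    then have "f ` {x \<in> X. v \<in> W x} \<subseteq> {(u, True), (w, True)}" by blast
    then show ?thesis by (rule card_le_2_of_subset_pair)
  next
    case False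
    show ?thesis
    proof (cases "\<exists>u. maximal u \<and> v \<in> W u")
      case True
      then obtain u where u: "maximal u" "v \<in> W u" by blast
      have "f x \<in> {(u, True), (u, False)}" if x: "x \<in> X" "v \<in> W x" for x
      proof -
        have sub: "z = u" if "z \<in> U x" for z using False u UW[OF that x] that by (auto simp: U_def)
        from Ucases[OF x(1)] show ?thesis
        proof (elim disjE exE conjE)
          fix z assume z: "U x = {z}" "f x = (z, g z x)"
          then show ?thesis using sub by auto
        next
          fix a b assume z: "U x = {a, b}" "a \<noteq> b"
          then show ?thesis using sub[of a] sub[of b] by simp
        qed
      qed
      then have "f ` {x \<in> X. v \<in> W x} \<subseteq> {(u, True), (u, False)}" by blast
      then show ?thesis by (rule card_le_2_of_subset_pair)
    next
      case f: False
      have "v \<notin> W x" if "x \<in> X" for x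
        using ex_maximal[OF that] f UW[of _ x v] that by (auto simp: U_def)
      then have "{x \<in> X. v \<in> W x} = {}" by blast
      then show ?thesis by (metis card.empty image_empty le0)
    qed
  qed
  obtain h :: "'x \<times> bool \<Rightarrow> nat" where h: "inj_on h (f ` X)"
    using finite_imp_inj_to_nat_seg[OF finite_imageI[OF fin, of f]] by blast
  have "valid (h \<circ> f)"
    unfolding valid_def
  proof (intro conjI ballI impI allI)
    fix x y assume "x \<in> X" "y \<in> X" "ap x y"
    then show "(h \<circ> f) x \<noteq> (h \<circ> f) y" using proper h by (auto simp: inj_on_def)
  next
    fix v
    have "card (h ` f ` {x \<in> X. v \<in> W x}) \<le> card (f ` {x \<in> X. v \<in> W x})"
      by (rule card_image_le) (use fin in auto)
    then show "card ((h \<circ> f) ` {x \<in> X. v \<in> W x}) \<le> 2" using two[of v] by (simp add: image_comp)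
  qed
  then show ?thesis by blast
qed

lemma valid_two_colors:
  assumes f: "valid f" and X: "x \<in> X" "y \<in> X" "z \<in> X" and v: "v \<in> W x" "v \<in> W y" "v \<in> W z"
    and ne: "f x \<noteq> f y"
  shows "f z = f x \<or> f z = f y"
proof (rule card_le_2_two[OF _ _ _ _ ne])
  show "card (f ` {x \<in> X. v \<in> W x}) \<le> 2" using f by (simp add: valid_def)
  show "finite (f ` {x \<in> X. v \<in> W x})" using fin by simp
qed (use X v in blast)+

text \<open>Whichever of \<open>x\<close> and \<open>z\<close> is the lower one, some
  \<open>v\<close> lies in all three attachment sets. Only two colours occur at \<open>v\<close>,
  and \<open>x\<close> and \<open>y\<close> take both, so \<open>z\<close> agrees with exactly one
  of them.\<close>

lemma valid_between:
  assumes f: "valid f" and X: "x \<in> X" "y \<in> X" "z \<in> X" and "ap x y" "le x z \<or> le z x" "W z \<inter> W y \<noteq> {}"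
  shows "(f y = f z) \<longleftrightarrow> \<not> (f x = f z)"
proof -
  obtain v where v: "v \<in> W x" "v \<in> W y" "v \<in> W z"
    using assms(5-7) W_mono X unfolding ap_def by blast
  have "f x \<noteq> f y" using f assms unfolding valid_def by blast
  with valid_two_colors[OF f X v] show ?thesis by metis
qed

lemma valid_imp_no_full_triangle:
  assumes f: "valid f"
  shows "\<not> full_triangle"
proof
  assume full_triangle
  then obtain x y z v where x: "x \<in> X" "y \<in> X" "z \<in> X" "ap x y" "ap y z" "ap x z"
    and v: "v \<in> W x" "v \<in> W y" "v \<in> W z" unfolding full_triangle_def by blast
  then have "f x \<noteq> f y" "f y \<noteq> f z" "f x \<noteq> f z" using f unfolding valid_def by blast+
  with valid_two_colors[OF f x(1,2,3) v] show False by metis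
qed

lemma le_att: "x \<in> X \<Longrightarrow> y \<in> X \<Longrightarrow> le x y \<or> le y x \<Longrightarrow> W x \<inter> W y \<noteq> {}"
  using W_mono W_ne by blast

text \<open>By \<open>valid_between\<close>, agreement with the colour of the hub alternates around
  the cycle, which is impossible for odd length.\<close>

lemma valid_imp_no_wheel:
  assumes f: "valid f" and k: "k \<ge> 1" and H: "has_csubgraph agraph H" "H = W0 k \<or> H = W1 k"
  shows False
proof -
  obtain c where c: "\<And>i. i \<in> cverts H \<Longrightarrow> c i \<in> X"
    "\<And>i j. {i, j} \<in> antip_edges H \<Longrightarrow> {c i, c j} \<in> antip_edges agraph"
    "\<And>i j. {i, j} \<in> dom_edges H \<Longrightarrow> {c i, c j} \<in> dom_edges agraph"
    using has_csubgraph_map[OF H(1)] cverts_agraph by metis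
  let ?h = "c (2 * k + 1)"
  have X: "c i \<in> X" if "i \<le> 2 * k + 1" for i using c(1) H(2) that cverts_family by auto
  have cyc: "ap (c i) (c j)" if "{i, j} \<in> cycle_edges (2 * k + 1)" for i j
    using c(2)[of i j] H(2) that by (auto simp: antip_iff W0_def W1_def)
  have dom: "le (c i) ?h \<or> le ?h (c i)" if "1 \<le> i" "i \<le> 2 * k" for i
    using c(3)[of i "2 * k + 1"] H(2) W0_simps(2)[of i "2 * k + 1" k] W1_simps(2)[of i "2 * k + 1" k] that
    by (auto simp: dom_iff)
  have att: "W ?h \<inter> W (c i) \<noteq> {}" if "i \<le> 2 * k" for i
  proof (cases "i = 0")
    case False
    then show ?thesis using dom[of i] that le_att[of ?h "c i"] X[of i] X[of "2 * k + 1"] by auto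
  next
    case True
    have "{0, 2 * k + 1} \<in> antip_edges H \<or> {0, 2 * k + 1} \<in> dom_edges H"
      using H(2) W0_simps(2)[of 0 "2 * k + 1" k] W1_simps(1)[of 0 "2 * k + 1" k] by auto
    then show ?thesis using c(2)[of 0 "2 * k + 1"] c(3)[of 0 "2 * k + 1"] True le_att[of ?h "c 0"]
      by (auto simp: antip_iff dom_iff ap_def Int_commute)
  qed
  \<comment> \<open>\<open>valid_between\<close> needs an end of the edge that is comparable to the
    hub. Only position \<open>0\<close> can fail to be so, in \<open>W1\<close>, and every edge has
    another end.\<close>
  have alt: "(f (c j) = f ?h) \<longleftrightarrow> \<not> (f (c i) = f ?h)" if "{i, j} \<in> cycle_edges (2 * k + 1)" "i \<le> 2 * k" "j \<le> 2 * k" "i \<noteq> j" for i j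
  proof (cases "i = 0")
    case False
    then show ?thesis using valid_between[OF f X[of i] X[of j] X[of "2 * k + 1"] cyc[OF that(1)]] dom[of i] att[of j] that by auto
  next
    case True
    then show ?thesis using valid_between[OF f X[of j] X[of i] X[of "2 * k + 1"] ap_sym[OF cyc[OF that(1)]]] dom[of j] att[of i] that by auto
  qed
  have "(f (c (0 + 2 * k)) = f ?h) \<longleftrightarrow> ((f (c 0) = f ?h) \<longleftrightarrow> even (2 * k))"
  proof (rule alternate_parity)
    fix i assume i: "i < 0 + 2 * k"
    then have "{i, Suc i} \<in> cycle_edges (2 * k + 1)" by (simp add: cycle_edges_iff)
    then show "(f (c (Suc i)) = f ?h) = (f (c i) \<noteq> f ?h)" using alt[of i "Suc i"] i by simp
  qed
  moreover have "{0, 2 * k} \<in> cycle_edges (2 * k + 1)" using k by (simp add: cycle_edges_iff)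
  then have "(f (c (2 * k)) = f ?h) \<longleftrightarrow> \<not> (f (c 0) = f ?h)" using alt[of 0 "2 * k"] k by simp
  ultimately show False by simp
qed

text \<open>Agreement with the colour of \<open>c 0\<close> alternates along the path from
  \<open>c 1\<close> to \<open>c (2 * k)\<close>, which has an odd number of edges. So exactly one
  end would agree, yet both are antipodal to \<open>c 0\<close>.\<close>

lemma valid_imp_no_fan:
  assumes f: "valid f" and k: "k \<ge> 2" and H: "has_csubgraph agraph (FF k)"
  shows False
proof -
  obtain c where c: "\<And>i. i \<in> cverts (FF k) \<Longrightarrow> c i \<in> X"
    "\<And>i j. {i, j} \<in> antip_edges (FF k) \<Longrightarrow> {c i, c j} \<in> antip_edges agraph"
    "\<And>i j. {i, j} \<in> dom_edges (FF k) \<Longrightarrow> {c i, c j} \<in> dom_edges agraph"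
    using has_csubgraph_map[OF H] cverts_agraph by metis
  have X: "c i \<in> X" if "i \<le> 2 * k" for i using c(1) that cverts_family by auto
  have ap: "ap (c i) (c j)" if "i < j" "j \<le> 2 * k" "j = Suc i \<or> i = 0 \<and> j = 2 * k" for i j
    using c(2)[of i j] FF_simps(1)[OF that(1,2) k] that by (auto simp: antip_iff)
  have dom: "le (c 0) (c i) \<or> le (c i) (c 0)" if "2 \<le> i" "i < 2 * k" for i
    using c(3)[of 0 i] FF_simps(2)[of 0 i k] that k by (auto simp: dom_iff)
  have att: "W (c 0) \<inter> W (c i) \<noteq> {}" if "1 \<le> i" "i \<le> 2 * k" for i
  proof (cases "i = 1 \<or> i = 2 * k")
    case True
    then show ?thesis using ap[of 0 i] that by (auto simp: ap_def)
  next
    case False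
    then show ?thesis using dom[of i] that le_att[of "c 0" "c i"] X[of i] X[of 0] by auto
  qed
  have "(f (c (1 + (2 * k - 1))) = f (c 0)) \<longleftrightarrow> ((f (c 1) = f (c 0)) \<longleftrightarrow> even (2 * k - 1))"
  proof (rule alternate_parity)
    fix i assume i: "1 \<le> i" "i < 1 + (2 * k - 1)"
    then have a: "ap (c i) (c (Suc i))" using ap[of i "Suc i"] by auto
    have i': "i < 2 * k" "Suc i \<le> 2 * k" using i k by linarith+
    show "(f (c (Suc i)) = f (c 0)) = (f (c i) \<noteq> f (c 0))"
    proof (cases "i = 1")
      case False
      then show ?thesis
        using valid_between[OF f X[of i] X[of "Suc i"] X[of 0] a] dom[of i] att[of "Suc i"] i i' by auto
    next
      case True
      then show ?thesis
        using valid_between[OF f X[of "Suc i"] X[of i] X[of 0] ap_sym[OF a]] dom[of "Suc i"] att[of i] i k by auto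
    qed
  qed
  moreover have "f (c 0) \<noteq> f (c 1)" "f (c 0) \<noteq> f (c (2 * k))"
    using ap[of 0 1] ap[of 0 "2 * k"] f X k by (auto simp: valid_def)
  moreover have "1 + (2 * k - 1) = 2 * k" "odd (2 * k - 1)" using k by auto
  ultimately show False by auto
qed

theorem valid_imp_no_F0:
  assumes "valid f" "H \<in> family_F0"
  shows "\<not> has_csubgraph agraph H"
  using assms valid_imp_no_wheel valid_imp_no_fan unfolding family_F0_def by blast

text \<open>\<open>FF_tilde k\<close> and \<open>DF k\<close> contain \<open>FF k\<close> as a
  subgraph on the same vertices. So excluding the smaller family as subgraphs excludes the larger
  one as induced subgraphs.\<close>

lemma no_F0_imp_not_forbidden:
  assumes "\<forall>H\<in>family_F0. \<not> has_csubgraph agraph H"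
  shows "\<not> forbidden"
proof
  assume forbidden
  then obtain H where H: "H \<in> family_F" "has_csubgraph agraph H"
    unfolding forbidden_def using has_induced_imp_has_csubgraph by blast
  have FF: "has_csubgraph agraph (FF k)" if "H = FF_tilde k \<or> H = DF k" "k \<ge> 2" for k
  proof (rule has_csubgraph_trans[OF H(2)])
    have e: "{i, j} \<in> antip_edges (FF k) \<Longrightarrow> {i, j} \<in> antip_edges H"
       "{i, j} \<in> dom_edges (FF k) \<Longrightarrow> {i, j} \<in> dom_edges H" if "i < j" "j \<le> 2 * k" for i j
      using FF_simps[OF that \<open>k \<ge> 2\<close>] DF_simps[OF that \<open>k \<ge> 2\<close>] \<open>H = _ \<or> _\<close> by auto
    have w: "ordered_edge (FF k) e" if "e \<in> antip_edges (FF k) \<union> dom_edges (FF k)" for e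
      by (rule family_F_wf[OF _ that]) (use \<open>k \<ge> 2\<close> in \<open>auto simp: family_F_def\<close>)
    show "cverts (FF k) = cverts H" using that by (auto simp: cverts_family)
    show "antip_edges (FF k) \<subseteq> antip_edges H"
    proof
      fix x assume x: "x \<in> antip_edges (FF k)"
      then obtain i j where "i < j" "j \<le> 2 * k" "x = {i, j}"
        using w[of x] by (auto simp: ordered_edge_def cverts_family)
      then show "x \<in> antip_edges H" using e x by blast
    qed
    show "dom_edges (FF k) \<subseteq> dom_edges H"
    proof
      fix x assume x: "x \<in> dom_edges (FF k)"
      then obtain i j where "i < j" "j \<le> 2 * k" "x = {i, j}"
        using w[of x] by (auto simp: ordered_edge_def cverts_family)
      then show "x \<in> dom_edges H" using e x by blast
    qed
  qed
  from H(1) show False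
  proof (cases rule: family_F_cases)
    case (1 k) then show False using H(2) assms unfolding family_F0_def by blast
  next
    case (2 k) then show False using H(2) assms unfolding family_F0_def by blast
  next
    case (3 k) then show False using H(2) assms unfolding family_F0_def by blast
  next
    case (4 k) then show False using FF[of k] assms unfolding family_F0_def by blast
  next
    case (5 k) then show False using FF[of k] assms unfolding family_F0_def by blast
  qed
qed

end

section \<open>Components and cliques\<close>

lemma adj_commute: "adj G u v \<longleftrightarrow> adj G v u"
  by (simp add: adj_def insert_commute)

lemma adj_sym: "adj G u v \<Longrightarrow> adj G v u"
  by (simp add: adj_def insert_commute)

lemma adjD:
  assumes "simple_graph G" "adj G u v"
  shows "u \<in> verts G" "v \<in> verts G" "u \<noteq> v"
proof -
  have "{u, v} \<subseteq> verts G \<and> card {u, v} = 2" using assms by (auto simp: simple_graph_def adj_def)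
  then show "u \<in> verts G" "v \<in> verts G" "u \<noteq> v" by auto
qed

lemma verts_induced [simp]: "verts (induced G S) = S"
  by (simp add: induced_def)

lemma adj_induced: "adj (induced G S) u v \<longleftrightarrow> adj G u v \<and> u \<in> S \<and> v \<in> S"
  by (auto simp: adj_def induced_def)

lemma induced_induced: "T \<subseteq> S \<Longrightarrow> induced (induced G S) T = induced G T"
  by (auto simp: induced_def)

lemma simple_graph_finite: "simple_graph G \<Longrightarrow> finite (verts G)"
  by (simp add: simple_graph_def)

lemma simple_induced: "simple_graph G \<Longrightarrow> S \<subseteq> verts G \<Longrightarrow> simple_graph (induced G S)"
  by (auto simp: simple_graph_def induced_def finite_subset)

lemma chordal_induced: "chordal G \<Longrightarrow> S \<subseteq> verts G \<Longrightarrow> chordal (induced G S)"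
  unfolding chordal_def by (metis induced_induced order_trans verts_induced)

definition conn :: "'a ugraph \<Rightarrow> 'a set \<Rightarrow> 'a \<Rightarrow> 'a \<Rightarrow> bool" where
  "conn G S = (adj (induced G S))\<^sup>*\<^sup>*"

lemma conn_refl [simp]: "conn G S x x" by (simp add: conn_def)

lemma conn_trans: "conn G S x y \<Longrightarrow> conn G S y z \<Longrightarrow> conn G S x z"
  by (simp add: conn_def)

lemma conn_sym: "conn G S x y \<Longrightarrow> conn G S y x"
  unfolding conn_def
proof (induction rule: rtranclp_induct)
  case (step y z)
  from adj_sym[OF step(2)] step(3) show ?case by (rule converse_rtranclp_into_rtranclp)
qed simp

lemma conn_adj: "adj G x y \<Longrightarrow> x \<in> S \<Longrightarrow> y \<in> S \<Longrightarrow> conn G S x y"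
  unfolding conn_def by (auto simp: adj_induced)

lemma conn_step: "conn G S x y \<Longrightarrow> adj G y z \<Longrightarrow> y \<in> S \<Longrightarrow> z \<in> S \<Longrightarrow> conn G S x z"
  by (meson conn_adj conn_trans)

lemma conn_mono: "conn G S x y \<Longrightarrow> S \<subseteq> T \<Longrightarrow> conn G T x y"
  unfolding conn_def
  by (erule rtranclp_mono[THEN predicate2D, rotated]) (auto simp: adj_induced)

lemma conn_closed:
  assumes "conn G S x y" "x \<in> A" "\<And>u v. u \<in> A \<Longrightarrow> adj G u v \<Longrightarrow> u \<in> S \<Longrightarrow> v \<in> S \<Longrightarrow> v \<in> A"
  shows "y \<in> A"
  using assms(1) unfolding conn_def
  by (induction rule: rtranclp_induct) (use assms(2,3) in \<open>auto simp: adj_induced\<close>)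

lemma conn_restrict:
  assumes "conn G S x y" "x \<in> A" "\<And>u v. u \<in> A \<Longrightarrow> adj G u v \<Longrightarrow> u \<in> S \<Longrightarrow> v \<in> S \<Longrightarrow> v \<in> A"
  shows "conn G A x y"
proof -
  have "conn G A x y \<and> y \<in> A"
    using assms(1) unfolding conn_def
  proof (induction rule: rtranclp_induct)
    case (step y z)
    then have "z \<in> A" "adj G y z" using assms(3) by (auto simp: adj_induced)
    then show ?case using step by (auto simp: adj_induced intro: rtranclp.rtrancl_into_rtrancl)
  qed (use assms(2) in simp)
  then show ?thesis by simp
qed

definition connected_on :: "'a ugraph \<Rightarrow> 'a set \<Rightarrow> bool" where
  "connected_on G S \<longleftrightarrow> (\<forall>x\<in>S. \<forall>y\<in>S. conn G S x y)"

lemma connected_graph_iff: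
  assumes "simple_graph G"
  shows "connected_graph G \<longleftrightarrow> verts G \<noteq> {} \<and> connected_on G (verts G)"
proof -
  have "adj (induced G (verts G)) = adj G"
    using adjD[OF assms] by (intro ext) (auto simp: adj_induced)
  then show ?thesis by (simp add: connected_graph_def connected_on_def conn_def)
qed

lemma connected_graph_induced: "connected_graph (induced G S) \<longleftrightarrow> S \<noteq> {} \<and> connected_on G S"
  by (simp add: connected_graph_def connected_on_def conn_def)

definition comps :: "'a ugraph \<Rightarrow> 'a set \<Rightarrow> 'a set set" where
  "comps G Q = components (induced G (verts G - Q))"

lemma comps_altdef: "comps G Q = {{w \<in> verts G - Q. conn G (verts G - Q) v w} | v. v \<in> verts G - Q}"
  by (simp add: comps_def components_def conn_def)

lemma comps_subset: "C \<in> comps G Q \<Longrightarrow> C \<subseteq> verts G - Q"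
  by (auto simp: comps_altdef)

lemma comps_nonempty: "C \<in> comps G Q \<Longrightarrow> C \<noteq> {}"
  by (auto simp: comps_altdef)

lemma comps_closed: "C \<in> comps G Q \<Longrightarrow> u \<in> C \<Longrightarrow> adj G u w \<Longrightarrow> w \<in> verts G - Q \<Longrightarrow> w \<in> C"
  unfolding comps_altdef by (auto intro: conn_step)

lemma comps_connected: "C \<in> comps G Q \<Longrightarrow> connected_on G C"
  unfolding connected_on_def
proof (intro ballI)
  fix x y assume C: "C \<in> comps G Q" and xy: "x \<in> C" "y \<in> C"
  then have "conn G (verts G - Q) x y" unfolding comps_altdef by (auto intro: conn_trans conn_sym)
  then show "conn G C x y" by (rule conn_restrict) (use C xy in \<open>blast intro: comps_closed[OF C]\<close>)+
qed

lemma comps_cover: "x \<in> verts G - Q \<Longrightarrow> \<exists>C\<in>comps G Q. x \<in> C"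
  unfolding comps_altdef
  by (rule bexI[of _ "{w \<in> verts G - Q. conn G (verts G - Q) x w}"]) auto

lemma comps_eq:
  assumes "C \<in> comps G Q" "D \<in> comps G Q" "x \<in> C" "x \<in> D"
  shows "C = D"
proof -
  have "E \<subseteq> F" if "E \<in> comps G Q" "F \<in> comps G Q" "x \<in> E" "x \<in> F" for E F
  proof
    fix y assume "y \<in> E"
    then have "conn G E x y" using comps_connected[OF that(1)] that(3) by (simp add: connected_on_def)
    then show "y \<in> F"
      by (rule conn_closed) (use that comps_closed[OF that(2)] comps_subset[OF that(1)] in blast)+
  qed
  then show ?thesis using assms by blast
qed

lemma compsI:
  assumes "C \<subseteq> verts G - Q" "C \<noteq> {}" "connected_on G C"
    and cl: "\<And>u w. u \<in> C \<Longrightarrow> adj G u w \<Longrightarrow> w \<in> verts G - Q \<Longrightarrow> w \<in> C"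
  shows "C \<in> comps G Q"
proof -
  obtain x where x: "x \<in> C" using assms(2) by blast
  then obtain D where D: "D \<in> comps G Q" "x \<in> D" using comps_cover[of x G Q] assms(1) by blast
  have "C \<subseteq> D"
  proof
    fix y assume "y \<in> C"
    then have "conn G C x y" using assms(3) x by (auto simp: connected_on_def)
    then show "y \<in> D" by (rule conn_closed) (use D comps_closed[OF D(1)] assms(1) in blast)+
  qed
  moreover have "D \<subseteq> C"
  proof
    fix y assume "y \<in> D"
    then have "conn G D x y" using D comps_connected[OF D(1)] by (simp add: connected_on_def)
    then show "y \<in> C" by (rule conn_closed) (use x comps_subset[OF D(1)] cl in blast)+
  qed
  ultimately show ?thesis using D by simp
qed

lemma finite_comps: "simple_graph G \<Longrightarrow> finite (comps G Q)"
  by (rule finite_subset[of _ "Pow (verts G)"]) (use comps_subset simple_graph_finite in auto)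

lemma pairwise_adjD: "pairwise_adj G K \<Longrightarrow> u \<in> K \<Longrightarrow> v \<in> K \<Longrightarrow> u \<noteq> v \<Longrightarrow> adj G u v"
  by (simp add: pairwise_adj_def)

lemma is_cliqueD:
  assumes "is_clique G K"
  shows "K \<subseteq> verts G" "pairwise_adj G K" "u \<in> K \<Longrightarrow> v \<in> K \<Longrightarrow> u \<noteq> v \<Longrightarrow> adj G u v"
    "pairwise_adj G L \<Longrightarrow> K \<subseteq> L \<Longrightarrow> L = K"
proof -
  show "K \<subseteq> verts G" "pairwise_adj G K" using assms unfolding is_clique_def pairwise_adj_def by simp_all
  then show "u \<in> K \<Longrightarrow> v \<in> K \<Longrightarrow> u \<noteq> v \<Longrightarrow> adj G u v" by (simp add: pairwise_adj_def)
  show "pairwise_adj G L \<Longrightarrow> K \<subseteq> L \<Longrightarrow> L = K" using assms unfolding is_clique_def by simp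
qed

lemma is_clique_maximal:
  assumes "is_clique G K" "x \<in> verts G" "\<And>y. y \<in> K \<Longrightarrow> y \<noteq> x \<Longrightarrow> adj G x y"
  shows "x \<in> K"
proof -
  have "adj G x y \<and> adj G y x" if "y \<in> K" "y \<noteq> x" for y
    using assms(3)[OF that] by (simp add: adj_commute[of G y])
  then have "pairwise_adj G (insert x K)"
    using assms(2) is_cliqueD(1,3)[OF assms(1)] unfolding pairwise_adj_def by blast
  then show ?thesis using is_cliqueD(4)[OF assms(1), of "insert x K"] by auto
qed

lemma is_clique_subset_eq: "is_clique G K \<Longrightarrow> is_clique G L \<Longrightarrow> K \<subseteq> L \<Longrightarrow> K = L"
  using is_cliqueD(2,4) by metis

lemma finite_cliques: "simple_graph G \<Longrightarrow> finite {K. is_clique G K}"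
  by (rule finite_subset[of _ "Pow (verts G)"]) (use is_cliqueD(1) simple_graph_finite in auto)

lemma extend_to_clique:
  assumes "simple_graph G" "pairwise_adj G K"
  shows "\<exists>L. is_clique G L \<and> K \<subseteq> L"
proof -
  let ?S = "{L. pairwise_adj G L \<and> K \<subseteq> L}"
  have "finite ?S"
    by (rule finite_subset[of _ "Pow (verts G)"]) (use assms simple_graph_finite in \<open>auto simp: pairwise_adj_def\<close>)
  then obtain L where L: "L \<in> ?S" "\<forall>M\<in>?S. L \<subseteq> M \<longrightarrow> L = M"
    using finite_has_maximal[of ?S] assms by auto
  then have "is_clique G L" unfolding is_clique_def by auto
  then show ?thesis using L by blast
qed

lemma clique_of_edge:
  assumes "simple_graph G" "adj G u v"
  shows "\<exists>K. is_clique G K \<and> u \<in> K \<and> v \<in> K"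
proof -
  have "pairwise_adj G {u, v}" using adjD[OF assms] assms(2) adj_sym by (auto simp: pairwise_adj_def)
  then show ?thesis using extend_to_clique[OF assms(1)] by blast
qed

lemma clique_of_vertex:
  assumes "simple_graph G" "v \<in> verts G"
  shows "\<exists>K. is_clique G K \<and> v \<in> K"
  using extend_to_clique[OF assms(1), of "{v}"] assms(2) by (auto simp: pairwise_adj_def)

lemma clique_nonempty:
  assumes "is_clique G K" "verts G \<noteq> {}"
  shows "K \<noteq> {}"
proof -
  obtain x where "x \<in> verts G" using assms(2) by blast
  then show ?thesis using is_clique_maximal[OF assms(1), of x] by blast
qed

text \<open>A component without edges to \<open>Q\<close> would be closed under adjacency in all of
  \<open>G\<close>, against connectedness, as \<open>Q\<close> is nonempty.\<close>

lemma component_has_neighbour: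
  assumes G: "simple_graph G" "connected_graph G" and Q: "is_clique G Q" and C: "C \<in> comps G Q"
  shows "\<exists>c\<in>C. \<exists>w\<in>Q. adj G w c"
proof (rule ccontr)
  assume no: "\<not> ?thesis"
  obtain c where c: "c \<in> C" using comps_nonempty[OF C] by blast
  have "verts G \<noteq> {}" using G(2) by (simp add: connected_graph_def)
  then obtain q where q: "q \<in> Q" using clique_nonempty[OF Q] by blast
  have "c \<in> verts G" "q \<in> verts G" using comps_subset[OF C] c q is_cliqueD(1)[OF Q] by blast+
  then have "conn G (verts G) c q" using G(2) unfolding connected_graph_iff[OF G(1)] connected_on_def by simp
  then have "q \<in> C"
  proof (rule conn_closed)
    fix u v assume u: "u \<in> C" "adj G u v" "u \<in> verts G" "v \<in> verts G"
    then have "v \<notin> Q" using no adj_sym[OF u(2)] by auto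
    then show "v \<in> C" using comps_closed[OF C u(1,2)] u(4) by simp
  qed (rule c)
  then show False using comps_subset[OF C] q by blast
qed

text \<open>These are the intersections with \<open>Q\<close> of the relevant cliques of the piece
  spanned by \<open>C\<close> and \<open>Q\<close>, but read off \<open>G\<close> itself.\<close>

definition traces :: "'a ugraph \<Rightarrow> 'a set \<Rightarrow> 'a set \<Rightarrow> 'a set set" where
  "traces G Q C = {K \<inter> Q | K. is_clique G K \<and> K \<inter> C \<noteq> {} \<and> K \<inter> Q \<noteq> {}}"

lemma mem_Union_traces:
  assumes "simple_graph G" "C \<inter> Q = {}"
  shows "v \<in> \<Union> (traces G Q C) \<longleftrightarrow> v \<in> Q \<and> (\<exists>y\<in>C. adj G v y)"
proof
  assume "v \<in> \<Union> (traces G Q C)"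
  then obtain K where "is_clique G K" "K \<inter> C \<noteq> {}" "v \<in> K" "v \<in> Q" by (auto simp: traces_def)
  then show "v \<in> Q \<and> (\<exists>y\<in>C. adj G v y)" using is_cliqueD(3)[of G K v] assms(2) by blast
next
  assume "v \<in> Q \<and> (\<exists>y\<in>C. adj G v y)"
  then show "v \<in> \<Union> (traces G Q C)"
  proof (elim conjE bexE)
    fix y assume "v \<in> Q" "y \<in> C" "adj G v y"
    moreover obtain K where "is_clique G K" "v \<in> K" "y \<in> K"
      using clique_of_edge[OF assms(1) \<open>adj G v y\<close>] by blast
    ultimately show ?thesis unfolding traces_def by blast
  qed
qed

lemma clique_meeting_component:
  assumes "is_clique G K" "C \<in> comps G Q" "x \<in> K" "x \<in> C"
  shows "K \<subseteq> C \<union> Q"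
proof
  fix y assume y: "y \<in> K"
  show "y \<in> C \<union> Q"
    using comps_closed[OF assms(2,4), of y] is_cliqueD(1,3)[OF assms(1)] y assms(3,4) by (cases "x = y") auto
qed

text \<open>A clique of \<open>G\<close> that meets \<open>C\<close> cannot leave
  \<open>C \<union> Q\<close>, so for such sets maximality in the piece and in \<open>G\<close>
  agree. A clique of the piece that misses \<open>C\<close> lies in \<open>Q\<close> and hence
  equals \<open>Q\<close>.\<close>

lemma is_clique_piece_iff:
  assumes G: "simple_graph G" "is_clique G Q" and C: "C \<in> comps G Q"
  shows "is_clique (induced G (C \<union> Q)) K \<longleftrightarrow> K = Q \<or> is_clique G K \<and> K \<inter> C \<noteq> {}"
proof -
  have pw: "pairwise_adj (induced G (C \<union> Q)) L \<longleftrightarrow> pairwise_adj G L \<and> L \<subseteq> C \<union> Q" for L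
    using comps_subset[OF C] is_cliqueD(1)[OF G(2)] by (auto simp: pairwise_adj_def adj_induced)
  show ?thesis
  proof
    assume K: "is_clique (induced G (C \<union> Q)) K"
    show "K = Q \<or> is_clique G K \<and> K \<inter> C \<noteq> {}"
    proof (cases "K \<inter> C = {}")
      case True
      then have "K \<subseteq> Q" using is_cliqueD(1)[OF K] by auto
      moreover have "pairwise_adj (induced G (C \<union> Q)) Q" using pw is_cliqueD(2)[OF G(2)] by auto
      ultimately show ?thesis using is_cliqueD(4)[OF K] by blast
    next
      case False
      then obtain x where x: "x \<in> K" "x \<in> C" by blast
      obtain L where L: "is_clique G L" "K \<subseteq> L"
        using extend_to_clique[OF G(1)] pw is_cliqueD(2)[OF K] by blast
      then have "L \<subseteq> C \<union> Q" using clique_meeting_component[OF L(1) C, of x] x by blast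
      then have "L = K" using is_cliqueD(4)[OF K _ L(2)] pw is_cliqueD(2)[OF L(1)] by blast
      then show ?thesis using L x by blast
    qed
  next
    assume "K = Q \<or> is_clique G K \<and> K \<inter> C \<noteq> {}"
    then have K: "is_clique G K" "K \<subseteq> C \<union> Q"
      using clique_meeting_component[OF _ C] G(2) by blast+
    then show "is_clique (induced G (C \<union> Q)) K"
      using pw unfolding is_clique_def by blast
  qed
qed

lemma relevant_clique_iff:
  assumes G: "simple_graph G" "is_clique G Q" and C: "C \<in> comps G Q"
  shows "relevant_clique Q (induced G (C \<union> Q)) K \<longleftrightarrow> is_clique G K \<and> K \<inter> C \<noteq> {} \<and> K \<inter> Q \<noteq> {}"
  unfolding relevant_clique_def is_clique_piece_iff[OF assms]
  using comps_subset[OF C] by blast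

section \<open>Chordal graphs\<close>

lemma is_cycle_inducedI:
  assumes "distinct xs" "length xs \<ge> 3" "simple_graph G"
    and e: "\<And>i k. i < k \<Longrightarrow> k < length xs \<Longrightarrow>
          adj G (xs ! i) (xs ! k) \<longleftrightarrow> k = Suc i \<or> i = 0 \<and> Suc k = length xs"
  shows "is_cycle (induced G (set xs))"
proof -
  let ?m = "length xs"
  have "edges (induced G (set xs)) = {{xs ! i, xs ! (Suc i mod ?m)} | i. i < ?m}"
  proof (intro equalityI subsetI)
    fix f assume "f \<in> edges (induced G (set xs))"
    then have f: "f \<in> edges G" "f \<subseteq> set xs" by (auto simp: induced_def)
    then have "card f = 2" using assms(3) by (simp add: simple_graph_def)
    then obtain u v where uv: "f = {u, v}" "u \<noteq> v" by (auto simp: card_2_iff)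
    then have "u \<in> set xs" "v \<in> set xs" using f(2) by auto
    then obtain i k where ik: "i < ?m" "k < ?m" "u = xs ! i" "v = xs ! k"
      unfolding in_set_conv_nth by blast
    have *: "\<exists>i. {xs ! a, xs ! b} = {xs ! i, xs ! (Suc i mod ?m)} \<and> i < ?m"
      if ab: "a < b" "b < ?m" "adj G (xs ! a) (xs ! b)" for a b
    proof -
      consider "b = Suc a" | "a = 0" "Suc b = ?m" using e[OF ab(1,2)] ab(3) by blast
      then show ?thesis
      proof cases
        case 1 then show ?thesis using ab by (intro exI[of _ a]) auto
      next
        case 2 then show ?thesis using ab by (intro exI[of _ b]) auto
      qed
    qed
    have "adj G u v" "adj G v u" using f(1) uv by (auto simp: adj_def insert_commute)
    then consider "i < k" "adj G (xs ! i) (xs ! k)" | "k < i" "adj G (xs ! k) (xs ! i)"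
      using uv ik by (metis linorder_neqE_nat)
    then have "\<exists>i. {u, v} = {xs ! i, xs ! (Suc i mod ?m)} \<and> i < ?m"
    proof cases
      case 1 then show ?thesis using *[of i k] ik by simp
    next
      case 2 then show ?thesis using *[of k i] ik by (simp add: insert_commute)
    qed
    then show "f \<in> {{xs ! i, xs ! (Suc i mod ?m)} | i. i < ?m}" using uv by blast
  next
    fix f assume "f \<in> {{xs ! i, xs ! (Suc i mod ?m)} | i. i < ?m}"
    then obtain i where i: "f = {xs ! i, xs ! (Suc i mod ?m)}" "i < ?m" by blast
    have "f \<in> edges G"
    proof (cases "Suc i = ?m")
      case True
      then have "adj G (xs ! 0) (xs ! i)" using e[of 0 i] assms(2) by auto
      then show ?thesis using i True by (simp add: adj_def insert_commute)
    next
      case False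
      then show ?thesis using e[of i "Suc i"] i by (simp add: adj_def)
    qed
    moreover have "Suc i mod ?m < ?m" using i(2) by (intro mod_less_divisor) auto
    then have "f \<subseteq> set xs" using i by auto
    ultimately show "f \<in> edges (induced G (set xs))" by (simp add: induced_def)
  qed
  then show ?thesis unfolding is_cycle_def using assms by (intro exI[of _ xs]) simp
qed

text \<open>A vertex \<open>x\<close> of \<open>C\<close> with the most neighbours in \<open>Q\<close> is adjacent to all of them: otherwise
  take a shortest path in \<open>C\<close> from \<open>x\<close> to a vertex with a neighbour \<open>b \<in> Q\<close> that \<open>x\<close> misses.
  Together with \<open>b\<close> and a neighbour \<open>a \<in> Q\<close> of \<open>x\<close> missed by the end of the path it contains an
  induced cycle.\<close>

lemma chordal_dominating_vertex:
  assumes G: "simple_graph G" "chordal G" and Q: "pairwise_adj G Q" and C: "C \<in> comps G Q"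
  shows "\<exists>x\<in>C. \<forall>w\<in>Q. (\<exists>y\<in>C. adj G w y) \<longrightarrow> adj G w x"
proof -
  define N where "N z = {w \<in> Q. adj G w z}" for z
  have finQ: "finite Q" using Q simple_graph_finite[OF G(1)] by (auto simp: pairwise_adj_def finite_subset)
  have finC: "finite C" using comps_subset[OF C] simple_graph_finite[OF G(1)] by (auto intro: finite_subset)
  have CQ: "C \<inter> Q = {}" "C \<subseteq> verts G" using comps_subset[OF C] by auto
  have finN: "finite (N z)" for z using finQ by (simp add: N_def)
  obtain x where x: "x \<in> C" "\<And>z. z \<in> C \<Longrightarrow> card (N z) \<le> card (N x)"
    using ex_greatest_on_finite[OF finC comps_nonempty[OF C], of "\<lambda>z. card (N z)"] by blast
  have "adj G w x" if w: "w \<in> Q" "y0 \<in> C" "adj G w y0" for w y0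
  proof (rule ccontr)
    assume nw: "\<not> adj G w x"
    define R where "R = adj (induced G C)"
    define B where "B = {y \<in> C. \<not> N y \<subseteq> N x}"
    have y0B: "y0 \<in> B" using w nw by (auto simp: B_def N_def)
    have "R\<^sup>*\<^sup>* x y0" using comps_connected[OF C] x w by (simp add: connected_on_def conn_def R_def)
    then have ex: "\<exists>n. \<exists>y\<in>B. (R ^^ n) x y" using y0B by (metis rtranclp_power)
    define n where "n = (LEAST n. \<exists>y\<in>B. (R ^^ n) x y)"
    have nB: "\<exists>y\<in>B. (R ^^ n) x y" unfolding n_def by (rule LeastI_ex[OF ex])
    have least: "n \<le> m" if "y \<in> B" "(R ^^ m) x y" for m y
      unfolding n_def by (rule Least_le) (use that in blast)
    obtain f where f: "f 0 = x" "f n \<in> B" "\<And>i. i < n \<Longrightarrow> R (f i) (f (Suc i))"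
      using nB unfolding relpowp_fun_conv by metis
    have n0: "n > 0" using f by (cases n) (auto simp: B_def)
    have fC: "f i \<in> C" if "i \<le> n" for i
      using that f x(1) by (cases i) (auto simp: R_def adj_induced)
    have walk: "(R ^^ k) (f i) (f (i + k))" if "i + k \<le> n" for i k
      using that
    proof (induction k)
      case (Suc k)
      then show ?case using f(3)[of "i + k"] by auto
    qed simp
    have short: "n \<le> i + m + (n - j)" if "(R ^^ m) (f i) (f j)" "i \<le> n" "j \<le> n" for i j m
    proof -
      have "(R ^^ (i + m)) x (f j)" using walk[of 0 i] that f(1) relpowp_trans[of i R x "f i" m "f j"] by simp
      then have "(R ^^ (i + m + (n - j))) x (f n)"
        using walk[of j "n - j"] that relpowp_trans[of "i + m" R x "f j" "n - j"] by simp
      then show ?thesis using least f(2) by blast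
    qed
    have fne: "f i \<noteq> f j" if "i < j" "j \<le> n" for i j
      using short[of 0 i j] that by auto
    have fadj: "adj G (f i) (f j) \<longleftrightarrow> j = Suc i" if "i < j" "j \<le> n" for i j
    proof
      assume "adj G (f i) (f j)"
      then have "(R ^^ 1) (f i) (f j)" using fC that by (auto simp: R_def adj_induced)
      then show "j = Suc i" using short[of 1 i j] that by auto
    next
      assume "j = Suc i"
      then show "adj G (f i) (f j)" using f(3)[of i] that by (auto simp: R_def adj_induced)
    qed
    \<comment> \<open>By minimality of \<open>n\<close>, no earlier vertex of the path sees a vertex
      of \<open>Q\<close> that \<open>x\<close> misses. So \<open>b\<close> will be adjacent to the
      last vertex only.\<close>
    have fB: "N (f i) \<subseteq> N x" if "i < n" for i
      using least[of "f i" i] walk[of 0 i] that f(1) fC[of i] by (auto simp: B_def)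
    obtain b where b: "b \<in> N (f n)" "b \<notin> N x" using f(2) by (auto simp: B_def)
    \<comment> \<open>\<open>x\<close> has the most neighbours in \<open>Q\<close>, so
      \<open>f n\<close>, which gains \<open>b\<close>, must lose some \<open>a\<close>.\<close>
    have "\<not> N x \<subseteq> N (f n)"
    proof
      assume "N x \<subseteq> N (f n)"
      then have "N x \<subset> N (f n)" using b by blast
      then have "card (N x) < card (N (f n))" using finN by (intro psubset_card_mono)
      then show False using x(2)[of "f n"] fC[of n] by simp
    qed
    then obtain a where a: "a \<in> N x" "a \<notin> N (f n)" by blast
    have abQ: "a \<in> Q" "b \<in> Q" "adj G b (f n)" "\<not> adj G a (f n)" "adj G a (f 0)" "a \<noteq> b"
      using a b f(1) by (auto simp: N_def)
    define j where "j = Max {i. i \<le> n \<and> adj G a (f i)}"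
    have jfin: "finite {i. i \<le> n \<and> adj G a (f i)}" by simp
    have j0: "0 \<in> {i. i \<le> n \<and> adj G a (f i)}" using abQ by simp
    have j: "j \<le> n" "adj G a (f j)"
      using Max_in[OF jfin] j0 unfolding j_def by blast+
    have jmax: "\<not> adj G a (f i)" if "j < i" "i \<le> n" for i
    proof
      assume "adj G a (f i)"
      then have "i \<in> {i. i \<le> n \<and> adj G a (f i)}" using that by simp
      then have "i \<le> j" unfolding j_def by (rule Max_ge[OF jfin])
      then show False using that by simp
    qed
    have jn: "j < n" using j abQ(4) by (cases "j = n") auto
    \<comment> \<open>The cycle is \<open>a, f j, ..., f n, b\<close>, with \<open>n - j + 3\<close>
      vertices, at least four because \<open>j < n\<close>. Entering the path at the last neighbour
      \<open>f j\<close> of \<open>a\<close> avoids chords at \<open>a\<close>.\<close>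
    define m where "m = n - j + 3"
    define h where "h i = (if i = 0 then a else if Suc i = m then b else f (j + i - 1))" for i
    define xs where "xs = map h [0..<m]"
    have m4: "m \<ge> 4" using jn by (simp add: m_def)
    have hf: "h i = f (j + i - 1)" "j + i - 1 \<le> n" if "i \<noteq> 0" "Suc i < m" for i
    proof -
      show "h i = f (j + i - 1)" using that by (simp add: h_def)
      show "j + i - 1 \<le> n" using that j(1) unfolding m_def by linarith
    qed
    have hm: "h (m - 1) = b" "h 0 = a" using m4 by (auto simp: h_def)
    have hrel: "h i \<noteq> h k \<and> (adj G (h i) (h k) \<longleftrightarrow> k = Suc i \<or> i = 0 \<and> Suc k = m)" if ik: "i < k" "k < m" for i k
    proof -
      consider (ab) "i = 0" "k = m - 1" | (af) "i = 0" "Suc k < m" | (fb) "i \<noteq> 0" "k = m - 1" | (ff) "i \<noteq> 0" "Suc k < m"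
        using ik by linarith
      then show ?thesis
      proof cases
        case ab
        then show ?thesis using hm abQ pairwise_adjD[OF Q] m4 by simp
      next
        case af
        have "h k = f (j + k - 1)" "j + k - 1 \<le> n" "h k \<in> C" using hf[of k] af ik fC by auto
        moreover have "a \<noteq> f (j + k - 1)" using calculation CQ abQ by auto
        moreover have "adj G a (f (j + k - 1)) \<longleftrightarrow> k = 1"
        proof (cases "k = 1")
          case True
          then show ?thesis using j by simp
        next
          case False
          then show ?thesis using jmax[of "j + k - 1"] calculation ik af by auto
        qed
        ultimately show ?thesis using af hm by auto
      next
        case fb
        have si: "Suc i < m" using ik fb by linarith
        have hi: "h i = f (j + i - 1)" "j + i - 1 \<le> n" using hf[OF fb(1) si] .
        have "f (j + i - 1) \<noteq> b" using fC[OF hi(2)] CQ abQ by auto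
        moreover have "adj G b (f (j + i - 1)) \<longleftrightarrow> Suc i = m - 1"
        proof (cases "Suc i = m - 1")
          case True
          then have "j + i - 1 = n" using jn by (auto simp: m_def)
          then show ?thesis using abQ True by simp
        next
          case False
          then have "j + i - 1 < n" using si fb jn by (auto simp: m_def)
          then show ?thesis using fB[of "j + i - 1"] b(2) abQ(2) False by (auto simp: N_def)
        qed
        ultimately show ?thesis using fb hi hm adj_commute[of G b] by auto
      next
        case ff
        have si: "Suc i < m" using ik ff by linarith
        have hi: "h i = f (j + i - 1)" "h k = f (j + k - 1)" "j + k - 1 \<le> n" using hf[of i] hf[of k] si ff ik by auto
        have "j + i - 1 < j + k - 1" using ik ff by linarith
        then show ?thesis using fne[of "j + i - 1" "j + k - 1"] fadj[of "j + i - 1" "j + k - 1"] hi ff ik by auto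
      qed
    qed
    have "inj_on h {0..<m}" using hrel by (intro inj_onI) (metis atLeastLessThan_iff linorder_neqE_nat)
    then have dist: "distinct xs" by (simp add: xs_def distinct_map)
    have cyc: "is_cycle (induced G (set xs))"
      by (rule is_cycle_inducedI[OF dist _ G(1)]) (use hrel m4 in \<open>auto simp: xs_def\<close>)
    have "card (set xs) = m" using distinct_card[OF dist] by (simp add: xs_def)
    moreover have "set xs \<subseteq> verts G"
    proof
      fix z assume "z \<in> set xs"
      then obtain i where i: "i < m" "z = h i" by (auto simp: xs_def)
      have "Q \<subseteq> verts G" using Q by (simp add: pairwise_adj_def)
      then show "z \<in> verts G" using i hf[of i] fC[of "j + i - 1"] CQ abQ hm
        by (cases "i = 0"; cases "Suc i = m") (auto simp: h_def)
    qed
    ultimately show False using G(2) cyc m4 unfolding chordal_def by auto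
  qed
  then show ?thesis using x(1) by blast
qed

section \<open>Rooted trees\<close>

text \<open>A rank \<open>d\<close> that drops towards the root takes the place of the distance.
  Parent map and rank can be defined piecewise, which makes it easy to assemble trees from
  parts.\<close>

definition rtree :: "'a ugraph \<Rightarrow> 'a \<Rightarrow> ('a \<Rightarrow> 'a) \<Rightarrow> ('a \<Rightarrow> nat) \<Rightarrow> bool" where
  "rtree T r p d \<longleftrightarrow> finite (verts T) \<and> r \<in> verts T \<and>
     (\<forall>x\<in>verts T - {r}. p x \<in> verts T \<and> d (p x) < d x) \<and>
     edges T = {{x, p x} | x. x \<in> verts T - {r}}"

lemma rtreeD:
  assumes "rtree T r p d"
  shows "finite (verts T)" "r \<in> verts T"
    "x \<in> verts T \<Longrightarrow> x \<noteq> r \<Longrightarrow> p x \<in> verts T"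
    "x \<in> verts T \<Longrightarrow> x \<noteq> r \<Longrightarrow> d (p x) < d x"
    "edges T = {{x, p x} | x. x \<in> verts T - {r}}"
  using assms by (auto simp: rtree_def)

lemma rtree_adj:
  assumes "rtree T r p d"
  shows "adj T x y \<longleftrightarrow> (x \<in> verts T \<and> x \<noteq> r \<and> y = p x) \<or> (y \<in> verts T \<and> y \<noteq> r \<and> x = p y)"
  unfolding adj_def rtreeD(5)[OF assms] by (auto simp: doubleton_eq_iff)

text \<open>On a cycle, both neighbours of a vertex of greatest rank would be its parent, so they
  would coincide.\<close>

lemma rtree_is_tree:
  assumes T: "rtree T r p d"
  shows "is_tree T"
proof -
  have simple: "simple_graph T"
    unfolding simple_graph_def
  proof (intro conjI ballI)
    show "finite (verts T)" by (rule rtreeD(1)[OF T])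
    fix e assume "e \<in> edges T"
    then obtain x where x: "x \<in> verts T" "x \<noteq> r" "e = {x, p x}" using rtreeD(5)[OF T] by auto
    then have "x \<noteq> p x" using rtreeD(4)[OF T, of x] by auto
    then show "e \<subseteq> verts T" "card e = 2" using x rtreeD(3)[OF T] by auto
  qed
  have root: "(adj T)\<^sup>*\<^sup>* x r" if "x \<in> verts T" for x
    using that
  proof (induction "d x" arbitrary: x rule: less_induct)
    case less
    show ?case
    proof (cases "x = r")
      case False
      then have "(adj T)\<^sup>*\<^sup>* (p x) r" using less rtreeD(3,4)[OF T] by blast
      moreover have "adj T x (p x)" using False less rtree_adj[OF T] by blast
      ultimately show ?thesis by (metis converse_rtranclp_into_rtranclp)
    qed simp
  qed
  have "(adj T)\<^sup>*\<^sup>* r x" if "(adj T)\<^sup>*\<^sup>* x r" for x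
    using that
  proof (induction rule: converse_rtranclp_induct)
    case (step y z)
    from step(3) adj_sym[OF step(1)] show ?case by (rule rtranclp.rtrancl_into_rtrancl)
  qed simp
  then have "connected_graph T" using root rtreeD(2)[OF T] unfolding connected_graph_def
    by (metis empty_iff rtranclp_trans)
  moreover have "\<not> (subgraph_of C T \<and> is_cycle C)" for C
  proof
    assume C: "subgraph_of C T \<and> is_cycle C"
    then obtain xs where xs: "length xs \<ge> 3" "distinct xs" "verts C = set xs"
      "edges C = {{xs ! i, xs ! (Suc i mod length xs)} | i. i < length xs}"
      unfolding is_cycle_def by blast
    let ?m = "length xs"
    have xT: "xs ! i \<in> verts T" if "i < ?m" for i
      using that xs(3) C by (auto simp: subgraph_of_def)
    have ad: "adj T (xs ! i) (xs ! (Suc i mod ?m))" if "i < ?m" for i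
      using that xs(4) C by (auto simp: subgraph_of_def adj_def)
    have "{..<?m} \<noteq> {}" using xs(1) by (auto simp: lessThan_empty_iff)
    then obtain i where i: "i < ?m" and max: "\<And>k. k < ?m \<Longrightarrow> d (xs ! k) \<le> d (xs ! i)"
      using ex_greatest_on_finite[of "{..<?m}" "\<lambda>i. d (xs ! i)"] by auto
    have par: "xs ! k = p (xs ! i)" if "k < ?m" "adj T (xs ! i) (xs ! k)" for k
      using that max[of k] rtree_adj[OF T] rtreeD(4)[OF T] by (metis leD)
    define i' where "i' = (if i = 0 then ?m - 1 else i - 1)"
    have i': "i' < ?m" "Suc i' mod ?m = i" using i xs(1) by (auto simp: i'_def)
    have nx: "Suc i mod ?m < ?m" using i by (intro mod_less_divisor) auto
    have "xs ! (Suc i mod ?m) = xs ! i'"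
      using par[OF nx ad[OF i]] par[OF i'(1)] adj_sym[OF ad[OF i'(1)]] i'(2) by simp
    then have "Suc i mod ?m = i'" using nx i'(1) xs(2) nth_eq_iff_index_eq by blast
    then show False using xs(1) i unfolding i'_def
      by (cases "Suc i = ?m") (auto split: if_splits)
  qed
  ultimately show ?thesis using simple unfolding is_tree_def by blast
qed

text \<open>A shortest detour around the edge would close up with it to a cycle.\<close>

lemma tree_edge_bridge:
  assumes T: "is_tree T" and e: "adj T x y"
  shows "\<not> (\<lambda>u v. adj T u v \<and> {u, v} \<noteq> {x, y})\<^sup>*\<^sup>* x y"
proof
  define R where "R u v \<longleftrightarrow> adj T u v \<and> {u, v} \<noteq> {x, y}" for u v
  assume "(\<lambda>u v. adj T u v \<and> {u, v} \<noteq> {x, y})\<^sup>*\<^sup>* x y"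
  then have "R\<^sup>*\<^sup>* x y" unfolding R_def .
  then have ex: "\<exists>n. (R ^^ n) x y" by (simp add: rtranclp_power)
  define n where "n = (LEAST n. (R ^^ n) x y)"
  have n: "(R ^^ n) x y" unfolding n_def by (rule LeastI_ex[OF ex])
  have least: "n \<le> m" if "(R ^^ m) x y" for m unfolding n_def by (rule Least_le) (rule that)
  obtain f where f: "f 0 = x" "f n = y" "\<And>i. i < n \<Longrightarrow> R (f i) (f (Suc i))"
    using n unfolding relpowp_fun_conv by metis
  have simple: "simple_graph T" using T by (simp add: is_tree_def)
  have "x \<noteq> y" using adjD[OF simple e] by simp
  then have "n \<noteq> 0" using f(1,2) by metis
  moreover have "n \<noteq> 1" using f f(3)[of 0] by (auto simp: R_def)
  ultimately have n2: "n \<ge> 2" by linarith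
  have walk: "(R ^^ k) (f i) (f (i + k))" if "i + k \<le> n" for i k
    using that
  proof (induction k)
    case (Suc k)
    then show ?case using f(3)[of "i + k"] by auto
  qed simp
  have fne: "f i \<noteq> f j" if "i < j" "j \<le> n" for i j
  proof
    assume eq: "f i = f j"
    have "(R ^^ i) x (f j)" using walk[of 0 i] that f(1) eq by simp
    moreover have "(R ^^ (n - j)) (f j) y" using walk[of j "n - j"] that f(2) by simp
    ultimately have "(R ^^ (i + (n - j))) x y" by (rule relpowp_trans)
    then show False using least that by fastforce
  qed
  define xs where "xs = map f [0..<Suc n]"
  have len: "length xs = Suc n" by (simp add: xs_def)
  have nth: "xs ! i = f i" if "i \<le> n" for i using that by (simp add: xs_def del: upt_Suc)
  have "inj_on f {0..<Suc n}" using fne by (intro inj_onI) (metis atLeastLessThan_iff less_Suc_eq_le linorder_neqE_nat)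
  then have dist: "distinct xs" by (simp add: xs_def distinct_map del: upt_Suc)
  define C where "C = \<lparr>verts = set xs, edges = {{xs ! i, xs ! (Suc i mod length xs)} | i. i < length xs}\<rparr>"
  have "is_cycle C" unfolding is_cycle_def using dist len n2 by (intro exI[of _ xs]) (simp add: C_def)
  have ed: "adj T (xs ! i) (xs ! (Suc i mod length xs))" if "i < length xs" for i
  proof (cases "i = n")
    case True
    then show ?thesis using len nth f(1,2) adj_sym[OF e] by simp
  next
    case False
    then show ?thesis using that len nth[of i] nth[of "Suc i"] f(3)[of i] by (simp add: R_def)
  qed
  have "set xs \<subseteq> verts T"
    using ed adjD(1)[OF simple] by (metis in_set_conv_nth subsetI)
  then have "subgraph_of C T" using ed unfolding subgraph_of_def C_def by (auto simp: adj_def)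
  then show False using T \<open>is_cycle C\<close> unfolding is_tree_def by blast
qed

text \<open>Parents are neighbours nearer to \<open>r\<close>. Any other edge could be bypassed
  along parent edges through the root, against \<open>tree_edge_bridge\<close>.\<close>

lemma is_tree_rtree:
  assumes T: "is_tree T" and r: "r \<in> verts T"
  shows "\<exists>p d. rtree T r p d"
proof -
  have simple: "simple_graph T" and con: "connected_graph T" using T by (auto simp: is_tree_def)
  define d where "d x = (LEAST n. (adj T ^^ n) r x)" for x
  have ex: "\<exists>n. (adj T ^^ n) r x" if "x \<in> verts T" for x
    using con r that by (simp add: connected_graph_def rtranclp_power)
  have dw: "(adj T ^^ d x) r x" if "x \<in> verts T" for x
    unfolding d_def by (rule LeastI_ex[OF ex[OF that]])
  have dl: "d x \<le> n" if "(adj T ^^ n) r x" for x n unfolding d_def by (rule Least_le) (rule that)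
  have "\<exists>y. adj T x y \<and> d y < d x" if x: "x \<in> verts T" "x \<noteq> r" for x
  proof (cases "d x")
    case 0
    then show ?thesis using dw x by fastforce
  next
    case (Suc n)
    then obtain y where y: "(adj T ^^ n) r y" "adj T y x" using dw[OF x(1)] by auto
    then have "d y < d x" using dl[OF y(1)] Suc by simp
    then show ?thesis using y(2) adj_sym by metis
  qed
  then have "\<forall>x. \<exists>y. x \<in> verts T - {r} \<longrightarrow> adj T x y \<and> d y < d x" by blast
  from choice[OF this] obtain p where
    p: "\<And>x. x \<in> verts T \<Longrightarrow> x \<noteq> r \<Longrightarrow> adj T x (p x) \<and> d (p x) < d x" by blast
  have pT: "p x \<in> verts T" if "x \<in> verts T" "x \<noteq> r" for x
    using p[OF that] adjD(2)[OF simple] by blast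
  have "edges T = {{x, p x} | x. x \<in> verts T - {r}}"
  proof (intro equalityI subsetI)
    fix e assume eT: "e \<in> edges T"
    then have "card e = 2" using simple by (simp add: simple_graph_def)
    then obtain x y where xy: "e = {x, y}" "x \<noteq> y" by (auto simp: card_2_iff)
    then have a: "adj T x y" using eT by (simp add: adj_def)
    show "e \<in> {{x, p x} | x. x \<in> verts T - {r}}"
    proof (rule ccontr)
      assume no: "e \<notin> {{x, p x} | x. x \<in> verts T - {r}}"
      define R where "R u v \<longleftrightarrow> adj T u v \<and> {u, v} \<noteq> {x, y}" for u v
      have Rp: "R z (p z)" "R (p z) z" if "z \<in> verts T" "z \<noteq> r" for z
      proof -
        have "{z, p z} \<noteq> {x, y}" using no that xy(1) by blast
        then show "R z (p z)" "R (p z) z" using p[OF that] adj_sym[of T z "p z"]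
          unfolding R_def by (auto simp: insert_commute)
      qed
      have up: "R\<^sup>*\<^sup>* z r \<and> R\<^sup>*\<^sup>* r z" if "z \<in> verts T" for z
        using that
      proof (induction "d z" arbitrary: z rule: less_induct)
        case less
        show ?case
        proof (cases "z = r")
          case False
          then have "R\<^sup>*\<^sup>* (p z) r \<and> R\<^sup>*\<^sup>* r (p z)" using less p pT by blast
          then show ?thesis using Rp[OF less(2) False]
            by (meson converse_rtranclp_into_rtranclp rtranclp.rtrancl_into_rtrancl)
        qed simp
      qed
      have "R\<^sup>*\<^sup>* x y" using up adjD[OF simple a] by (meson rtranclp_trans)
      then show False using tree_edge_bridge[OF T a] unfolding R_def by simp
    qed
  next
    fix e assume "e \<in> {{x, p x} | x. x \<in> verts T - {r}}"
    then show "e \<in> edges T" using p by (auto simp: adj_def)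
  qed
  then have "rtree T r p d"
    using r p pT simple_graph_finite[OF simple] unfolding rtree_def by auto
  then show ?thesis by blast
qed

section \<open>Ancestors, tops of subtrees and the Helly property\<close>

definition parent_step :: "'a ugraph \<Rightarrow> 'a \<Rightarrow> ('a \<Rightarrow> 'a) \<Rightarrow> 'a \<Rightarrow> 'a \<Rightarrow> bool" where
  "parent_step T r p x y \<longleftrightarrow> x \<in> verts T \<and> x \<noteq> r \<and> y = p x"

definition up :: "'a ugraph \<Rightarrow> 'a \<Rightarrow> ('a \<Rightarrow> 'a) \<Rightarrow> 'a \<Rightarrow> 'a \<Rightarrow> bool" where
  "up T r p = (parent_step T r p)\<^sup>*\<^sup>*"

lemma up_refl [simp]: "up T r p x x" by (simp add: up_def)

lemma up_trans: "up T r p x y \<Longrightarrow> up T r p y z \<Longrightarrow> up T r p x z" by (simp add: up_def)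

lemma up_parent: "x \<in> verts T \<Longrightarrow> x \<noteq> r \<Longrightarrow> up T r p x (p x)"
  unfolding up_def by (rule r_into_rtranclp) (simp add: parent_step_def)

lemma up_cases:
  assumes "up T r p x y"
  obtains "x = y" | "x \<in> verts T" "x \<noteq> r" "up T r p (p x) y"
  using assms unfolding up_def by (cases rule: converse_rtranclpE) (auto simp: parent_step_def)

lemma up_linear: "up T r p x a \<Longrightarrow> up T r p x b \<Longrightarrow> up T r p a b \<or> up T r p b a"
  unfolding up_def
proof (induction rule: rtranclp_induct)
  case (step y z)
  from step(3)[OF step(4)] show ?case
  proof
    assume "(parent_step T r p)\<^sup>*\<^sup>* y b"
    then show ?thesis
    proof (cases rule: converse_rtranclpE)
      case base
      then show ?thesis using step(2) by blast
    next
      case (step w)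
      then have "w = z" using \<open>parent_step T r p y z\<close> by (simp add: parent_step_def)
      then show ?thesis using step by simp
    qed
  next
    assume "(parent_step T r p)\<^sup>*\<^sup>* b y"
    from rtranclp.rtrancl_into_rtrancl[OF this step(2)] show ?thesis by blast
  qed
qed simp

context
  fixes T r p d
  assumes T: "rtree T r p d"
begin

lemma up_depth:
  assumes "up T r p x y"
  shows "d y \<le> d x \<and> (d y = d x \<longrightarrow> y = x)"
  using assms unfolding up_def
proof (induction rule: rtranclp_induct)
  case (step y z)
  then show ?case using rtreeD(4)[OF T, of y] by (auto simp: parent_step_def)
qed simp

lemma up_root: "x \<in> verts T \<Longrightarrow> up T r p x r"
proof (induction "d x" arbitrary: x rule: less_induct)
  case less
  show ?case
  proof (cases "x = r")
    case False
    then have "up T r p (p x) r" using less rtreeD(3,4)[OF T] by blast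
    then show ?thesis using up_parent[OF less(2) False] up_trans by metis
  qed simp
qed

text \<open>Choose \<open>t\<close> of least rank. If another \<open>x\<close> in \<open>S\<close>
  had its parent outside \<open>S\<close>, no edge inside \<open>S\<close> would leave the subtree
  below \<open>x\<close>; then \<open>t\<close> would lie below \<open>x\<close> and have larger
  rank.\<close>

lemma connected_top:
  assumes S: "S \<subseteq> verts T" "S \<noteq> {}" "connected_on T S"
  shows "\<exists>t\<in>S. (\<forall>x\<in>S. x \<noteq> t \<longrightarrow> x \<noteq> r \<and> p x \<in> S) \<and> (t \<noteq> r \<longrightarrow> p t \<notin> S)"
proof -
  obtain t where t: "t \<in> S" and min: "\<And>x. x \<in> S \<Longrightarrow> d t \<le> d x"
    using S(2) ex_has_least_nat[of "\<lambda>x. x \<in> S" _ d] by blast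
  have "p x \<in> S" if x: "x \<in> S" "x \<noteq> t" "x \<noteq> r" for x
  proof (rule ccontr)
    assume px: "p x \<notin> S"
    have "t \<in> {z. up T r p z x}"
    proof (rule conn_closed[of T S x])
      show "conn T S x t" using S(3) x(1) t by (simp add: connected_on_def)
      fix u v assume u: "u \<in> {z. up T r p z x}" "adj T u v" "u \<in> S" "v \<in> S"
      show "v \<in> {z. up T r p z x}"
      proof (cases "v \<in> verts T \<and> v \<noteq> r \<and> u = p v")
        case True
        then show ?thesis using u(1) up_parent[of v T r p] up_trans by (metis mem_Collect_eq)
      next
        case False
        then have v: "u \<in> verts T" "u \<noteq> r" "v = p u" using u(2) rtree_adj[OF T] by blast+
        have "u \<noteq> x" using v u(4) px by auto
        then show ?thesis using u(1) v up_cases[of T r p u x] by auto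
      qed
    qed simp
    then have "d x \<le> d t \<and> (d x = d t \<longrightarrow> x = t)" using up_depth by simp
    then show False using min[OF x(1)] x(2) by simp
  qed
  moreover have "x \<noteq> r" if "x \<in> S" "x \<noteq> t" for x
  proof
    assume "x = r"
    moreover have "up T r p t r" using up_root t S(1) by blast
    ultimately show False using up_depth[of t r] min[of x] that by auto
  qed
  moreover have "p t \<notin> S" if "t \<noteq> r"
    using min[of "p t"] rtreeD(4)[OF T, of t] that t S(1) by fastforce
  ultimately show ?thesis using t by blast
qed

lemma up_in_closed:
  assumes "\<forall>x\<in>S. x \<noteq> t \<longrightarrow> x \<noteq> r \<and> p x \<in> S" and "x \<in> S" "up T r p x a" "up T r p a t"
  shows "a \<in> S"
proof -
  have "up T r p a t \<longrightarrow> a \<in> S"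
    using assms(3) unfolding up_def
  proof (induction rule: rtranclp_induct)
    case base
    show ?case using assms(2) by simp
  next
    case (step y z)
    have y: "y \<in> verts T" "y \<noteq> r" "z = p y" using step(2) by (simp_all add: parent_step_def)
    show ?case
    proof
      assume zt: "(parent_step T r p)\<^sup>*\<^sup>* z t"
      have "y \<in> S" using step(3) converse_rtranclp_into_rtranclp[OF step(2) zt] by blast
      moreover have "d t \<le> d z" using zt up_depth unfolding up_def by blast
      then have "y \<noteq> t" using y rtreeD(4)[OF T, of y] by auto
      ultimately show "z \<in> S" using assms(1) y by blast
    qed
  qed
  then show ?thesis using assms(4) by blast
qed

lemma up_to_top:
  assumes "S \<subseteq> verts T" "\<forall>x\<in>S. x \<noteq> t \<longrightarrow> x \<noteq> r \<and> p x \<in> S" "x \<in> S"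
  shows "up T r p x t"
  using assms(3)
proof (induction "d x" arbitrary: x rule: less_induct)
  case less
  show ?case
  proof (cases "x = t")
    case False
    then have x: "x \<in> verts T" "x \<noteq> r" "p x \<in> S" using assms less(2) by blast+
    then have "up T r p (p x) t" using less(1) rtreeD(4)[OF T] by blast
    then show ?thesis using up_parent[OF x(1,2)] up_trans by metis
  qed simp
qed

text \<open>The top of greatest rank lies in all the sets. From a node common to \<open>S i\<close>
  and \<open>S j\<close>, the two tops are reached on one ascending line, and the top
  \<open>t i\<close> of greatest rank comes no later than \<open>t j\<close>.\<close>

lemma subtree_helly:
  assumes I: "finite I" "I \<noteq> {}"
    and S: "\<And>i. i \<in> I \<Longrightarrow> S i \<subseteq> verts T" "\<And>i. i \<in> I \<Longrightarrow> connected_on T (S i)"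
    and meet: "\<And>i j. i \<in> I \<Longrightarrow> j \<in> I \<Longrightarrow> S i \<inter> S j \<noteq> {}"
  shows "\<exists>q. \<forall>i\<in>I. q \<in> S i"
proof -
  have "\<forall>i. \<exists>t. i \<in> I \<longrightarrow> t \<in> S i \<and> (\<forall>x\<in>S i. x \<noteq> t \<longrightarrow> x \<noteq> r \<and> p x \<in> S i)"
    using connected_top S meet by (metis Int_absorb)
  from choice[OF this] obtain t where
    t: "\<And>i. i \<in> I \<Longrightarrow> t i \<in> S i" "\<And>i. i \<in> I \<Longrightarrow> \<forall>x\<in>S i. x \<noteq> t i \<longrightarrow> x \<noteq> r \<and> p x \<in> S i" by blast
  obtain i where i: "i \<in> I" and max: "\<And>j. j \<in> I \<Longrightarrow> d (t j) \<le> d (t i)"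
    using ex_greatest_on_finite[OF I, of "\<lambda>i. d (t i)"] by blast
  have "t i \<in> S j" if j: "j \<in> I" for j
  proof -
    obtain x where x: "x \<in> S i" "x \<in> S j" using meet[OF i j] by blast
    have u: "up T r p x (t i)" "up T r p x (t j)"
      using up_to_top[OF S(1) t(2) x(1)] up_to_top[OF S(1) t(2) x(2)] i j by simp_all
    from up_linear[OF this] show ?thesis
    proof
      assume "up T r p (t i) (t j)"
      then show ?thesis using up_in_closed[OF t(2)[OF j] x(2) u(1)] by blast
    next
      assume "up T r p (t j) (t i)"
      then have "t i = t j" using up_depth[of "t j" "t i"] max[OF j] by auto
      then show ?thesis using t(1)[OF j] by simp
    qed
  qed
  then show ?thesis by blast
qed

end

section \<open>Path graphs have valid colourings\<close>

definition fam_dom :: "'q set set \<Rightarrow> 'q set set \<Rightarrow> bool" where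
  "fam_dom A B \<longleftrightarrow> \<Union> A \<inter> \<Union> B \<noteq> {} \<and> (\<forall>Y\<in>B. \<Union> A \<subseteq> Y \<or> \<Union> A \<inter> Y = {})"

definition fam_antipodal :: "'q set set \<Rightarrow> 'q set set \<Rightarrow> bool" where
  "fam_antipodal A B \<longleftrightarrow> \<Union> A \<inter> \<Union> B \<noteq> {} \<and> \<not> fam_dom A B \<and> \<not> fam_dom B A"

text \<open>The case \<open>i = j\<close> is left out because \<open>fam_dom A A\<close> can fail: a
  component dominates itself by convention, not by the formula for families.\<close>

definition fam_coloring :: "'i set \<Rightarrow> ('i \<Rightarrow> 'q set set) \<Rightarrow> ('i \<Rightarrow> 'c) \<Rightarrow> bool" where
  "fam_coloring I R f \<longleftrightarrow>
     (\<forall>i\<in>I. \<forall>j\<in>I. i \<noteq> j \<longrightarrow> fam_antipodal (R i) (R j) \<longrightarrow> f i \<noteq> f j) \<and>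
     (\<forall>v. card (f ` {i \<in> I. v \<in> \<Union> (R i)}) \<le> 2)"

definition colorable :: "'a ugraph \<Rightarrow> 'a set \<Rightarrow> bool" where
  "colorable G Q \<longleftrightarrow> (\<exists>f :: 'a set \<Rightarrow> nat. fam_coloring (comps G Q) (traces G Q) f)"

section \<open>Paths through the root of a tree\<close>

definition tree_path :: "'a ugraph \<Rightarrow> 'a list \<Rightarrow> bool" where
  "tree_path T xs \<longleftrightarrow> xs \<noteq> [] \<and> distinct xs \<and> set xs \<subseteq> verts T \<and>
     (\<forall>i. Suc i < length xs \<longrightarrow> adj T (xs ! i) (xs ! Suc i))"

lemma tree_path_of_path:
  assumes "P \<in> paths_of T"
  shows "\<exists>xs. tree_path T xs \<and> verts P = set xs"
proof -
  have P: "subgraph_of P T" "is_path P" using assms by (auto simp: paths_of_def)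
  then obtain xs where xs: "xs \<noteq> []" "distinct xs" "verts P = set xs"
    "edges P = {{xs ! i, xs ! Suc i} | i. Suc i < length xs}" unfolding is_path_def by blast
  then have "tree_path T xs" using P(1) unfolding tree_path_def subgraph_of_def adj_def by auto
  then show ?thesis using xs(3) by blast
qed

lemma tree_path_rev: "tree_path T xs \<Longrightarrow> tree_path T (rev xs)"
  unfolding tree_path_def
proof (elim conjE, intro conjI allI impI)
  fix i assume a: "\<forall>i. Suc i < length xs \<longrightarrow> adj T (xs ! i) (xs ! Suc i)" and i: "Suc i < length (rev xs)"
  define k where "k = length xs - Suc (Suc i)"
  have "rev xs ! i = xs ! Suc k" "rev xs ! Suc i = xs ! k" "Suc k < length xs"
    using i by (auto simp: rev_nth k_def Suc_diff_Suc)
  then show "adj T (rev xs ! i) (rev xs ! Suc i)" using a adj_sym by metis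
qed auto

lemma tree_path_connected:
  assumes "tree_path T xs"
  shows "connected_on T (set xs)"
proof -
  have 0: "i < length xs \<Longrightarrow> conn T (set xs) (xs ! 0) (xs ! i)" for i
  proof (induction i)
    case (Suc i)
    have "adj T (xs ! i) (xs ! Suc i)" using assms Suc.prems by (simp add: tree_path_def)
    then show ?case using Suc conn_step[of T "set xs" "xs ! 0" "xs ! i" "xs ! Suc i"] by simp
  qed simp
  show ?thesis unfolding connected_on_def
  proof (intro ballI)
    fix x y assume "x \<in> set xs" "y \<in> set xs"
    then obtain i j where "i < length xs" "j < length xs" "x = xs ! i" "y = xs ! j"
      unfolding in_set_conv_nth by blast
    then show "conn T (set xs) x y" using 0 conn_sym conn_trans by metis
  qed
qed

text \<open>Past the root the path only descends: an ascending edge after \<open>xs ! k\<close>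
  would lead to the parent of \<open>xs ! k\<close>, which is the preceding node.\<close>

lemma tree_path_parent:
  assumes T: "rtree T q p d" and xs: "tree_path T xs" and m: "m < k" "k < length xs" "xs ! m = q"
  shows "xs ! k \<noteq> q \<and> p (xs ! k) = xs ! (k - 1)"
  using m(1,2)
proof (induction k)
  case (Suc k)
  have dist: "distinct xs" and a: "adj T (xs ! k) (xs ! Suc k)" using xs Suc.prems by (auto simp: tree_path_def)
  from a consider "xs ! k \<noteq> q" "xs ! Suc k = p (xs ! k)" | "xs ! Suc k \<noteq> q" "xs ! k = p (xs ! Suc k)"
    unfolding rtree_adj[OF T] by blast
  then show ?case
  proof cases
    case 1
    then have "m < k" using Suc.prems m(3) by (cases "m = k") auto
    then have "xs ! Suc k = xs ! (k - 1)" using Suc 1 by simp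
    then have "Suc k = k - 1" using dist Suc.prems nth_eq_iff_index_eq[of xs "Suc k" "k - 1"] by simp
    then show ?thesis by simp
  qed simp
qed simp

lemma tree_path_parent':
  assumes T: "rtree T q p d" and xs: "tree_path T xs" and m: "k < m" "m < length xs" "xs ! m = q"
  shows "xs ! k \<noteq> q \<and> p (xs ! k) = xs ! Suc k"
proof -
  define n where "n = length xs"
  have *: "rev xs ! (n - Suc i) = xs ! i" if "i < n" for i
    using that by (simp add: rev_nth n_def Suc_diff_Suc)
  have "rev xs ! (n - Suc k) \<noteq> q \<and> p (rev xs ! (n - Suc k)) = rev xs ! (n - Suc k - 1)"
    by (rule tree_path_parent[OF T tree_path_rev[OF xs], of "n - Suc m"])
       (use m * in \<open>auto simp: n_def\<close>)
  moreover have "n - Suc k - 1 = n - Suc (Suc k)" by simp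
  ultimately show ?thesis using *[of k] *[of "Suc k"] m by (simp add: n_def)
qed

text \<open>A path through the root splits at \<open>q\<close> into two descending branches. The
  colouring argument uses just this: two children at the root, and no branching below.\<close>

lemma tree_path_children:
  assumes T: "rtree T q p d" and xs: "tree_path T xs" and q: "q \<in> set xs"
  shows "card {y \<in> set xs. y \<noteq> q \<and> p y = q} \<le> 2"
    and "y \<in> set xs \<Longrightarrow> z \<in> set xs \<Longrightarrow> y \<noteq> q \<Longrightarrow> z \<noteq> q \<Longrightarrow> p y \<noteq> q \<Longrightarrow> p y = p z \<Longrightarrow> y = z"
proof -
  obtain m where m: "m < length xs" "xs ! m = q" using q unfolding in_set_conv_nth by blast
  have dist: "distinct xs" using xs by (simp add: tree_path_def)
  have par: "p (xs ! k) = xs ! (if m < k then k - 1 else Suc k)" if "k < length xs" "k \<noteq> m" for k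
    using tree_path_parent[OF T xs _ that(1) m(2)] tree_path_parent'[OF T xs _ m] that(2) by auto
  have inj: "i = j" if "xs ! i = xs ! j" "i < length xs" "j < length xs" for i j
    using nth_eq_iff_index_eq[OF dist] that by blast
  have "{y \<in> set xs. y \<noteq> q \<and> p y = q} \<subseteq> {xs ! (m - 1), xs ! Suc m}"
  proof
    fix y assume "y \<in> {y \<in> set xs. y \<noteq> q \<and> p y = q}"
    then obtain k where k: "k < length xs" "y = xs ! k" "y \<noteq> q" "p y = q" unfolding in_set_conv_nth by blast
    then have "k \<noteq> m" using m by blast
    then have "xs ! (if m < k then k - 1 else Suc k) = xs ! m" using par[OF k(1)] k m(2) by simp
    moreover have "(if m < k then k - 1 else Suc k) < length xs" using k(1) m(1) \<open>k \<noteq> m\<close> by auto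
    ultimately have "(if m < k then k - 1 else Suc k) = m" using inj m(1) by blast
    then show "y \<in> {xs ! (m - 1), xs ! Suc m}" using k(2) by (auto split: if_splits)
  qed
  then show "card {y \<in> set xs. y \<noteq> q \<and> p y = q} \<le> 2" by (rule card_le_2_of_subset_pair)
  assume y: "y \<in> set xs" "z \<in> set xs" "y \<noteq> q" "z \<noteq> q" "p y \<noteq> q" "p y = p z"
  then obtain k l where kl: "k < length xs" "l < length xs" "y = xs ! k" "z = xs ! l"
    unfolding in_set_conv_nth by blast
  have ne: "k \<noteq> m" "l \<noteq> m" using y kl m by auto
  have lt: "(if m < i then i - 1 else Suc i) < length xs" if "i < length xs" "i \<noteq> m" for i
    using that m(1) by auto
  have "xs ! (if m < k then k - 1 else Suc k) = xs ! (if m < l then l - 1 else Suc l)"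
    using par[OF kl(1) ne(1)] par[OF kl(2) ne(2)] y(6) kl by simp
  then have eq: "(if m < k then k - 1 else Suc k) = (if m < l then l - 1 else Suc l)"
    using inj lt kl(1,2) ne by blast
  have "(if m < k then k - 1 else Suc k) \<noteq> m" using par[OF kl(1) ne(1)] y(5) kl(3) m(2) by auto
  then have "k = l" using eq ne by (cases "m < k"; cases "m < l") auto
  then show "y = z" using kl(3,4) by simp
qed

text \<open>The node \<open>b\<close> singles out one branch of the path, and a branch is a chain.
  The induction follows the ascent from \<open>x\<close> to \<open>b\<close>.\<close>

lemma up_comparable:
  assumes T: "rtree T q p d" and xs: "tree_path T xs" and q: "q \<in> set xs"
    and cl: "\<And>x. x \<in> set xs \<Longrightarrow> x \<noteq> q \<Longrightarrow> p x \<in> set xs"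
    and x: "x \<in> set xs" "up T q p x b" and y: "y \<in> set xs" "up T q p y b" and b: "b \<noteq> q"
  shows "up T q p x y \<or> up T q p y x"
  using x(2,1) unfolding up_def
proof (induction rule: converse_rtranclp_induct)
  case base
  then show ?case using y(2) by (simp add: up_def)
next
  case (step x x')
  have x': "x \<in> verts T" "x \<noteq> q" "x' = p x" using step(1) by (simp_all add: parent_step_def)
  have x'S: "x' \<in> set xs" using cl step(4) x' by blast
  have "x' \<noteq> q"
  proof
    assume "x' = q"
    then have "up T q p q b" using step(2) by (simp add: up_def)
    then show False using b by (cases rule: up_cases) auto
  qed
  from step(3)[OF x'S] show ?case
  proof
    assume "(parent_step T q p)\<^sup>*\<^sup>* x' y"
    with step(1) have "(parent_step T q p)\<^sup>*\<^sup>* x y" by (rule converse_rtranclp_into_rtranclp)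
    then show ?thesis by blast
  next
    assume yx': "(parent_step T q p)\<^sup>*\<^sup>* y x'"
    from yx' show ?thesis
    proof (cases rule: rtranclp.cases)
      case rtrancl_refl
      then show ?thesis using step(1) by auto
    next
      case (rtrancl_into_rtrancl y')
      have y': "y' \<in> verts T" "y' \<noteq> q" "x' = p y'" using rtrancl_into_rtrancl(2) by (simp_all add: parent_step_def)
      have "up T q p y y'" using rtrancl_into_rtrancl(1) by (simp add: up_def)
      then have "y' \<in> set xs"
        using up_in_closed[OF T _ y(1) _ up_root[OF T y'(1)]] cl by blast
      then have "y' = x" using tree_path_children(2)[OF T xs q, of y' x] y' x' step(4) \<open>x' \<noteq> q\<close> by metis
      then show ?thesis using rtrancl_into_rtrancl(1) by blast
    qed
  qed
qed

text \<open>Root the tree at a node \<open>q\<close> common to the paths of the vertices of \<open>Q\<close> and colour a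
  component by the child of \<open>q\<close> above its subtree. Components in the same branch that share a
  vertex of \<open>Q\<close> have their tops on one descending path, and the lower one is dominated by the
  upper one.\<close>

theorem path_graph_colorable:
  assumes G: "simple_graph G" and pg: "path_graph G" and Q: "is_clique G Q" and ne: "verts G \<noteq> {}"
  shows "colorable G Q"
proof -
  obtain T :: "nat ugraph" and \<P> \<phi> where T: "is_tree T" and P: "\<P> \<subseteq> paths_of T" "bij_betw \<phi> (verts G) \<P>"
    and adj: "\<And>u v. u \<in> verts G \<Longrightarrow> v \<in> verts G \<Longrightarrow> u \<noteq> v \<Longrightarrow>
        adj G u v \<longleftrightarrow> verts (\<phi> u) \<inter> verts (\<phi> v) \<noteq> {}"
    using pg unfolding path_graph_def by blast
  define S where "S v = verts (\<phi> v)" for v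
  have "\<forall>v. \<exists>xs. v \<in> verts G \<longrightarrow> tree_path T xs \<and> S v = set xs"
    using tree_path_of_path P unfolding S_def bij_betw_def by blast
  from choice[OF this] obtain xs where
    xs: "\<And>v. v \<in> verts G \<Longrightarrow> tree_path T (xs v)" "\<And>v. v \<in> verts G \<Longrightarrow> S v = set (xs v)" by blast
  have ST: "S v \<subseteq> verts T" "S v \<noteq> {}" "connected_on T (S v)" if "v \<in> verts G" for v
    using xs[OF that] tree_path_connected by (auto simp: tree_path_def)
  have meet: "S u \<inter> S v \<noteq> {}" if "u \<in> verts G" "v \<in> verts G" "u = v \<or> adj G u v" for u v
    using that adj[of u v] ST(2)[of u] adjD(3)[OF G, of u v] by (auto simp: S_def)
  have QV: "Q \<subseteq> verts G" using is_cliqueD(1)[OF Q] .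
  have finV: "finite (verts G)" using simple_graph_finite[OF G] .
  obtain r0 where "r0 \<in> verts T" using T unfolding is_tree_def connected_graph_def by blast
  then obtain p0 d0 where T0: "rtree T r0 p0 d0" using is_tree_rtree[OF T] by blast
  have helly: "\<exists>k. \<forall>v\<in>K. k \<in> S v" if K: "is_clique G K" for K
  proof (rule subtree_helly[OF T0])
    show "finite K" using is_cliqueD(1)[OF K] finV finite_subset by blast
    show "K \<noteq> {}" using clique_nonempty[OF K ne] .
    show "S i \<subseteq> verts T" "connected_on T (S i)" if "i \<in> K" for i using ST that is_cliqueD(1)[OF K] by blast+
    show "S i \<inter> S j \<noteq> {}" if "i \<in> K" "j \<in> K" for i j
      using meet[of i j] that is_cliqueD(1,3)[OF K] by blast
  qed
  \<comment> \<open>By maximality, a node common to all the paths of a clique lies on no other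
    path.\<close>
  have in_clique: "w \<in> K" if K: "is_clique G K" "\<forall>v\<in>K. k \<in> S v" and w: "w \<in> verts G" "k \<in> S w" for w k K
  proof (rule is_clique_maximal[OF K(1) w(1)])
    fix y assume y: "y \<in> K" "y \<noteq> w"
    then show "adj G w y" using adj[of w y] K w is_cliqueD(1)[OF K(1)] by (auto simp: S_def)
  qed
  obtain q where q: "\<forall>v\<in>Q. q \<in> S v" using helly[OF Q] by blast
  have "Q \<noteq> {}" using clique_nonempty[OF Q ne] .
  then have "q \<in> verts T" using q ST QV by blast
  then obtain p d where R: "rtree T q p d" using is_tree_rtree[OF T] by blast
  let ?up = "up T q p"
  have S_cl: "p x \<in> S v" if "v \<in> Q" "x \<in> S v" "x \<noteq> q" for v x
  proof -
    have v: "v \<in> verts G" "q \<in> S v" using that QV q by auto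
    obtain t where t: "t \<in> S v" "\<forall>x\<in>S v. x \<noteq> t \<longrightarrow> x \<noteq> q \<and> p x \<in> S v"
      using connected_top[OF R ST[OF v(1)]] by blast
    then have "t = q" using v(2) by metis
    then show ?thesis using t that by blast
  qed
  have S_up: "a \<in> S v" if "v \<in> Q" "x \<in> S v" "?up x a" for v x a
  proof -
    have "a \<in> verts T" using that(3,2) ST[of v] QV that(1) unfolding up_def
      by (induction rule: rtranclp_induct) (auto simp: parent_step_def intro: rtreeD(3)[OF R])
    then show ?thesis using up_in_closed[OF R, of "S v" q x a] S_cl that up_root[OF R] by blast
  qed
  define A where "A C = (\<Union>v\<in>C. S v)" for C
  have CV: "C \<subseteq> verts G" "C \<inter> Q = {}" "C \<noteq> {}" if "C \<in> comps G Q" for C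
    using comps_subset[OF that] comps_nonempty[OF that] by auto
  have A_T: "A C \<subseteq> verts T" "A C \<noteq> {}" if C: "C \<in> comps G Q" for C
  proof -
    show "A C \<subseteq> verts T" using CV(1)[OF C] ST(1) unfolding A_def by (intro UN_least) blast
    obtain c where "c \<in> C" using CV(3)[OF C] by blast
    then show "A C \<noteq> {}" using CV(1)[OF C] ST(2)[of c] unfolding A_def by auto
  qed
  have qA: "q \<notin> A C" if C: "C \<in> comps G Q" for C
    using in_clique[OF Q q] CV[OF C] unfolding A_def by blast
  have A_conn: "connected_on T (A C)" if C: "C \<in> comps G Q" for C
    unfolding connected_on_def
  proof (intro ballI)
    fix a b assume "a \<in> A C" "b \<in> A C"
    then obtain u v where uv: "u \<in> C" "v \<in> C" "a \<in> S u" "b \<in> S v" by (auto simp: A_def)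
    have SA: "conn T (A C) x y" if "z \<in> C" "x \<in> S z" "y \<in> S z" for x y z
      using ST(3)[of z] CV(1)[OF C] that conn_mono[of T "S z" x y "A C"]
      unfolding connected_on_def A_def by blast
    have "conn G C u v" using comps_connected[OF C] uv by (simp add: connected_on_def)
    then have "\<forall>b\<in>S v. conn T (A C) a b"
      unfolding conn_def[of G]
    proof (induction rule: rtranclp_induct)
      case base
      then show ?case using SA uv by blast
    next
      case (step y z)
      then have yz: "y \<in> C" "z \<in> C" "adj G y z" by (auto simp: adj_induced)
      have "y \<in> verts G" "z \<in> verts G" using yz CV(1)[OF C] by auto
      then obtain c where c: "c \<in> S y" "c \<in> S z" using meet[of y z] yz(3) by auto
      have "conn T (A C) a c" using step(3) c(1) by blast
      then show ?case using SA[OF yz(2) c(2)] conn_trans[of T "A C" a c] by blast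
    qed
    then show "conn T (A C) a b" using uv by blast
  qed
  have "\<forall>C. \<exists>t. C \<in> comps G Q \<longrightarrow> t \<in> A C \<and> (\<forall>x\<in>A C. x \<noteq> t \<longrightarrow> x \<noteq> q \<and> p x \<in> A C)"
  proof
    fix C
    show "\<exists>t. C \<in> comps G Q \<longrightarrow> t \<in> A C \<and> (\<forall>x\<in>A C. x \<noteq> t \<longrightarrow> x \<noteq> q \<and> p x \<in> A C)"
    proof (cases "C \<in> comps G Q")
      case True
      from connected_top[OF R A_T[OF True] A_conn[OF True]] show ?thesis by blast
    qed simp
  qed
  from choice[OF this] obtain t where
    t: "\<And>C. C \<in> comps G Q \<Longrightarrow> t C \<in> A C"
       "\<And>C. C \<in> comps G Q \<Longrightarrow> \<forall>x\<in>A C. x \<noteq> t C \<longrightarrow> x \<noteq> q \<and> p x \<in> A C" by blast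
  have up_t: "?up x (t C)" if "C \<in> comps G Q" "x \<in> A C" for x C
    using up_to_top[OF R A_T(1) t(2)] that by blast
  have "\<exists>b. ?up x b \<and> b \<in> verts T \<and> b \<noteq> q \<and> p b = q" if "x \<in> verts T" "x \<noteq> q" for x
    using that
  proof (induction "d x" arbitrary: x rule: less_induct)
    case less
    show ?case
    proof (cases "p x = q")
      case False
      then obtain b where "?up (p x) b" "b \<in> verts T" "b \<noteq> q" "p b = q" using less rtreeD(3,4)[OF R] by blast
      then show ?thesis using up_parent[OF less(2,3)] up_trans by metis
    qed (use less in \<open>auto intro: exI[of _ x]\<close>)
  qed
  then have "\<forall>x. \<exists>b. x \<in> verts T \<and> x \<noteq> q \<longrightarrow> ?up x b \<and> b \<in> verts T \<and> b \<noteq> q \<and> p b = q" by blast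
  from choice[OF this] obtain br where
    br: "\<And>x. x \<in> verts T \<Longrightarrow> x \<noteq> q \<Longrightarrow> ?up x (br x) \<and> br x \<noteq> q \<and> p (br x) = q" by blast
  define f where "f C = br (t C)" for C
  have tq: "t C \<in> verts T" "t C \<noteq> q" if "C \<in> comps G Q" for C using t(1) A_T qA that by blast+
  have f: "?up (t C) (f C)" "f C \<noteq> q" "p (f C) = q" if "C \<in> comps G Q" for C
    using br[OF tq[OF that]] by (simp_all add: f_def)
  \<comment> \<open>The path of \<open>v\<close> contains \<open>q\<close> and a node of
    \<open>A C\<close>; the ascent from that node to \<open>q\<close> passes the top
    \<open>t C\<close>.\<close>
  have W: "v \<in> Q \<and> t C \<in> S v" if C: "C \<in> comps G Q" and v: "v \<in> \<Union> (traces G Q C)" for C v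
  proof -
    obtain y where y: "v \<in> Q" "y \<in> C" "adj G v y"
      using v mem_Union_traces[OF G CV(2)[OF C], of v] by blast
    then obtain x where x: "x \<in> S v" "x \<in> S y" using meet[of v y] QV CV(1)[OF C] by blast
    then have "x \<in> A C" using y by (auto simp: A_def)
    then show ?thesis using S_up[OF y(1) x(1)] up_t[OF C] y(1) by blast
  qed
  \<comment> \<open>The colours at \<open>v\<close> are children of \<open>q\<close> on the path of
    \<open>v\<close> itself.\<close>
  have two: "card (f ` {C \<in> comps G Q. v \<in> \<Union> (traces G Q C)}) \<le> 2" for v
  proof (cases "v \<in> Q")
    case True
    have "v \<in> verts G" using True QV by blast
    with True q xs(2)[of v] have v: "v \<in> verts G" "q \<in> set (xs v)" by auto
    have "f ` {C \<in> comps G Q. v \<in> \<Union> (traces G Q C)} \<subseteq> {y \<in> set (xs v). y \<noteq> q \<and> p y = q}"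
      using f W S_up[OF True] xs(2)[OF v(1)] by blast
    then have "card (f ` {C \<in> comps G Q. v \<in> \<Union> (traces G Q C)}) \<le> card {y \<in> set (xs v). y \<noteq> q \<and> p y = q}"
      by (intro card_mono) auto
    also have "\<dots> \<le> 2" by (rule tree_path_children(1)[OF R xs(1)[OF v(1)] v(2)])
    finally show ?thesis .
  next
    case False
    then have "{C \<in> comps G Q. v \<in> \<Union> (traces G Q C)} = {}" using W by blast
    then show ?thesis by (metis card.empty image_empty le0)
  qed
  have below: "fam_dom (traces G Q D) (traces G Q C)"
    if C: "C \<in> comps G Q" and D: "D \<in> comps G Q" "C \<noteq> D" and fe: "f C = f D"
      and v: "v \<in> \<Union> (traces G Q C)" "v \<in> \<Union> (traces G Q D)" and u: "?up (t D) (t C)" for C D v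
    unfolding fam_dom_def
  proof (intro conjI ballI)
    show "\<Union> (traces G Q D) \<inter> \<Union> (traces G Q C) \<noteq> {}" using v by blast
    fix Y assume "Y \<in> traces G Q C"
    then obtain K where K: "is_clique G K" "K \<inter> C \<noteq> {}" "Y = K \<inter> Q" by (auto simp: traces_def)
    obtain k where k: "\<forall>v\<in>K. k \<in> S v" using helly[OF K(1)] by blast
    have kA: "k \<in> A C" using k K(2) by (auto simp: A_def)
    have disj: "t D \<notin> A C"
    proof
      assume "t D \<in> A C"
      then obtain c e where ce: "c \<in> C" "e \<in> D" "t D \<in> S c" "t D \<in> S e" using t(1)[OF D(1)] by (auto simp: A_def)
      then have "c \<noteq> e" using comps_eq[OF C D(1)] D(2) by blast
      then have "adj G c e" using adj[of c e] ce CV(1)[OF C] CV(1)[OF D(1)] by (auto simp: S_def)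
      then have "e \<in> C" using comps_closed[OF C ce(1)] comps_subset[OF D(1)] ce(2) by blast
      then show False using comps_eq[OF C D(1)] D(2) ce(2) by blast
    qed
    show "\<Union> (traces G Q D) \<subseteq> Y \<or> \<Union> (traces G Q D) \<inter> Y = {}"
    proof (rule disjCI)
      assume "\<Union> (traces G Q D) \<inter> Y \<noteq> {}"
      then obtain w where w: "w \<in> \<Union> (traces G Q D)" "w \<in> K" "w \<in> Q" using K(3) by blast
      have "w \<in> verts G" using w(3) QV by blast
      with w(3) q xs(2)[of w] have ww: "w \<in> verts G" "q \<in> set (xs w)" by auto
      \<comment> \<open>Both nodes lie in one branch of the path of \<open>w\<close>. If
        \<open>k\<close> were below \<open>t D\<close>, then \<open>t D\<close> would lie between
        \<open>k\<close> and \<open>t C\<close> and so belong to \<open>A C\<close>. Hence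
        \<open>k\<close> is above \<open>t D\<close>, on the path of every vertex attached to
        \<open>D\<close>, and all these vertices belong to \<open>K\<close>.\<close>
      have "?up (t D) k \<or> ?up k (t D)"
      proof (rule up_comparable[OF R xs(1)[OF ww(1)] ww(2)])
        show "p x \<in> set (xs w)" if "x \<in> set (xs w)" "x \<noteq> q" for x
          using S_cl[OF w(3)] that xs(2)[OF ww(1)] by simp
        show "t D \<in> set (xs w)" "k \<in> set (xs w)" using W[OF D(1) w(1)] k w(2) xs(2)[OF ww(1)] by auto
        show "?up (t D) (f D)" "f D \<noteq> q" by (rule f[OF D(1)])+
        show "?up k (f D)" using up_trans[OF up_t[OF C kA] f(1)[OF C]] fe by simp
      qed
      moreover have "\<not> ?up k (t D)"
        using up_in_closed[OF R t(2)[OF C] kA _ u] disj by blast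
      ultimately have up: "?up (t D) k" by blast
      have "w' \<in> K \<and> w' \<in> Q" if w': "w' \<in> \<Union> (traces G Q D)" for w'
        using in_clique[OF K(1) k] W[OF D(1) w'] S_up[OF _ _ up] QV by blast
      then show "\<Union> (traces G Q D) \<subseteq> Y" using K(3) by blast
    qed
  qed
  have "fam_coloring (comps G Q) (traces G Q) f"
    unfolding fam_coloring_def
  proof (intro conjI ballI impI allI)
    fix C D assume C: "C \<in> comps G Q" and D: "D \<in> comps G Q" "C \<noteq> D"
      and ap: "fam_antipodal (traces G Q C) (traces G Q D)"
    show "f C \<noteq> f D"
    proof
      assume fe: "f C = f D"
      obtain v where v: "v \<in> \<Union> (traces G Q C)" "v \<in> \<Union> (traces G Q D)"
        using ap unfolding fam_antipodal_def by blast
      have vQ: "v \<in> Q" "t C \<in> S v" "t D \<in> S v" using W C D v by blast+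
      have vv: "v \<in> verts G" "q \<in> set (xs v)" using vQ(1) QV q xs(2)[of v] by auto
      have "?up (t C) (t D) \<or> ?up (t D) (t C)"
      proof (rule up_comparable[OF R xs(1)[OF vv(1)] vv(2)])
        show "p x \<in> set (xs v)" if "x \<in> set (xs v)" "x \<noteq> q" for x
          using S_cl[OF vQ(1)] that xs(2)[OF vv(1)] by simp
        show "t C \<in> set (xs v)" "t D \<in> set (xs v)" using vQ xs(2)[OF vv(1)] by auto
        show "?up (t C) (f C)" "f C \<noteq> q" by (rule f[OF C])+
        show "?up (t D) (f C)" using f(1)[OF D(1)] fe by simp
      qed
      then show False
        using below[OF C D fe v] below[OF D(1) C D(2)[symmetric] fe[symmetric] v(2,1)] ap
        unfolding fam_antipodal_def by blast
    qed
  qed (rule two)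
  then show ?thesis unfolding colorable_def by blast
qed

section \<open>Clique trees whose vertex subtrees are paths\<close>

lemma clique_separator_iff: "clique_separator G Q \<longleftrightarrow> is_clique G Q \<and> card (comps G Q) \<ge> 2"
  by (simp add: clique_separator_def comps_def)

definition piece :: "'a ugraph \<Rightarrow> 'a set \<Rightarrow> 'a set \<Rightarrow> 'a ugraph" where
  "piece G Q C = induced G (C \<union> Q)"

lemma piece_verts [simp]: "verts (piece G Q C) = C \<union> Q" by (simp add: piece_def)

lemma adj_piece: "adj (piece G Q C) u v \<longleftrightarrow> adj G u v \<and> u \<in> C \<union> Q \<and> v \<in> C \<union> Q"
  by (simp add: piece_def adj_induced)

lemma conn_piece: "S \<subseteq> C \<union> Q \<Longrightarrow> conn (piece G Q C) S = conn G S"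
  by (simp add: conn_def piece_def induced_induced)

lemma piece_simple:
  "simple_graph G \<Longrightarrow> is_clique G Q \<Longrightarrow> C \<in> comps G Q \<Longrightarrow> simple_graph (piece G Q C)"
  unfolding piece_def by (rule simple_induced) (use comps_subset is_cliqueD(1) in blast)+

lemma is_clique_piece:
  "simple_graph G \<Longrightarrow> is_clique G Q \<Longrightarrow> C \<in> comps G Q \<Longrightarrow>
     is_clique (piece G Q C) K \<longleftrightarrow> K = Q \<or> is_clique G K \<and> K \<inter> C \<noteq> {}"
  unfolding piece_def by (rule is_clique_piece_iff)

text \<open>A component of \<open>G - Q'\<close> restricts to at most one component of the piece minus \<open>Q'\<close>, and
  the traces on \<open>Q'\<close> can only grow from the piece to \<open>G\<close>, with the same union. So antipodal
  components of the piece lie in antipodal components of \<open>G\<close>.\<close>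

lemma colorable_piece:
  assumes G: "simple_graph G" and Q: "is_clique G Q" and C: "C \<in> comps G Q"
    and sep: "clique_separator (piece G Q C) Q'"
    and col: "\<And>Q'. clique_separator G Q' \<Longrightarrow> colorable G Q'"
  shows "colorable (piece G Q C) Q'"
proof -
  let ?H = "piece G Q C"
  have H: "simple_graph ?H" by (rule piece_simple[OF G Q C])
  have CV: "C \<subseteq> verts G - Q" by (rule comps_subset[OF C])
  have QV: "Q \<subseteq> verts G" by (rule is_cliqueD(1)[OF Q])
  have clQ': "is_clique ?H Q'" and card2: "card (comps ?H Q') \<ge> 2" using sep by (auto simp: clique_separator_iff)
  have Q'H: "Q' \<subseteq> C \<union> Q" using is_cliqueD(1)[OF clQ'] by simp
  have ne: "Q' \<noteq> Q"
  proof
    assume eq: "Q' = Q"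
    have "D = C" if D: "D \<in> comps ?H Q" for D
    proof -
      have DC: "D \<subseteq> C" using comps_subset[OF D] by auto
      obtain x where x: "x \<in> D" using comps_nonempty[OF D] by blast
      have "y \<in> D" if "y \<in> C" for y
      proof -
        have "conn G C x y" using comps_connected[OF C] x DC that by (auto simp: connected_on_def)
        then show ?thesis
        proof (rule conn_closed)
          fix u v assume "u \<in> D" "adj G u v" "u \<in> C" "v \<in> C"
          then show "v \<in> D" using comps_closed[OF D, of u v] CV by (auto simp: adj_piece)
        qed (rule x)
      qed
      then show ?thesis using DC by blast
    qed
    then have "comps ?H Q \<subseteq> {C}" by blast
    then have "card (comps ?H Q) \<le> card {C}" by (intro card_mono) auto
    then show False using card2 eq by simp
  qed
  then have Q': "is_clique G Q'" "Q' \<inter> C \<noteq> {}" using clQ' is_clique_piece[OF G Q C] by blast+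
  \<comment> \<open>A vertex \<open>z0\<close> of \<open>Q\<close> outside \<open>Q'\<close> marks
    the only component of the piece minus \<open>Q'\<close> that can meet \<open>Q\<close>.\<close>
  have "\<not> Q \<subseteq> Q'" using is_clique_subset_eq[OF Q Q'(1)] ne by blast
  then obtain z0 where z0: "z0 \<in> Q" "z0 \<notin> Q'" by blast
  have Hsub: "D \<subseteq> C \<union> Q - Q'" if "D \<in> comps ?H Q'" for D using comps_subset[OF that] by simp
  have "\<exists>E\<in>comps G Q'. D \<subseteq> E" if D: "D \<in> comps ?H Q'" for D
  proof -
    obtain x where x: "x \<in> D" using comps_nonempty[OF D] by blast
    have DV: "D \<subseteq> verts G - Q'" using Hsub[OF D] CV QV by blast
    then obtain E where E: "E \<in> comps G Q'" "x \<in> E" using x comps_cover[of x G Q'] by blast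
    have "y \<in> E" if "y \<in> D" for y
    proof -
      have "D \<subseteq> C \<union> Q" using Hsub[OF D] by blast
      then have "conn G D x y" using comps_connected[OF D] x that conn_piece[of D C Q G]
        unfolding connected_on_def by simp
      then show ?thesis by (rule conn_closed) (use E comps_closed[OF E(1)] DV in blast)+
    qed
    then show ?thesis using E by blast
  qed
  then have "\<forall>D. \<exists>E. D \<in> comps ?H Q' \<longrightarrow> E \<in> comps G Q' \<and> D \<subseteq> E" by blast
  from choice[OF this] obtain h where
    h: "\<And>D. D \<in> comps ?H Q' \<Longrightarrow> h D \<in> comps G Q'" "\<And>D. D \<in> comps ?H Q' \<Longrightarrow> D \<subseteq> h D" by blast
  have same: "h D = D" if D: "D \<in> comps ?H Q'" "D \<inter> Q = {}" for D
  proof -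
    have DC: "D \<subseteq> C" using Hsub[OF D(1)] D(2) by blast
    have "D \<in> comps G Q'"
    proof (rule compsI)
      show "D \<subseteq> verts G - Q'" using Hsub[OF D(1)] CV QV by blast
      show "D \<noteq> {}" by (rule comps_nonempty[OF D(1)])
      show "connected_on G D"
        using comps_connected[OF D(1)] conn_piece[OF order_trans[OF DC Un_upper1]]
        unfolding connected_on_def by simp
      fix u w assume u: "u \<in> D" "adj G u w" "w \<in> verts G - Q'"
      then have "w \<in> C \<union> Q" using comps_closed[OF C, of u w] DC by blast
      then show "w \<in> D" using comps_closed[OF D(1), of u w] u DC by (auto simp: adj_piece)
    qed
    moreover obtain x where "x \<in> D" using comps_nonempty[OF D(1)] by blast
    ultimately show ?thesis using comps_eq[OF h(1)[OF D(1)], of D x] h(2)[OF D(1)] by blast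
  qed
  have rest: "z \<in> D" if D: "D \<in> comps ?H Q'" "D \<inter> Q \<noteq> {}" and z: "z \<in> Q" "z \<notin> Q'" for D z
  proof -
    obtain x where x: "x \<in> D" "x \<in> Q" using D(2) by blast
    show ?thesis
    proof (cases "x = z")
      case False
      then have "adj ?H x z" using is_cliqueD(3)[OF Q] x z by (simp add: adj_piece)
      then show ?thesis using comps_closed[OF D(1) x(1)] z by simp
    qed (use x in simp)
  qed
  have inj: "D = E" if D: "D \<in> comps ?H Q'" and E: "E \<in> comps ?H Q'" and eq: "h D = h E" for D E
  proof -
    have *: "D = E" if de: "D \<in> comps ?H Q'" "E \<in> comps ?H Q'" "h D = h E" "D \<inter> Q = {}" for D E
    proof -
      have "E \<subseteq> D" using h(2)[OF de(2)] same[OF de(1,4)] de(3) by simp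
      moreover obtain x where "x \<in> E" using comps_nonempty[OF de(2)] by blast
      ultimately show ?thesis using comps_eq[OF de(1,2)] by blast
    qed
    show ?thesis
    proof (cases "D \<inter> Q = {} \<or> E \<inter> Q = {}")
      case True
      then show ?thesis using *[OF D E eq] *[OF E D eq[symmetric]] by blast
    next
      case False
      then have "z0 \<in> D" "z0 \<in> E" using rest[OF D _ z0] rest[OF E _ z0] by simp_all
      then show ?thesis by (rule comps_eq[OF D E])
    qed
  qed
  have sub: "traces ?H Q' D \<subseteq> traces G Q' (h D)" if D: "D \<in> comps ?H Q'" for D
  proof
    fix Y assume "Y \<in> traces ?H Q' D"
    then obtain K where K: "Y = K \<inter> Q'" "is_clique ?H K" "K \<inter> D \<noteq> {}" "K \<inter> Q' \<noteq> {}"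
      unfolding traces_def by blast
    have "K = Q \<or> is_clique G K" using K(2) unfolding is_clique_piece[OF G Q C] by auto
    then have "is_clique G K" using Q by auto
    moreover have "K \<inter> h D \<noteq> {}" using K(3) h(2)[OF D] by blast
    ultimately show "Y \<in> traces G Q' (h D)" using K unfolding traces_def by blast
  qed
  have un: "\<Union> (traces ?H Q' D) = \<Union> (traces G Q' (h D))" if D: "D \<in> comps ?H Q'" for D
  proof
    show "\<Union> (traces ?H Q' D) \<subseteq> \<Union> (traces G Q' (h D))" using sub[OF D] by blast
    show "\<Union> (traces G Q' (h D)) \<subseteq> \<Union> (traces ?H Q' D)"
    proof
      fix v assume "v \<in> \<Union> (traces G Q' (h D))"
      moreover have "h D \<inter> Q' = {}" using comps_subset[OF h(1)[OF D]] by blast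
      ultimately obtain y where v: "v \<in> Q'" "y \<in> h D" "adj G v y" using mem_Union_traces[OF G] by blast
      have "\<exists>y'\<in>D. adj ?H v y'"
      proof (cases "y \<in> C \<union> Q")
        case True
        moreover have yQ': "y \<notin> Q'" using v(2) comps_subset[OF h(1)[OF D]] by blast
        ultimately obtain D' where D': "D' \<in> comps ?H Q'" "y \<in> D'" using comps_cover[of y ?H Q'] by auto
        have "h D' = h D" using comps_eq[OF h(1)[OF D'(1)] h(1)[OF D], of y] h(2)[OF D'(1)] D'(2) v(2) by blast
        then have "D' = D" using inj[OF D'(1) D] by blast
        then show ?thesis using D' v True Q'H by (auto simp: adj_piece)
      next
        case False
        \<comment> \<open>The neighbour \<open>y\<close> lies outside the piece, which forces
          \<open>v\<close> into \<open>Q\<close>; then \<open>z0\<close> can replace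
          \<open>y\<close> as a neighbour inside \<open>D\<close>.\<close>
        have "v \<notin> C"
        proof
          assume "v \<in> C"
          moreover have "y \<in> verts G" using adjD(2)[OF G v(3)] .
          ultimately show False using comps_closed[OF C _ v(3)] False by blast
        qed
        then have vQ: "v \<in> Q" using v(1) Q'H by blast
        have "D \<inter> Q \<noteq> {}" using same[OF D] v(2) False Hsub[OF D] by blast
        then have "z0 \<in> D" using rest[OF D _ z0] by blast
        moreover have "adj ?H v z0" using is_cliqueD(3)[OF Q vQ z0(1)] v(1) z0 vQ by (auto simp: adj_piece)
        ultimately show ?thesis by blast
      qed
      moreover have "D \<inter> Q' = {}" using Hsub[OF D] by blast
      ultimately show "v \<in> \<Union> (traces ?H Q' D)" using mem_Union_traces[OF H] v(1) by blast
    qed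
  qed
  have "clique_separator G Q'"
  proof -
    have "inj_on h (comps ?H Q')" using inj by (auto simp: inj_on_def)
    moreover have "h ` comps ?H Q' \<subseteq> comps G Q'" using h(1) by blast
    ultimately have "card (comps ?H Q') \<le> card (comps G Q')" 
      by (rule card_inj_on_le) (rule finite_comps[OF G])
    then show ?thesis using card2 Q'(1) by (simp add: clique_separator_iff)
  qed
  then obtain f :: "'a set \<Rightarrow> nat" where f: "fam_coloring (comps G Q') (traces G Q') f"
    using col by (auto simp: colorable_def)
  have dom: "fam_dom (traces ?H Q' D) (traces ?H Q' E)"
    if "fam_dom (traces G Q' (h D)) (traces G Q' (h E))" "D \<in> comps ?H Q'" "E \<in> comps ?H Q'" for D E
    using that(1) sub[OF that(3)] unfolding fam_dom_def un[OF that(2)] un[OF that(3)] by blast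
  have "fam_coloring (comps ?H Q') (traces ?H Q') (f \<circ> h)"
    unfolding fam_coloring_def
  proof (intro conjI ballI impI allI)
    fix D E assume D: "D \<in> comps ?H Q'" and E: "E \<in> comps ?H Q'" "D \<noteq> E"
      and ap: "fam_antipodal (traces ?H Q' D) (traces ?H Q' E)"
    have "fam_antipodal (traces G Q' (h D)) (traces G Q' (h E))"
      using ap dom[OF _ D E(1)] dom[OF _ E(1) D] un[OF D] un[OF E(1)] unfolding fam_antipodal_def by auto
    moreover have "h D \<noteq> h E" using inj[OF D E(1)] E(2) by blast
    ultimately show "(f \<circ> h) D \<noteq> (f \<circ> h) E"
      using f h(1)[OF D] h(1)[OF E(1)] unfolding fam_coloring_def by auto
  next
    fix v
    have "(f \<circ> h) ` {D \<in> comps ?H Q'. v \<in> \<Union> (traces ?H Q' D)} \<subseteq> f ` {D \<in> comps G Q'. v \<in> \<Union> (traces G Q' D)}"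
    proof
      fix a assume "a \<in> (f \<circ> h) ` {D \<in> comps ?H Q'. v \<in> \<Union> (traces ?H Q' D)}"
      then obtain D where D: "D \<in> comps ?H Q'" "v \<in> \<Union> (traces ?H Q' D)" "a = f (h D)" by auto
      then have "v \<in> \<Union> (traces G Q' (h D))" using un[OF D(1)] by blast
      then show "a \<in> f ` {D \<in> comps G Q'. v \<in> \<Union> (traces G Q' D)}" using D(3) h(1)[OF D(1)] by blast
    qed
    then have "card ((f \<circ> h) ` {D \<in> comps ?H Q'. v \<in> \<Union> (traces ?H Q' D)}) \<le> card (f ` {D \<in> comps G Q'. v \<in> \<Union> (traces G Q' D)})"
      by (intro card_mono finite_imageI finite_subset[OF _ finite_comps[OF G, of Q']]) auto
    also have "\<dots> \<le> 2" using f by (simp only: fam_coloring_def)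
    finally show "card ((f \<circ> h) ` {D \<in> comps ?H Q'. v \<in> \<Union> (traces ?H Q' D)}) \<le> 2" .
  qed
  then show ?thesis unfolding colorable_def by blast
qed

section \<open>Clique trees, and graphs without clique separators\<close>

definition cliques_at :: "'a ugraph \<Rightarrow> 'a \<Rightarrow> 'a set set" where
  "cliques_at G v = {K. is_clique G K \<and> v \<in> K}"

text \<open>Connectedness of \<open>cliques_at G v\<close> is the usual condition on clique trees;
  degrees of at most two turn these subtrees into paths. In this form the path condition can be
  checked node by node when trees are glued.\<close>

definition clique_path_tree :: "'a ugraph \<Rightarrow> 'a set ugraph \<Rightarrow> bool" where
  "clique_path_tree G T \<longleftrightarrow> is_tree T \<and> verts T = {K. is_clique G K} \<and>
     (\<forall>v\<in>verts G. connected_on T (cliques_at G v) \<and>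
        (\<forall>K\<in>cliques_at G v. card {L \<in> cliques_at G v. adj T K L} \<le> 2))"

text \<open>Without a clique separator, fix a clique \<open>Q\<close> with \<open>G - Q\<close> nonempty, hence connected. A
  vertex of \<open>G - Q\<close> that sees all the neighbours \<open>B\<close> of \<open>G - Q\<close> in \<open>Q\<close> spans together with
  \<open>B\<close> a second clique, which by maximality of \<open>Q\<close> separates the rest of \<open>Q\<close> from
  everything else.\<close>

lemma no_separator_two_cliques:
  assumes G: "simple_graph G" "chordal G" and ne: "verts G \<noteq> {}"
    and no: "\<And>Q. \<not> clique_separator G Q"
  shows "\<exists>Q Q'. {K. is_clique G K} = {Q, Q'}"
proof -
  obtain Q where Q: "is_clique G Q" using clique_of_vertex[OF G(1)] ne by blast
  have QV: "Q \<subseteq> verts G" by (rule is_cliqueD(1)[OF Q])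
  show ?thesis
  proof (cases "verts G - Q = {}")
    case True
    have "K = Q" if "is_clique G K" for K
      using is_clique_subset_eq[OF that Q] is_cliqueD(1)[OF that] True by blast
    then have "{K. is_clique G K} = {Q, Q}" using Q by blast
    then show ?thesis by blast
  next
    case False
    have single: "C = D" if "C \<in> comps G K" "D \<in> comps G K" "is_clique G K" for C D K
    proof -
      have "\<not> card (comps G K) \<ge> 2" using no[of K] that by (simp add: clique_separator_iff)
      then have "card (comps G K) \<le> Suc 0" by simp
      then show ?thesis using that finite_comps[OF G(1)] by (metis card_le_Suc0_iff_eq)
    qed
    obtain C where C: "C \<in> comps G Q" using False comps_cover[of _ G Q] by blast
    have CV: "C = verts G - Q" using comps_cover[of _ G Q] single[OF C _ Q] comps_subset[OF C] by blast
    obtain x where x: "x \<in> C" "\<forall>w\<in>Q. (\<exists>y\<in>C. adj G w y) \<longrightarrow> adj G w x"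
      using chordal_dominating_vertex[OF G is_cliqueD(2)[OF Q] C] by blast
    define B where "B = {w \<in> Q. \<exists>y\<in>C. adj G w y}"
    have Bx: "adj G w x \<and> adj G x w" if "w \<in> B" for w
      using x(2) that adj_commute[of G w x] by (auto simp: B_def)
    have BQ: "B \<subseteq> Q" by (auto simp: B_def)
    have "pairwise_adj G (insert x B)"
      unfolding pairwise_adj_def
    proof (intro conjI ballI impI)
      show "insert x B \<subseteq> verts G" using BQ QV x(1) CV by blast
      fix u v assume "u \<in> insert x B" "v \<in> insert x B" "u \<noteq> v"
      then show "adj G u v" using Bx is_cliqueD(3)[OF Q, of u v] BQ by blast
    qed
    then obtain Q' where Q': "is_clique G Q'" "insert x B \<subseteq> Q'" using extend_to_clique[OF G(1)] by blast
    have "\<not> Q \<subseteq> B"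
    proof
      assume "Q \<subseteq> B"
      then have "x \<in> Q" using Bx x(1) CV by (intro is_clique_maximal[OF Q]) auto
      then show False using x(1) CV by blast
    qed
    then obtain s where s: "s \<in> Q" "s \<notin> B" by blast
    have "s \<notin> Q'"
    proof
      assume "s \<in> Q'"
      moreover have "s \<noteq> x" using s(1) x(1) CV by blast
      ultimately have "adj G s x" using is_cliqueD(3)[OF Q'(1), of s x] Q'(2) by blast
      then show False using s x(1) by (auto simp: B_def)
    qed
    have cover: "z \<in> Q \<union> Q'" if z: "z \<in> verts G" for z
    proof (rule ccontr)
      assume nz: "z \<notin> Q \<union> Q'"
      obtain E where E: "E \<in> comps G Q'" "s \<in> E" using comps_cover[of s G Q'] s(1) \<open>s \<notin> Q'\<close> QV by blast
      obtain F where F: "F \<in> comps G Q'" "z \<in> F" using comps_cover[of z G Q'] z nz by blast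
      have "conn G E s z" using comps_connected[OF E(1)] E(2) F single[OF E(1) F(1) Q'(1)] by (simp add: connected_on_def)
      \<comment> \<open>No edge avoiding \<open>Q'\<close> leaves \<open>Q - B\<close>: its vertices
        have no neighbours in \<open>C\<close>, and \<open>B\<close> is contained in
        \<open>Q'\<close>.\<close>
      then have "z \<in> Q - B"
      proof (rule conn_closed)
        fix u v assume u: "u \<in> Q - B" "adj G u v" "u \<in> E" "v \<in> E"
        then have "v \<notin> C" by (auto simp: B_def)
        moreover have "v \<notin> Q'" "v \<in> verts G" using u(4) comps_subset[OF E(1)] by blast+
        ultimately show "v \<in> Q - B" using CV Q'(2) by blast
      qed (use s in blast)
      then show False using nz by blast
    qed
    have "K = Q \<or> K = Q'" if K: "is_clique G K" for K
    proof (cases "K \<subseteq> Q")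
      case True
      then show ?thesis using is_clique_subset_eq[OF K Q] by blast
    next
      case False
      then obtain y where y: "y \<in> K" "y \<notin> Q" by blast
      have yC: "y \<in> C" using y is_cliqueD(1)[OF K] CV by blast
      have "u \<in> Q'" if u: "u \<in> K" for u
      proof (cases "u \<in> Q")
        case True
        then have "adj G u y" using is_cliqueD(3)[OF K u y(1)] y(2) by blast
        then have "u \<in> B" using True yC by (auto simp: B_def)
        then show ?thesis using Q'(2) by blast
      next
        case False
        then show ?thesis using cover[of u] is_cliqueD(1)[OF K] u by blast
      qed
      then show ?thesis using is_clique_subset_eq[OF K Q'(1)] by blast
    qed
    then have "{K. is_clique G K} = {Q, Q'}" using Q Q'(1) by blast
    then show ?thesis by blast
  qed
qed

text \<open>With at most two nodes the degree bound is automatic. \<open>Q = Q'\<close> covers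
  graphs with a single clique.\<close>

lemma clique_path_tree_two:
  assumes K: "{K. is_clique G K} = {Q, Q'}"
  shows "\<exists>T. clique_path_tree G T"
proof -
  define T where "T = \<lparr>verts = {Q, Q'}, edges = {{x, Q} | x. x \<in> {Q, Q'} - {Q}}\<rparr>"
  have T: "rtree T Q (\<lambda>_. Q) (\<lambda>x. if x = Q then 0 else 1)"
    unfolding rtree_def T_def by auto
  have con: "connected_on T S" if "S \<subseteq> {Q, Q'}" for S
    unfolding connected_on_def
  proof (intro ballI)
    fix x y assume xy: "x \<in> S" "y \<in> S"
    show "conn T S x y"
    proof (cases "x = y")
      case False
      have "x \<in> {Q, Q'}" "y \<in> {Q, Q'}" using xy that by blast+
      then have "adj T x y" using False unfolding rtree_adj[OF T] by (auto simp: T_def)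
      then show ?thesis using conn_adj[of T x y S] xy by simp
    qed simp
  qed
  have sub: "cliques_at G v \<subseteq> {Q, Q'}" for v unfolding K[symmetric] cliques_at_def by blast
  have "clique_path_tree G T"
    unfolding clique_path_tree_def
  proof (intro conjI ballI)
    show "is_tree T" by (rule rtree_is_tree[OF T])
    show "verts T = {K. is_clique G K}" using K by (simp add: T_def)
    show "connected_on T (cliques_at G v)" for v by (rule con[OF sub])
    show "card {L \<in> cliques_at G v. adj T K L} \<le> 2" for v K 
      by (rule card_le_2_of_subset_pair) (use sub in blast)
  qed
  then show ?thesis by blast
qed

text \<open>The cliques meeting \<open>C\<close> form a subtree with top \<open>r\<close> below the
  root \<open>Q\<close>. By the last two conditions, for \<open>v \<in> Q\<close> the nodes
  containing \<open>v\<close> descend from \<open>Q\<close> in a chain: closed under parents and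
  without branching below \<open>Q\<close>. In this shape the subtree can be detached from
  \<open>Q\<close> and hung elsewhere.\<close>

definition hanging_tree :: "'a set set \<Rightarrow> 'a set \<Rightarrow> 'a set ugraph \<Rightarrow>
    ('a set \<Rightarrow> 'a set) \<Rightarrow> ('a set \<Rightarrow> nat) \<Rightarrow> 'a set \<Rightarrow> bool" where
  "hanging_tree \<K> Q T p d r \<longleftrightarrow> rtree T Q p d \<and> verts T = insert Q \<K> \<and> r \<in> \<K> \<and> p r = Q \<and>
     (\<forall>K\<in>\<K>. K \<noteq> r \<longrightarrow> p K \<in> \<K>) \<and>
     (\<forall>v\<in>Q. \<forall>K\<in>\<K>. v \<in> K \<longrightarrow> v \<in> p K) \<and>
     (\<forall>v\<in>Q. \<forall>K\<in>\<K>. \<forall>L\<in>\<K>. v \<in> K \<longrightarrow> v \<in> L \<longrightarrow> p K = p L \<longrightarrow> p K \<noteq> Q \<longrightarrow> K = L)"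

text \<open>Since \<open>C\<close> is connected, the cliques meeting it form a subtree, and the
  parent of its top can only be \<open>Q\<close>. A node other than \<open>Q\<close> that contains
  \<open>v \<in> Q\<close> has a parent containing \<open>v\<close>, so the degree bound leaves room
  for one child.\<close>

lemma clique_path_tree_rooted:
  assumes G: "simple_graph G" and Q: "is_clique G Q" and C: "C \<in> comps G Q"
    and T: "clique_path_tree (piece G Q C) T"
  defines "\<K> \<equiv> {K. is_clique G K \<and> K \<inter> C \<noteq> {}}"
  shows "\<exists>p d r. hanging_tree \<K> Q T p d r"
proof -
  have CQ: "C \<inter> Q = {}" "C \<subseteq> verts G" using comps_subset[OF C] by auto
  have QK: "Q \<notin> \<K>" using CQ by (auto simp: \<K>_def)
  have vT: "verts T = insert Q \<K>"
    using T is_clique_piece[OF G Q C] by (auto simp: clique_path_tree_def \<K>_def)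
  have tree: "is_tree T" using T by (simp add: clique_path_tree_def)
  have fin: "finite (verts T)" using tree by (simp add: is_tree_def simple_graph_def)
  obtain p d where R: "rtree T Q p d" using is_tree_rtree[OF tree, of Q] vT by blast
  have at: "cliques_at (piece G Q C) v = {K \<in> insert Q \<K>. v \<in> K}" for v
    using is_clique_piece[OF G Q C] by (auto simp: cliques_at_def \<K>_def)
  have con: "connected_on T {K \<in> insert Q \<K>. v \<in> K}" if "v \<in> C \<union> Q" for v
    using T that unfolding clique_path_tree_def at by simp
  have deg: "card {L \<in> {K \<in> insert Q \<K>. v \<in> K}. adj T K L} \<le> 2" if "v \<in> C \<union> Q" "K \<in> insert Q \<K>" "v \<in> K" for v K
    using T that unfolding clique_path_tree_def at by simp
  have "connected_on T \<K>"
    unfolding connected_on_def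
  proof (intro ballI)
    fix K L assume K: "K \<in> \<K>" and L: "L \<in> \<K>"
    obtain u v where uv: "u \<in> K" "u \<in> C" "v \<in> L" "v \<in> C" using K L by (auto simp: \<K>_def)
    have same: "conn T \<K> K' L'" if "w \<in> C" "w \<in> K'" "w \<in> L'" "is_clique G K'" "is_clique G L'" for w K' L'
    proof -
      have "conn T {K \<in> insert Q \<K>. w \<in> K} K' L'"
      proof -
        have "K' \<in> {K \<in> insert Q \<K>. w \<in> K}" "L' \<in> {K \<in> insert Q \<K>. w \<in> K}"
          using that unfolding \<K>_def by blast+
        then show ?thesis using con[of w] that(1) unfolding connected_on_def by blast
      qed
      moreover have "{K \<in> insert Q \<K>. w \<in> K} \<subseteq> \<K>" using that(1) CQ by auto
      ultimately show ?thesis by (rule conn_mono)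
    qed
    have "conn G C u v" using comps_connected[OF C] uv by (simp add: connected_on_def)
    then have "\<forall>L. is_clique G L \<and> v \<in> L \<longrightarrow> conn T \<K> K L"
      unfolding conn_def[of G]
    proof (induction rule: rtranclp_induct)
      case base
      then show ?case using same[OF uv(2,1)] K by (auto simp: \<K>_def)
    next
      case (step y z)
      then have yz: "y \<in> C" "z \<in> C" "adj G y z" by (auto simp: adj_induced)
      obtain M where M: "is_clique G M" "y \<in> M" "z \<in> M" using clique_of_edge[OF G yz(3)] by blast
      have "conn T \<K> K M" using step(3) M by blast
      then show ?case using same[OF yz(2) M(3) _ M(1)] conn_trans[of T \<K> K M] by blast
    qed
    then show "conn T \<K> K L" using L uv by (auto simp: \<K>_def)
  qed
  moreover have "\<K> \<noteq> {}"
  proof -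
    obtain x where "x \<in> C" using comps_nonempty[OF C] by blast
    then show ?thesis using clique_of_vertex[OF G, of x] CQ unfolding \<K>_def by blast
  qed
  ultimately obtain r where r: "r \<in> \<K>" "\<forall>K\<in>\<K>. K \<noteq> r \<longrightarrow> K \<noteq> Q \<and> p K \<in> \<K>" "r \<noteq> Q \<longrightarrow> p r \<notin> \<K>"
    using connected_top[OF R, of \<K>] vT by blast
  have pr: "p r = Q" using r QK rtreeD(3)[OF R, of r] vT by auto
  have cl: "v \<in> p K" if v: "v \<in> Q" "v \<in> K" "K \<in> \<K>" for v K
  proof -
    let ?S = "{K \<in> insert Q \<K>. v \<in> K}"
    obtain t where t: "t \<in> ?S" "\<forall>x\<in>?S. x \<noteq> t \<longrightarrow> x \<noteq> Q \<and> p x \<in> ?S"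
      using connected_top[OF R, of ?S] con[of v] v vT by blast
    have "Q \<in> ?S" using v(1) by simp
    then have "t = Q" using t(2)[rule_format, of Q] by blast
    moreover have "K \<in> ?S" "K \<noteq> Q" using v QK by auto
    ultimately have "p K \<in> ?S" using t(2)[rule_format, of K] by blast
    then show ?thesis by simp
  qed
  have one: "K = L" if v: "v \<in> Q" "K \<in> \<K>" "L \<in> \<K>" "v \<in> K" "v \<in> L" and e: "p K = p L" "p K \<noteq> Q" for v K L
  proof (rule ccontr)
    assume KL: "K \<noteq> L"
    define M where "M = p K"
    have M: "M \<in> \<K>" "v \<in> M" using r(2) v(2) pr e(2) cl[OF v(1,4,2)] unfolding M_def by metis+
    have MQ: "M \<noteq> Q" "K \<noteq> Q" "L \<noteq> Q" using e(2) v QK by (auto simp: M_def)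
    have pM: "p M \<in> insert Q \<K>" "v \<in> p M" using rtreeD(3)[OF R, of M] M MQ vT cl[OF v(1) M(2,1)] by auto
    have "d (p M) < d M" "d M < d K" "d M < d L"
      using rtreeD(4)[OF R, of M] rtreeD(4)[OF R, of K] rtreeD(4)[OF R, of L] M v MQ vT e by (auto simp: M_def)
    then have ne: "p M \<noteq> K" "p M \<noteq> L" by auto
    have "{p M, K, L} \<subseteq> {L \<in> {K \<in> insert Q \<K>. v \<in> K}. adj T M L}"
      using pM v M MQ vT e unfolding rtree_adj[OF R] by (auto simp: M_def)
    then have "card {p M, K, L} \<le> card {L \<in> {K \<in> insert Q \<K>. v \<in> K}. adj T M L}"
      by (rule card_mono[rotated]) (use fin vT in simp)
    also have "\<dots> \<le> 2" by (rule deg) (use v M in auto)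
    finally show False using ne KL by simp
  qed
  show ?thesis
    unfolding hanging_tree_def
  proof (intro exI[of _ p] exI[of _ d] exI[of _ r] conjI R vT r(1) pr ballI impI)
    show "p K \<in> \<K>" if "K \<in> \<K>" "K \<noteq> r" for K using r(2) that by simp
    show "v \<in> p K" if "v \<in> Q" "K \<in> \<K>" "v \<in> K" for v K by (rule cl[OF that(1,3,2)])
    show "K = L" if "v \<in> Q" "K \<in> \<K>" "L \<in> \<K>" "v \<in> K" "v \<in> L" "p K = p L" "p K \<noteq> Q" for v K L
      by (rule one[OF that])
  qed
qed

section \<open>Gluing clique trees along a valid colouring\<close>

lemma fam_dom_trans: "fam_dom A B \<Longrightarrow> fam_dom B C \<Longrightarrow> fam_dom A C"
proof -
  assume AB: "fam_dom A B" and BC: "fam_dom B C"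
  have sub: "\<Union> X \<subseteq> \<Union> Y" if "fam_dom X Y" for X Y :: "'a set set"
  proof -
    have "\<Union> X \<inter> \<Union> Y \<noteq> {}" using that by (simp add: fam_dom_def)
    then obtain Z where Z: "Z \<in> Y" "\<Union> X \<inter> Z \<noteq> {}" by blast
    have "\<Union> X \<subseteq> Z \<or> \<Union> X \<inter> Z = {}" using that Z(1) unfolding fam_dom_def by blast
    then show ?thesis using Z by blast
  qed
  have "\<Union> A \<subseteq> \<Union> B" "\<Union> B \<subseteq> \<Union> C" using sub AB BC by blast+
  moreover have "\<Union> A \<noteq> {}" using AB unfolding fam_dom_def by blast
  moreover have "\<Union> A \<subseteq> Z \<or> \<Union> A \<inter> Z = {}" if "Z \<in> C" for Z
  proof -
    have "\<Union> B \<subseteq> Z \<or> \<Union> B \<inter> Z = {}" using BC that unfolding fam_dom_def by simp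
    then show ?thesis using \<open>\<Union> A \<subseteq> \<Union> B\<close> by blast
  qed
  ultimately show ?thesis unfolding fam_dom_def by blast
qed

text \<open>The number of elements above \<open>i\<close> grows strictly on going strictly down; the
  injection \<open>e\<close>, with values below \<open>card I\<close>, breaks ties as a last digit
  in base \<open>card I\<close>. The key counts \<open>i\<close> itself explicitly because
  \<open>le\<close> may fail to be reflexive.\<close>

lemma preorder_numbering:
  fixes le :: "'i \<Rightarrow> 'i \<Rightarrow> bool"
  assumes fin: "finite I" and trans: "\<And>i j k. le i j \<Longrightarrow> le j k \<Longrightarrow> le i k"
  shows "\<exists>num :: 'i \<Rightarrow> nat. inj_on num I \<and> (\<forall>i\<in>I. \<forall>j\<in>I. le i j \<and> \<not> le j i \<longrightarrow> num j < num i)"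
proof -
  obtain e :: "'i \<Rightarrow> nat" where e: "inj_on e I" "e ` I = {..<card I}"
    using ex_bij_betw_finite_nat[OF fin] unfolding bij_betw_def by (metis atLeast0LessThan)
  define key where "key i = card {k \<in> I. i = k \<or> le i k}" for i
  define num where "num i = key i * card I + e i" for i
  have eI: "e i < card I" if "i \<in> I" for i using e(2) that by auto
  have "inj_on num I"
  proof (rule inj_onI)
    fix i j assume ij: "i \<in> I" "j \<in> I" "num i = num j"
    have "e k = num k mod card I" if "k \<in> I" for k using eI[OF that] by (simp add: num_def)
    then have "e i = e j" using ij by metis
    then show "i = j" using e(1) ij by (auto simp: inj_on_def)
  qed
  moreover have "num j < num i" if ij: "i \<in> I" "j \<in> I" "le i j" "\<not> le j i" for i j
  proof -
    have "{k \<in> I. j = k \<or> le j k} \<subset> {k \<in> I. i = k \<or> le i k}"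
    proof (rule psubsetI)
      show "{k \<in> I. j = k \<or> le j k} \<subseteq> {k \<in> I. i = k \<or> le i k}"
        using ij(3) trans[OF ij(3)] by auto
      have "i \<notin> {k \<in> I. j = k \<or> le j k}" using ij(3,4) by auto
      moreover have "i \<in> {k \<in> I. i = k \<or> le i k}" using ij(1) by simp
      ultimately show "{k \<in> I. j = k \<or> le j k} \<noteq> {k \<in> I. i = k \<or> le i k}" by metis
    qed
    then have "key j < key i" unfolding key_def using fin by (intro psubset_card_mono) auto
    then have "Suc (key j) * card I \<le> key i * card I" by (intro mult_right_mono) auto
    then show ?thesis using eI[OF ij(2)] by (simp add: num_def)
  qed
  ultimately show ?thesis by blast
qed

lemma connected_onI_root:
  assumes R: "rtree T r p d" and S: "S \<subseteq> verts T" "r \<in> S" "\<And>x. x \<in> S \<Longrightarrow> x \<noteq> r \<Longrightarrow> p x \<in> S"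
  shows "connected_on T S"
proof -
  have "conn T S x r" if "x \<in> S" for x
    using that
  proof (induction "d x" arbitrary: x rule: less_induct)
    case less
    show ?case
    proof (cases "x = r")
      case False
      have "x \<in> verts T" using less S by blast
      then have "adj T x (p x)" "d (p x) < d x" using False rtree_adj[OF R] rtreeD(4)[OF R] by blast+
      then show ?thesis using less S(3)[OF less(2) False] conn_adj[of T x "p x" S] conn_trans by metis
    qed simp
  qed
  then show ?thesis unfolding connected_on_def using conn_sym conn_trans by metis
qed

lemma connected_on_cong:
  assumes "\<And>x y. x \<in> S \<Longrightarrow> y \<in> S \<Longrightarrow> adj T x y \<longleftrightarrow> adj T' x y"
  shows "connected_on T S \<longleftrightarrow> connected_on T' S"
proof -
  have "adj (induced T S) = adj (induced T' S)" using assms by (intro ext) (auto simp: adj_induced)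
  then show ?thesis by (simp add: connected_on_def conn_def)
qed

text \<open>Within a colour class, components that share a vertex of \<open>Q\<close> are comparable. The tree of
  a component \<open>C\<close> is hung below the deepest clique that contains the neighbourhood of \<open>C\<close> in \<open>Q\<close>,
  taken in the tree of the next component of its class above \<open>C\<close>; if there is none it is hung
  below \<open>Q\<close> itself.\<close>

theorem glue_clique_path_trees:
  assumes G: "simple_graph G" and Q: "is_clique G Q" and col: "colorable G Q"
    and pieces: "\<And>C. C \<in> comps G Q \<Longrightarrow> \<exists>T. clique_path_tree (piece G Q C) T"
  shows "\<exists>T. clique_path_tree G T"
proof -
  define cl where "cl C = {K. is_clique G K \<and> K \<inter> C \<noteq> {}}" for C
  have "\<forall>C. \<exists>T. C \<in> comps G Q \<longrightarrow> clique_path_tree (piece G Q C) T" using pieces by blast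
  from choice[OF this] obtain T where T: "\<And>C. C \<in> comps G Q \<Longrightarrow> clique_path_tree (piece G Q C) (T C)" by blast
  have "\<exists>p d r. hanging_tree (cl C) Q (T C) p d r" if "C \<in> comps G Q" for C
    using clique_path_tree_rooted[OF G Q that T[OF that], folded cl_def] .
  then obtain p d r where hang: "\<And>C. C \<in> comps G Q \<Longrightarrow> hanging_tree (cl C) Q (T C) (p C) (d C) (r C)"
    by metis
  have tree: "rtree (T C) Q (p C) (d C)" and vT: "verts (T C) = insert Q (cl C)"
    and r: "r C \<in> cl C" "p C (r C) = Q"
    and p_cl: "K \<in> cl C \<Longrightarrow> K \<noteq> r C \<Longrightarrow> p C K \<in> cl C"
    and p_mem: "v \<in> Q \<Longrightarrow> K \<in> cl C \<Longrightarrow> v \<in> K \<Longrightarrow> v \<in> p C K"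
    and p_inj: "v \<in> Q \<Longrightarrow> K \<in> cl C \<Longrightarrow> L \<in> cl C \<Longrightarrow> v \<in> K \<Longrightarrow> v \<in> L \<Longrightarrow>
        p C K = p C L \<Longrightarrow> p C K \<noteq> Q \<Longrightarrow> K = L"
    if C: "C \<in> comps G Q" for C K L v
  proof -
    note hang[OF C, unfolded hanging_tree_def]
    then show "rtree (T C) Q (p C) (d C)" "verts (T C) = insert Q (cl C)" "r C \<in> cl C" "p C (r C) = Q"
      "K \<in> cl C \<Longrightarrow> K \<noteq> r C \<Longrightarrow> p C K \<in> cl C" "v \<in> Q \<Longrightarrow> K \<in> cl C \<Longrightarrow> v \<in> K \<Longrightarrow> v \<in> p C K"
      "v \<in> Q \<Longrightarrow> K \<in> cl C \<Longrightarrow> L \<in> cl C \<Longrightarrow> v \<in> K \<Longrightarrow> v \<in> L \<Longrightarrow>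
        p C K = p C L \<Longrightarrow> p C K \<noteq> Q \<Longrightarrow> K = L"
      by simp_all
  qed
  obtain f :: "'a set \<Rightarrow> nat" where f: "fam_coloring (comps G Q) (traces G Q) f"
    using col by (auto simp: colorable_def)
  let ?R = "traces G Q"
  define W where "W C = \<Union> (?R C)" for C
  have finc: "finite (comps G Q)" by (rule finite_comps[OF G])
  \<comment> \<open>Dominating components get the smaller numbers; injectivity also orders
    components that dominate each other.\<close>
  obtain num :: "'a set \<Rightarrow> nat" where num: "inj_on num (comps G Q)"
    "\<And>C D. C \<in> comps G Q \<Longrightarrow> D \<in> comps G Q \<Longrightarrow> fam_dom (?R C) (?R D) \<Longrightarrow> \<not> fam_dom (?R D) (?R C) \<Longrightarrow> num D < num C"
    using preorder_numbering[OF finc, of "\<lambda>C D. fam_dom (?R C) (?R D)"] fam_dom_trans by blast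
  define above where "above C = {D \<in> comps G Q. f D = f C \<and> fam_dom (?R C) (?R D) \<and> num D < num C}" for C
  have "finite (above C)" for C using finc by (simp add: above_def)
  then have "\<exists>D\<in>above C. \<forall>E\<in>above C. num E \<le> num D" if "above C \<noteq> {}" for C
    using that by (rule ex_greatest_on_finite)
  then obtain nxt where nxt: "\<And>C. above C \<noteq> {} \<Longrightarrow> nxt C \<in> above C"
    "\<And>C E. above C \<noteq> {} \<Longrightarrow> E \<in> above C \<Longrightarrow> num E \<le> num (nxt C)"
    by metis
  \<comment> \<open>Equal colours and a common vertex exclude antipodality, so one component
    dominates the other; \<open>num\<close> decides if both do.\<close>
  have comparable: "D \<in> above C \<or> C \<in> above D"
    if CD: "C \<in> comps G Q" "D \<in> comps G Q" "C \<noteq> D" "f C = f D" "v \<in> W C" "v \<in> W D" for C D v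
  proof -
    have "\<not> fam_antipodal (?R C) (?R D)" using f CD unfolding fam_coloring_def by blast
    moreover have "W C \<inter> W D \<noteq> {}" using CD by blast
    ultimately have c: "fam_dom (?R C) (?R D) \<or> fam_dom (?R D) (?R C)" by (auto simp: fam_antipodal_def W_def)
    have "num C \<noteq> num D" using num(1) CD by (auto simp: inj_on_def)
    then consider "num D < num C" | "num C < num D" by linarith
    then show ?thesis
    proof cases
      case 1
      then have "fam_dom (?R C) (?R D)" using c num(2)[OF CD(2,1)] by fastforce
      then show ?thesis using 1 CD by (simp add: above_def)
    next
      case 2
      then have "fam_dom (?R D) (?R C)" using c num(2)[OF CD(1,2)] by fastforce
      then show ?thesis using 2 CD by (simp add: above_def)
    qed
  qed
  have fincl: "finite (cl C)" for C
    by (rule finite_subset[OF _ finite_cliques[OF G]]) (auto simp: cl_def)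
  \<comment> \<open>Dominance is all or nothing: a clique of \<open>D\<close> that contains one
    vertex of \<open>W C\<close> contains all of them.\<close>
  have W_below: "W C \<subseteq> L" if "fam_dom (?R C) (?R D)" "L \<in> cl D" "v \<in> L" "v \<in> W C" for C D L v
  proof -
    have "v \<in> Q" using that(4) by (auto simp: W_def traces_def)
    then have "L \<inter> Q \<in> ?R D" using that unfolding traces_def cl_def by blast
    moreover have "\<forall>Y\<in>?R D. W C \<subseteq> Y \<or> W C \<inter> Y = {}" using that(1) unfolding fam_dom_def W_def by (rule conjunct2)
    ultimately have "W C \<subseteq> L \<inter> Q \<or> W C \<inter> (L \<inter> Q) = {}" by (rule bspec[rotated])
    then show ?thesis using that(3,4) \<open>v \<in> Q\<close> by auto
  qed
  have ex_bot: "\<exists>K. K \<in> cl D \<and> W C \<subseteq> K \<and> (\<forall>L\<in>cl D. W C \<subseteq> L \<longrightarrow> d D L \<le> d D K)"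
    if dom: "fam_dom (?R C) (?R D)" for C D
  proof -
    have "W C \<inter> W D \<noteq> {}" using dom by (simp add: fam_dom_def W_def)
    then obtain v where v: "v \<in> W C" "v \<in> W D" by blast
    then obtain K where K: "K \<in> cl D" "v \<in> K" unfolding W_def traces_def cl_def by auto
    then have "{K \<in> cl D. W C \<subseteq> K} \<noteq> {}" using W_below[OF dom K v(1)] by auto
    then obtain M where "M \<in> {K \<in> cl D. W C \<subseteq> K}" "\<forall>L\<in>{K \<in> cl D. W C \<subseteq> K}. d D L \<le> d D M"
      using ex_greatest_on_finite[of "{K \<in> cl D. W C \<subseteq> K}" "d D"] fincl by auto
    then show ?thesis by (intro exI[of _ M]) simp
  qed
  define bot where "bot D C = (SOME K. K \<in> cl D \<and> W C \<subseteq> K \<and> (\<forall>L\<in>cl D. W C \<subseteq> L \<longrightarrow> d D L \<le> d D K))" for D C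
  have bot: "bot D C \<in> cl D" "W C \<subseteq> bot D C" "\<And>L. L \<in> cl D \<Longrightarrow> W C \<subseteq> L \<Longrightarrow> d D L \<le> d D (bot D C)"
    if dom: "fam_dom (?R C) (?R D)" for C D
    using someI_ex[OF ex_bot[OF dom], folded bot_def] by simp_all
  define comp where "comp K = (SOME C. C \<in> comps G Q \<and> K \<in> cl C)" for K
  have cl_disj: "C = D" if cd: "C \<in> comps G Q" "D \<in> comps G Q" "K \<in> cl C" "K \<in> cl D" for C D K
  proof -
    obtain x y where xy: "x \<in> K" "x \<in> C" "y \<in> K" "y \<in> D" using cd by (auto simp: cl_def)
    have "K \<subseteq> C \<union> Q" using clique_meeting_component[of G K C Q x] cd xy by (auto simp: cl_def)
    then have "y \<in> C" using xy comps_subset[OF cd(2)] by blast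
    then show ?thesis using comps_eq[OF cd(1,2)] xy by blast
  qed
  have comp: "comp K = C" if "C \<in> comps G Q" "K \<in> cl C" for C K
    unfolding comp_def by (rule some_equality) (use that cl_disj in blast)+
  have QV: "Q \<subseteq> verts G" by (rule is_cliqueD(1)[OF Q])
  have cover: "\<exists>C\<in>comps G Q. K \<in> cl C" if cd: "is_clique G K" "K \<noteq> Q" for K
  proof -
    have "\<not> K \<subseteq> Q" using is_clique_subset_eq[OF cd(1) Q] cd(2) by blast
    then obtain x where x: "x \<in> K" "x \<notin> Q" by blast
    then obtain C where "C \<in> comps G Q" "x \<in> C" using comps_cover[of x G Q] is_cliqueD(1)[OF cd(1)] by blast
    then show ?thesis using x cd by (auto simp: cl_def)
  qed
  have Qcl: "Q \<notin> cl C" if "C \<in> comps G Q" for C using comps_subset[OF that] by (auto simp: cl_def)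
  define att where "att C = (if above C = {} then Q else bot (nxt C) C)" for C
  define pp where "pp K = (if K = r (comp K) then att (comp K) else p (comp K) K)" for K
  have pp_r: "pp (r C) = att C" if "C \<in> comps G Q" for C
    using comp[OF that r(1)[OF that]] by (simp add: pp_def)
  have pp_in: "pp K = p C K" if "C \<in> comps G Q" "K \<in> cl C" "K \<noteq> r C" for C K
    using comp[OF that(1,2)] that(3) by (simp add: pp_def)
  have nxtC: "nxt C \<in> comps G Q" "f (nxt C) = f C" "fam_dom (?R C) (?R (nxt C))" "num (nxt C) < num C"
    if "above C \<noteq> {}" for C using nxt(1)[OF that] by (auto simp: above_def)
  have att: "att C \<in> cl (nxt C)" "W C \<subseteq> att C" if "above C \<noteq> {}" for C
    using bot[OF nxtC(3)[OF that]] that by (simp_all add: att_def)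
  define M where "M = Suc (Max ((\<lambda>(C, K). d C K) ` (comps G Q \<times> {K. is_clique G K})))"
  have dM: "d C K < M" if "C \<in> comps G Q" "is_clique G K" for C K
  proof -
    have "d C K \<le> Max ((\<lambda>(C, K). d C K) ` (comps G Q \<times> {K. is_clique G K}))"
      by (rule Max_ge) (use that finc finite_cliques[OF G] in auto)
    then show ?thesis by (simp add: M_def)
  qed
  \<comment> \<open>A lexicographic rank: \<open>M\<close> exceeds every depth, so the number of the
    component outweighs the depth inside its tree. The root \<open>Q\<close> gets
    \<open>0\<close>.\<close>
  define dd where "dd K = (if K = Q then 0 else num (comp K) * M + d (comp K) K)" for K
  have dd: "dd K = num C * M + d C K" if "C \<in> comps G Q" "K \<in> cl C" for C K
    using comp[OF that] Qcl[OF that(1)] that(2) by (auto simp: dd_def)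
  define TT where "TT = \<lparr>verts = {K. is_clique G K}, edges = {{K, pp K} | K. K \<in> {K. is_clique G K} - {Q}}\<rparr>"
  have clK: "is_clique G K" if "K \<in> cl C" for K C using that by (simp add: cl_def)
  have step: "is_clique G (pp K) \<and> dd (pp K) < dd K" if K: "is_clique G K" "K \<noteq> Q" for K
  proof -
    obtain C where C: "C \<in> comps G Q" "K \<in> cl C" using cover[OF K] by blast
    have dK: "d C (p C K) < d C K" using rtreeD(4)[OF tree[OF C(1)], of K] vT[OF C(1)] C(2) K(2) by simp
    show ?thesis
    proof (cases "K = r C")
      case False
      then show ?thesis using pp_in[OF C False] p_cl[OF C False] dd[OF C(1)] C(2) dK clK by simp
    next
      case True
      show ?thesis
      proof (cases "above C = {}")
        case e: True
        then have "pp K = Q" using True pp_r[OF C(1)] by (simp add: att_def)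
        then show ?thesis using Q dd[OF C] dK by (simp add: dd_def)
      next
        case False
        have a: "pp K = att C" using True pp_r[OF C(1)] by simp
        have b: "is_clique G (att C)" using att(1)[OF False] by (rule clK)
        have "dd (att C) = num (nxt C) * M + d (nxt C) (att C)" by (rule dd[OF nxtC(1)[OF False] att(1)[OF False]])
        also have "\<dots> < num (nxt C) * M + M" using dM[OF nxtC(1)[OF False] b] by simp
        also have "\<dots> = Suc (num (nxt C)) * M" by simp
        also have "\<dots> \<le> num C * M" using nxtC(4)[OF False] by (intro mult_right_mono) auto
        also have "\<dots> \<le> dd K" using dd[OF C] by simp
        finally show ?thesis using a b by simp
      qed
    qed
  qed
  have R: "rtree TT Q pp dd"
    unfolding rtree_def using finite_cliques[OF G] Q step by (auto simp: TT_def)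
  have vTT: "verts TT = {K. is_clique G K}" by (simp add: TT_def)
  have W_mem: "v \<in> W C" if "C \<in> comps G Q" "K \<in> cl C" "v \<in> K" "v \<in> Q" for C K v
    using that unfolding W_def traces_def cl_def by blast
  have main: "connected_on TT (cliques_at G v) \<and> (\<forall>K\<in>cliques_at G v. card {L \<in> cliques_at G v. adj TT K L} \<le> 2)"
    if v: "v \<in> verts G" for v
  proof (cases "v \<in> Q")
    case vQ: True
    let ?S = "cliques_at G v"
    have Ssub: "?S \<subseteq> verts TT" by (auto simp: cliques_at_def vTT)
    have closed: "pp K \<in> ?S" if K: "K \<in> ?S" "K \<noteq> Q" for K
    proof -
      have K': "is_clique G K" "v \<in> K" using K by (auto simp: cliques_at_def)
      obtain C where C: "C \<in> comps G Q" "K \<in> cl C" using cover[OF K'(1) K(2)] by blast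
      have "v \<in> pp K"
      proof (cases "K = r C")
        case False
        then show ?thesis using pp_in[OF C False] p_mem[OF C(1) vQ C(2) K'(2)] by simp
      next
        case True
        show ?thesis
        proof (cases "above C = {}")
          case e: True
          then show ?thesis using True pp_r[OF C(1)] vQ by (simp add: att_def)
        next
          case False
          then show ?thesis using True pp_r[OF C(1)] att(2)[OF False] W_mem[OF C K'(2) vQ] by auto
        qed
      qed
      then show ?thesis using step[OF K'(1) K(2)] by (simp add: cliques_at_def)
    qed
    have "connected_on TT ?S"
      by (rule connected_onI_root[OF R Ssub]) (use Q vQ closed in \<open>auto simp: cliques_at_def\<close>)
    moreover have "card {L \<in> ?S. adj TT K L} \<le> 2" if KS: "K \<in> ?S" for K
    proof (cases "K = Q")
      case True
      \<comment> \<open>The children of \<open>Q\<close> containing \<open>v\<close> are tops of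
        components with nothing above them. Two of the same colour would be comparable, so there are
        no more of them than colours at \<open>v\<close>.\<close>
      have sub: "{L \<in> ?S. adj TT K L} \<subseteq> r ` {C \<in> comps G Q. above C = {} \<and> v \<in> W C}"
      proof
        fix L assume "L \<in> {L \<in> ?S. adj TT K L}"
        then have L: "is_clique G L" "v \<in> L" "L \<noteq> Q" "pp L = Q"
          using True unfolding rtree_adj[OF R] by (auto simp: cliques_at_def vTT)
        obtain C where C: "C \<in> comps G Q" "L \<in> cl C" using cover[OF L(1,3)] by blast
        have "L = r C" using pp_in[OF C] p_cl[OF C] L(4) Qcl[OF C(1)] by metis
        moreover have "above C = {}"
        proof (rule ccontr)
          assume a: "above C \<noteq> {}"
          have "att C = Q" using pp_r[OF C(1)] L(4) \<open>L = r C\<close> by simp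
          then show False using att(1)[OF a] Qcl[OF nxtC(1)[OF a]] by simp
        qed
        ultimately show "L \<in> r ` {C \<in> comps G Q. above C = {} \<and> v \<in> W C}"
          using C W_mem[OF C L(2) vQ] by blast
      qed
      have "finite {C \<in> comps G Q. above C = {} \<and> v \<in> W C}" using finc by simp
      then have "card {L \<in> ?S. adj TT K L} \<le> card {C \<in> comps G Q. above C = {} \<and> v \<in> W C}"
        using sub by (meson card_image_le card_mono finite_imageI le_trans)
      also have "\<dots> \<le> card (f ` {C \<in> comps G Q. v \<in> W C})"
      proof (rule card_inj_on_le[of f])
        show "inj_on f {C \<in> comps G Q. above C = {} \<and> v \<in> W C}"
        proof (rule inj_onI)
          fix C D assume "C \<in> {C \<in> comps G Q. above C = {} \<and> v \<in> W C}" "D \<in> {C \<in> comps G Q. above C = {} \<and> v \<in> W C}" "f C = f D"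
          then show "C = D" using comparable[of C D v] by blast
        qed
        show "f ` {C \<in> comps G Q. above C = {} \<and> v \<in> W C} \<subseteq> f ` {C \<in> comps G Q. v \<in> W C}" by blast
        show "finite (f ` {C \<in> comps G Q. v \<in> W C})" using finc by simp
      qed
      also have "\<dots> \<le> 2" using f unfolding fam_coloring_def W_def by blast
      finally show ?thesis .
    next
      case False
      have K: "is_clique G K" "v \<in> K" using KS by (auto simp: cliques_at_def)
      obtain C where C: "C \<in> comps G Q" "K \<in> cl C" using cover[OF K(1) False] by blast
      have child: "\<exists>D. D \<in> comps G Q \<and> L \<in> cl D \<and> (L \<noteq> r D \<and> D = C \<and> p C L = K \<or>
            L = r D \<and> above D \<noteq> {} \<and> nxt D = C \<and> K = bot C D)"
        if L: "L \<in> ?S" "L \<noteq> Q" "pp L = K" for L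
      proof -
        have "is_clique G L" using L by (simp add: cliques_at_def)
        then obtain D where D: "D \<in> comps G Q" "L \<in> cl D" using cover L(2) by blast
        show ?thesis
        proof (cases "L = r D")
          case nr: False
          have "K \<in> cl D" using pp_in[OF D nr] p_cl[OF D nr] L(3) by simp
          then have "D = C" using cl_disj[OF D(1) C(1)] C(2) by blast
          then show ?thesis using D nr pp_in[OF D nr] L(3) by blast
        next
          case True
          have K': "K = att D" using pp_r[OF D(1)] True L(3) by simp
          then have a: "above D \<noteq> {}" using False by (auto simp: att_def)
          have "nxt D = C" using cl_disj[OF nxtC(1)[OF a] C(1)] att(1)[OF a] K' C(2) by blast
          then show ?thesis using D True a K' by (auto simp: att_def)
        qed
      qed
      \<comment> \<open>A child \<open>L\<close> of \<open>K = bot C D\<close> in the tree of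
        \<open>C\<close> that contains \<open>v\<close> would contain all of \<open>W D\<close> by
        dominance, although \<open>K\<close> is a deepest such clique.\<close>
      have mixed: False
        if L: "L \<in> ?S" "L \<in> cl C" "p C L = K" and D: "D \<in> comps G Q" "v \<in> W D" "above D \<noteq> {}" "nxt D = C" "K = bot C D" for L D
      proof -
        have dom: "fam_dom (?R D) (?R C)" using nxtC(3)[OF D(3)] D(4) by simp
        have "v \<in> L" using L(1) by (simp add: cliques_at_def)
        then have "W D \<subseteq> L" using W_below[OF dom L(2) _ D(2)] by blast
        then have "d C L \<le> d C K" using bot(3)[OF dom L(2)] D(5) by simp
        moreover have "d C K < d C L"
          using rtreeD(4)[OF tree[OF C(1)], of L] vT[OF C(1)] L(2,3) Qcl[OF C(1)] by auto
        ultimately show False by simp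
      qed
      \<comment> \<open>Otherwise \<open>C = nxt D\<close> would have at least the number of
        \<open>E\<close>, while \<open>C = nxt E\<close> has a smaller one.\<close>
      have roots: "\<not> E \<in> above D" if D: "D \<in> comps G Q" "above D \<noteq> {}" "nxt D = C"
        and E: "E \<in> comps G Q" "above E \<noteq> {}" "nxt E = C" for D E
      proof
        assume "E \<in> above D"
        then have "num E \<le> num C" using nxt(2)[OF D(2)] D(3) by simp
        moreover have "num C < num E" using nxtC(4)[OF E(2)] E(3) by simp
        ultimately show False by simp
      qed
      have uniq: "L = L'" if L: "L \<in> ?S" "L \<noteq> Q" "pp L = K" and L': "L' \<in> ?S" "L' \<noteq> Q" "pp L' = K" for L L'
      proof -
        obtain D where D: "D \<in> comps G Q" "L \<in> cl D" and D': "L \<noteq> r D \<and> D = C \<and> p C L = K \<or>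
            L = r D \<and> above D \<noteq> {} \<and> nxt D = C \<and> K = bot C D" using child[OF L] by blast
        obtain E where E: "E \<in> comps G Q" "L' \<in> cl E" and E': "L' \<noteq> r E \<and> E = C \<and> p C L' = K \<or>
            L' = r E \<and> above E \<noteq> {} \<and> nxt E = C \<and> K = bot C E" using child[OF L'] by blast
        have vL: "v \<in> L" "v \<in> L'" using L(1) L'(1) by (auto simp: cliques_at_def)
        have vW: "v \<in> W D" "v \<in> W E" using W_mem[OF D vL(1) vQ] W_mem[OF E vL(2) vQ] by auto
        from D' show ?thesis
        proof
          assume d: "L \<noteq> r D \<and> D = C \<and> p C L = K"
          from E' show ?thesis
          proof
            assume e: "L' \<noteq> r E \<and> E = C \<and> p C L' = K"
            show ?thesis by (rule p_inj[OF C(1) vQ _ _ vL]) (use d e D E False in auto)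
          next
            assume e: "L' = r E \<and> above E \<noteq> {} \<and> nxt E = C \<and> K = bot C E"
            then show ?thesis using mixed[of L E] L(1) d D(2) E(1) vW by blast
          qed
        next
          assume d: "L = r D \<and> above D \<noteq> {} \<and> nxt D = C \<and> K = bot C D"
          from E' show ?thesis
          proof
            assume e: "L' \<noteq> r E \<and> E = C \<and> p C L' = K"
            then show ?thesis using mixed[of L' D] L'(1) d E(2) D(1) vW by blast
          next
            assume e: "L' = r E \<and> above E \<noteq> {} \<and> nxt E = C \<and> K = bot C E"
            have "f D = f E" using nxtC(2)[of D] nxtC(2)[of E] d e by auto
            then have "D = E" using comparable[OF D(1) E(1) _ _ vW] roots[of D E] roots[of E D] D(1) E(1) d e by blast
            then show ?thesis using d e by simp
          qed
        qed
      qed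
      show ?thesis
      proof (cases "\<exists>L. L \<in> ?S \<and> L \<noteq> Q \<and> pp L = K")
        case True
        then obtain L where L: "L \<in> ?S" "L \<noteq> Q" "pp L = K" by blast
        have "{L \<in> ?S. adj TT K L} \<subseteq> {pp K, L}"
          unfolding rtree_adj[OF R] using uniq[OF _ _ _ L] by blast
        then show ?thesis by (rule card_le_2_of_subset_pair)
      next
        case no: False
        have "{L \<in> ?S. adj TT K L} \<subseteq> {pp K, pp K}"
          unfolding rtree_adj[OF R] using no by blast
        then show ?thesis by (rule card_le_2_of_subset_pair)
      qed
    qed
    ultimately show ?thesis by blast
  next
    case False
    then obtain C where C: "C \<in> comps G Q" "v \<in> C" using comps_cover[of v G Q] v by blast
    let ?S = "cliques_at G v"
    have Scl: "?S \<subseteq> cl C" using C(2) by (auto simp: cliques_at_def cl_def)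
    have S: "cliques_at (piece G Q C) v = ?S"
      using is_clique_piece[OF G Q C(1)] False C(2) by (auto simp: cliques_at_def)
    \<comment> \<open>Inside \<open>cl C\<close> the new parent map agrees with the old one except
      at the top, whose parent is outside \<open>cl C\<close> in both trees. So for
      \<open>v \<in> C\<close> nothing changes.\<close>
    have par: "L = pp K \<longleftrightarrow> L = p C K" if "K \<in> cl C" "L \<in> cl C" for K L
    proof (cases "K = r C")
      case True
      have "pp K \<notin> cl C"
      proof (cases "above C = {}")
        case e: True
        then show ?thesis using True pp_r[OF C(1)] Qcl[OF C(1)] by (simp add: att_def)
      next
        case a: False
        have "nxt C \<noteq> C" using nxtC(4)[OF a] by auto
        then show ?thesis using True pp_r[OF C(1)] att(1)[OF a] cl_disj[OF nxtC(1)[OF a] C(1)] by metis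
      qed
      moreover have "p C K \<notin> cl C" using True r(2)[OF C(1)] Qcl[OF C(1)] by simp
      ultimately show ?thesis using that(2) by blast
    next
      case f: False
      then show ?thesis using pp_in[OF C(1) that(1)] by simp
    qed
    have adj: "adj TT K L \<longleftrightarrow> adj (T C) K L" if "K \<in> ?S" "L \<in> ?S" for K L
    proof -
      have KL: "K \<in> cl C" "L \<in> cl C" using that Scl by blast+
      then show ?thesis using par[of K L] par[of L K] clK
        unfolding rtree_adj[OF R] rtree_adj[OF tree[OF C(1)]] vT[OF C(1)] vTT by auto
    qed
    have "v \<in> verts (piece G Q C)" using C(2) by simp
    then have "connected_on (T C) (cliques_at (piece G Q C) v) \<and>
        (\<forall>K\<in>cliques_at (piece G Q C) v. card {L \<in> cliques_at (piece G Q C) v. adj (T C) K L} \<le> 2)"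
      using T[OF C(1)] unfolding clique_path_tree_def by blast
    then have "connected_on (T C) ?S \<and> (\<forall>K\<in>?S. card {L \<in> ?S. adj (T C) K L} \<le> 2)" unfolding S .
    moreover have "connected_on TT ?S = connected_on (T C) ?S" by (rule connected_on_cong[OF adj])
    moreover have "{L \<in> ?S. adj TT K L} = {L \<in> ?S. adj (T C) K L}" if "K \<in> ?S" for K using adj that by blast
    ultimately show ?thesis by simp
  qed
  have "clique_path_tree G TT"
    unfolding clique_path_tree_def using rtree_is_tree[OF R] vTT main by blast
  then show ?thesis by blast
qed

text \<open>Induction on the number of vertices, over the pieces at a separator. A piece is smaller
  because another component is left out, and \<open>colorable_piece\<close> hands down the
  hypothesis on colourings.\<close>

theorem clique_path_tree_exists:
  assumes "simple_graph G" "connected_graph G" "chordal G"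
    and "\<And>Q. clique_separator G Q \<Longrightarrow> colorable G Q"
  shows "\<exists>T. clique_path_tree G T"
  using assms
proof (induction "card (verts G)" arbitrary: G rule: less_induct)
  case less
  note G = less.prems(1)
  have ne: "verts G \<noteq> {}" using less.prems(2) by (simp add: connected_graph_def)
  show ?case
  proof (cases "\<exists>Q. clique_separator G Q")
    case False
    then obtain Q Q' where "{K. is_clique G K} = {Q, Q'}"
      using no_separator_two_cliques[OF G less.prems(3) ne] by blast
    then show ?thesis by (rule clique_path_tree_two)
  next
    case True
    then obtain Q where sep: "clique_separator G Q" by blast
    then have Q: "is_clique G Q" and two: "card (comps G Q) \<ge> 2" by (auto simp: clique_separator_iff)
    have QV: "Q \<subseteq> verts G" by (rule is_cliqueD(1)[OF Q])
    obtain q0 where q0: "q0 \<in> Q" using clique_nonempty[OF Q ne] by blast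
    show ?thesis
    proof (rule glue_clique_path_trees[OF G Q less.prems(4)[OF sep]])
      fix C assume C: "C \<in> comps G Q"
      have CV: "C \<subseteq> verts G - Q" by (rule comps_subset[OF C])
      show "\<exists>T. clique_path_tree (piece G Q C) T"
      proof (rule less.hyps)
        have "\<exists>D\<in>comps G Q. D \<noteq> C"
        proof (rule ccontr)
          assume "\<not> (\<exists>D\<in>comps G Q. D \<noteq> C)"
          then have "comps G Q \<subseteq> {C}" by blast
          then have "card (comps G Q) \<le> card {C}" by (intro card_mono) auto
          then show False using two by simp
        qed
        then obtain D where D: "D \<in> comps G Q" "D \<noteq> C" by blast
        obtain x where x: "x \<in> D" using comps_nonempty[OF D(1)] by blast
        have "x \<notin> C" using comps_eq[OF D(1) C x] D(2) by blast
        moreover have "x \<in> verts G - Q" using comps_subset[OF D(1)] x by blast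
        ultimately have "C \<union> Q \<subset> verts G" using CV QV by blast
        then show "card (verts (piece G Q C)) < card (verts G)"
          using simple_graph_finite[OF G] by (simp add: psubset_card_mono)
        show "simple_graph (piece G Q C)" by (rule piece_simple[OF G Q C])
        show "chordal (piece G Q C)" unfolding piece_def
          by (rule chordal_induced[OF less.prems(3)]) (use CV QV in blast)
        show "colorable (piece G Q C) Q'" if "clique_separator (piece G Q C) Q'" for Q'
          by (rule colorable_piece[OF G Q C that less.prems(4)])
        show "connected_graph (piece G Q C)"
        proof -
          obtain c w where cw: "c \<in> C" "w \<in> Q" "adj G c w"
            using component_has_neighbour[OF G less.prems(2) Q C] adj_commute by metis
          have root: "conn G (C \<union> Q) x w" if x: "x \<in> C \<union> Q" for x
          proof (cases "x \<in> C")
            case True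
            then have "conn G C x c" using comps_connected[OF C] cw(1) by (simp add: connected_on_def)
            then have "conn G (C \<union> Q) x c" by (rule conn_mono) simp
            then show ?thesis using conn_step[of G "C \<union> Q" x c w] cw by simp
          next
            case False
            then show ?thesis
              using is_cliqueD(3)[OF Q, of x w] cw(2) x conn_adj[of G x w "C \<union> Q"] by (cases "x = w") auto
          qed
          have "conn G (C \<union> Q) x y" if "x \<in> C \<union> Q" "y \<in> C \<union> Q" for x y
            using conn_trans[OF root[OF that(1)] conn_sym[OF root[OF that(2)]]] .
          then have "connected_on G (C \<union> Q)" unfolding connected_on_def by blast
          then show ?thesis unfolding piece_def connected_graph_induced using q0 by blast
        qed
      qed
    qed
  qed
qed

text \<open>Remove a deepest node \<open>x\<close>; the rest is a path by induction. The parent of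
  \<open>x\<close> must be an end of it, since in the middle it would have three neighbours in
  \<open>S\<close>.\<close>

lemma tree_path_of_degree:
  assumes R: "rtree T r p d" and S: "S \<subseteq> verts T" "S \<noteq> {}" "connected_on T S"
    and deg: "\<And>x. x \<in> S \<Longrightarrow> card {y \<in> S. adj T x y} \<le> 2"
  shows "\<exists>xs. tree_path T xs \<and> set xs = S"
proof -
  have fin: "finite S" using S(1) rtreeD(1)[OF R] finite_subset by blast
  obtain t where t: "t \<in> S" "\<forall>x\<in>S. x \<noteq> t \<longrightarrow> x \<noteq> r \<and> p x \<in> S"
    using connected_top[OF R S] by blast
  have par: "x \<noteq> r \<and> p x \<in> S" if "x \<in> S" "x \<noteq> t" for x using t(2)[rule_format, OF that] .
  have "\<exists>xs. tree_path T xs \<and> set xs = A"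
    if "A \<subseteq> S" "t \<in> A" "\<And>x. x \<in> A \<Longrightarrow> x \<noteq> t \<Longrightarrow> p x \<in> A" for A
    using that
  proof (induction "card A" arbitrary: A rule: less_induct)
    case less
    have finA: "finite A" using less.prems(1) fin finite_subset by blast
    show ?case
    proof (cases "A = {t}")
      case True
      then show ?thesis using t(1) S(1) by (intro exI[of _ "[t]"]) (auto simp: tree_path_def)
    next
      case False
      then have ne: "A - {t} \<noteq> {}" using less.prems(2) by blast
      obtain x where "x \<in> A - {t}" and "\<forall>y\<in>A - {t}. d y \<le> d x"
        using ex_greatest_on_finite[OF finite_Diff[OF finA] ne] by blast
      then have x: "x \<in> A" "x \<noteq> t" and max: "\<And>y. y \<in> A \<Longrightarrow> y \<noteq> t \<Longrightarrow> d y \<le> d x" by simp_all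
      have xT: "x \<in> verts T" "x \<noteq> r" "x \<in> S" using x less.prems(1) S(1) par by blast+
      define B where "B = A - {x}"
      have "p y \<in> B" if "y \<in> B" "y \<noteq> t" for y
      proof -
        have y: "y \<in> A" "y \<in> S" using that less.prems(1) by (auto simp: B_def)
        then have "d (p y) < d y" using rtreeD(4)[OF R, of y] par[OF y(2) that(2)] S(1) by blast
        then have "p y \<noteq> x" using max[OF y(1) that(2)] by auto
        then show ?thesis using less.prems(3)[OF y(1) that(2)] by (simp add: B_def)
      qed
      moreover have "card B < card A" unfolding B_def using finA x(1) by (rule card_Diff1_less)
      moreover have "B \<subseteq> S" "t \<in> B" using less.prems x by (auto simp: B_def)
      ultimately obtain xs where xs: "tree_path T xs" "set xs = B" using less.hyps[of B] by blast
      have px: "p x \<in> B"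
      proof -
        have "p x \<noteq> x" using rtreeD(4)[OF R xT(1,2)] by auto
        then show ?thesis using less.prems(3)[OF x(1,2)] by (simp add: B_def)
      qed
      then obtain m where m: "m < length xs" "xs ! m = p x" using xs(2) unfolding in_set_conv_nth[symmetric] by (metis in_set_conv_nth)
      have dist: "distinct xs" and a: "\<And>i. Suc i < length xs \<Longrightarrow> adj T (xs ! i) (xs ! Suc i)" and xsT: "xs \<noteq> []" "set xs \<subseteq> verts T"
        using xs(1) by (auto simp: tree_path_def)
      have xn: "x \<notin> set xs" using xs(2) by (simp add: B_def)
      have ad: "adj T x (p x)" "adj T (p x) x" using xT rtree_adj[OF R] by blast+
      have end_: "m = 0 \<or> Suc m = length xs"
      proof (rule ccontr)
        assume "\<not> ?thesis"
        then have m': "0 < m" "Suc m < length xs" using m(1) by auto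
        have "adj T (p x) (xs ! (m - 1))" using a[of "m - 1"] m' m(2) adj_sym[of T "xs ! (m - 1)" "p x"] by simp
        moreover have "adj T (p x) (xs ! Suc m)" using a[of m] m' m(2) by simp
        moreover have "xs ! (m - 1) \<in> S" "xs ! Suc m \<in> S"
          using xs(2) \<open>B \<subseteq> S\<close> nth_mem[of "m - 1" xs] nth_mem[of "Suc m" xs] m' by auto
        ultimately have "{x, xs ! (m - 1), xs ! Suc m} \<subseteq> {y \<in> S. adj T (p x) y}" using xT(3) ad by auto
        then have "card {x, xs ! (m - 1), xs ! Suc m} \<le> card {y \<in> S. adj T (p x) y}"
          using fin by (intro card_mono) auto
        also have "\<dots> \<le> 2" by (rule deg) (use px \<open>B \<subseteq> S\<close> in blast)
        finally have le: "card {x, xs ! (m - 1), xs ! Suc m} \<le> 2" .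
        have "xs ! (m - 1) \<noteq> xs ! Suc m" using nth_eq_iff_index_eq[OF dist, of "m - 1" "Suc m"] m' by auto
        moreover have "xs ! (m - 1) \<noteq> x" "xs ! Suc m \<noteq> x"
          using xn nth_mem[of "m - 1" xs] nth_mem[of "Suc m" xs] m' by auto
        ultimately have "card {x, xs ! (m - 1), xs ! Suc m} = 3" by auto
        then show False using le by simp
      qed
      have first: "\<exists>zs. tree_path T zs \<and> set zs = A" if ys: "tree_path T ys" "set ys = B" "ys ! 0 = p x" for ys
      proof (intro exI conjI)
        show "set (x # ys) = A" using ys(2) x(1) by (auto simp: B_def)
        show "tree_path T (x # ys)"
          unfolding tree_path_def
        proof (intro conjI allI impI)
          show "distinct (x # ys)" using ys by (auto simp: tree_path_def B_def)
          show "set (x # ys) \<subseteq> verts T" using ys xT by (auto simp: tree_path_def)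
          fix i assume i: "Suc i < length (x # ys)"
          show "adj T ((x # ys) ! i) ((x # ys) ! Suc i)"
          proof (cases i)
            case 0
            then show ?thesis using ad ys(3) by simp
          next
            case (Suc j)
            then show ?thesis using ys(1) i by (simp add: tree_path_def)
          qed
        qed simp
      qed
      from end_ show ?thesis
      proof
        assume "m = 0"
        then show ?thesis using first[OF xs] m by simp
      next
        assume l: "Suc m = length xs"
        have "rev xs ! 0 = p x" using l[symmetric] m xsT(1) by (simp add: rev_nth)
        then show ?thesis using first[OF tree_path_rev[OF xs(1)]] xs(2) by simp
      qed
    qed
  qed
  then show ?thesis using t(1) par by blast
qed

text \<open>Paths of different vertices may coincide in a clique tree. Hanging a private leaf below
  one end of each path makes them distinct without creating new intersections.\<close>

theorem clique_path_tree_imp_path_graph: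
  assumes G: "simple_graph G" and T: "clique_path_tree G T"
  shows "path_graph G"
proof -
  have tree: "is_tree T" and vT: "verts T = {K. is_clique G K}" using T by (auto simp: clique_path_tree_def)
  obtain r where r: "r \<in> verts T" using tree unfolding is_tree_def connected_graph_def by blast
  obtain p d where R: "rtree T r p d" using is_tree_rtree[OF tree r] by blast
  have finV: "finite (verts G)" by (rule simple_graph_finite[OF G])
  have "\<exists>xs. tree_path T xs \<and> set xs = cliques_at G v" if v: "v \<in> verts G" for v
  proof (rule tree_path_of_degree[OF R])
    show "cliques_at G v \<subseteq> verts T" by (auto simp: vT cliques_at_def)
    show "cliques_at G v \<noteq> {}" using clique_of_vertex[OF G v] by (auto simp: cliques_at_def)
  qed (use T v in \<open>auto simp: clique_path_tree_def\<close>)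
  then have "\<forall>v. \<exists>xs. v \<in> verts G \<longrightarrow> tree_path T xs \<and> set xs = cliques_at G v" by blast
  from choice[OF this] obtain xs where
    xs: "\<And>v. v \<in> verts G \<Longrightarrow> tree_path T (xs v)" "\<And>v. v \<in> verts G \<Longrightarrow> set (xs v) = cliques_at G v" by blast
  have xs_ne: "xs v \<noteq> []" if "v \<in> verts G" for v using xs(1)[OF that] by (simp add: tree_path_def)
  have last: "last (xs v) \<in> verts T" if "v \<in> verts G" for v
    using xs(1)[OF that] last_in_set[OF xs_ne[OF that]] by (auto simp: tree_path_def)
  \<comment> \<open>The nodes are the cliques and one private leaf per vertex. The injection
    \<open>g\<close> encodes both, as \<open>path_graph\<close> asks for a tree on natural
    numbers.\<close>
  define A where "A = Inl ` verts T \<union> Inr ` verts G"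
  have "finite A" using finV rtreeD(1)[OF R] by (simp add: A_def)
  then obtain g :: "'a set + 'a \<Rightarrow> nat" where g: "inj_on g A" using finite_imp_inj_to_nat_seg by blast
  have gA: "inv_into A g (g a) = a" if "a \<in> A" for a by (rule inv_into_f_f[OF g that])
  have geq: "g a = g b \<longleftrightarrow> a = b" if "a \<in> A" "b \<in> A" for a b using g that by (auto simp: inj_on_def)
  have inA: "K \<in> verts T \<Longrightarrow> Inl K \<in> A" "v \<in> verts G \<Longrightarrow> Inr v \<in> A" for K v by (auto simp: A_def)
  define pp where "pp n = (case inv_into A g n of Inl K \<Rightarrow> g (Inl (p K)) | Inr v \<Rightarrow> g (Inl (last (xs v))))" for n
  define dd where "dd n = (case inv_into A g n of Inl K \<Rightarrow> d K | Inr v \<Rightarrow> Suc (d (last (xs v))))" for n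
  have ppL: "pp (g (Inl K)) = g (Inl (p K))" "dd (g (Inl K)) = d K" if "K \<in> verts T" for K
    using gA inA that by (simp_all add: pp_def dd_def)
  have ppR: "pp (g (Inr v)) = g (Inl (last (xs v)))" "dd (g (Inr v)) = Suc (d (last (xs v)))" if "v \<in> verts G" for v
    using gA inA that by (simp_all add: pp_def dd_def)
  define T' where "T' = \<lparr>verts = g ` A, edges = {{n, pp n} | n. n \<in> g ` A - {g (Inl r)}}\<rparr>"
  have R': "rtree T' (g (Inl r)) pp dd"
    unfolding rtree_def
  proof (intro conjI ballI)
    show "finite (verts T')" using \<open>finite A\<close> by (simp add: T'_def)
    show "g (Inl r) \<in> verts T'" using r by (simp add: T'_def A_def)
    show "edges T' = {{x, pp x} | x. x \<in> verts T' - {g (Inl r)}}" by (simp add: T'_def)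
    fix n assume "n \<in> verts T' - {g (Inl r)}"
    then obtain a where a: "n = g a" "a \<in> A" "a \<noteq> Inl r" by (auto simp: T'_def)
    have "pp n \<in> verts T' \<and> dd (pp n) < dd n"
    proof (cases a)
      case (Inl K)
      then have K: "K \<in> verts T" "K \<noteq> r" using a by (auto simp: A_def)
      then show ?thesis using a(1) Inl ppL[of K] ppL[of "p K"] rtreeD(3,4)[OF R K] inA by (simp add: T'_def)
    next
      case (Inr v)
      then have "v \<in> verts G" using a by (auto simp: A_def)
      then show ?thesis using a(1) Inr ppR[of v] ppL[of "last (xs v)"] last inA by (simp add: T'_def)
    qed
    then show "pp n \<in> verts T'" "dd (pp n) < dd n" by blast+
  qed
  have R'T: "verts T' = g ` A" by (simp add: T'_def)
  have adjL: "adj T' (g (Inl K)) (g (Inl L))" if "adj T K L" for K L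
  proof -
    have KL: "K \<in> verts T" "L \<in> verts T" using that adjD[of T K L] tree by (auto simp: is_tree_def)
    show ?thesis using that KL ppL geq inA r unfolding rtree_adj[OF R'] rtree_adj[OF R] R'T by auto
  qed
  define ys where "ys v = map (\<lambda>K. g (Inl K)) (xs v) @ [g (Inr v)]" for v
  define \<phi> where "\<phi> v = \<lparr>verts = set (ys v), edges = {{ys v ! i, ys v ! Suc i} | i. Suc i < length (ys v)}\<rparr>" for v
  have xsT: "set (xs v) \<subseteq> verts T" if "v \<in> verts G" for v using xs(1)[OF that] by (simp add: tree_path_def)
  have set_ys: "set (ys v) = g ` (Inl ` cliques_at G v \<union> {Inr v})" if "v \<in> verts G" for v
    using xs(2)[OF that] by (auto simp: ys_def)
  have subA: "Inl ` cliques_at G v \<union> {Inr v} \<subseteq> A" if "v \<in> verts G" for v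
    using that by (auto simp: A_def vT cliques_at_def)
  have ys_path: "\<phi> v \<in> paths_of T'" if v: "v \<in> verts G" for v
  proof -
    have "distinct (ys v)"
    proof -
      have "inj_on (\<lambda>K. g (Inl K)) (set (xs v))"
        using geq inA xsT[OF v] by (intro inj_onI) (metis subsetD sum.inject(1))
      moreover have "g (Inr v) \<noteq> g (Inl K)" if "K \<in> set (xs v)" for K
        using geq[of "Inr v" "Inl K"] inA v xsT[OF v] that by auto
      ultimately show ?thesis using xs(1)[OF v] by (auto simp: ys_def distinct_map tree_path_def)
    qed
    moreover have "ys v \<noteq> []" by (simp add: ys_def)
    ultimately have "is_path (\<phi> v)" unfolding is_path_def \<phi>_def by (intro exI[of _ "ys v"]) simp
    moreover have "adj T' (ys v ! i) (ys v ! Suc i)" if i: "Suc i < length (ys v)" for i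
    proof (cases "Suc i = length (xs v)")
      case True
      have "ys v ! Suc i = g (Inr v)" "ys v ! i = g (Inl (last (xs v)))"
        using True[symmetric] xs_ne[OF v] by (simp_all add: ys_def nth_append last_conv_nth)
      moreover have "g (Inr v) \<in> verts T'" "g (Inr v) \<noteq> g (Inl r)" using v inA r geq by (auto simp: R'T)
      ultimately show ?thesis using ppR(1)[OF v] unfolding rtree_adj[OF R'] by simp
    next
      case False
      then have "Suc i < length (xs v)" using i by (simp add: ys_def)
      then show ?thesis using xs(1)[OF v] adjL by (simp add: ys_def nth_append tree_path_def)
    qed
    then have "subgraph_of (\<phi> v) T'"
      using set_ys[OF v] subA[OF v] unfolding subgraph_of_def \<phi>_def by (auto simp: R'T adj_def)
    ultimately show ?thesis by (simp add: paths_of_def)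
  qed
  have inter: "set (ys u) \<inter> set (ys v) \<noteq> {} \<longleftrightarrow> adj G u v" if uv: "u \<in> verts G" "v \<in> verts G" "u \<noteq> v" for u v
  proof -
    have "set (ys u) \<inter> set (ys v) = g ` ((Inl ` cliques_at G u \<union> {Inr u}) \<inter> (Inl ` cliques_at G v \<union> {Inr v}))"
      unfolding set_ys[OF uv(1)] set_ys[OF uv(2)] by (rule inj_on_image_Int[OF g subA[OF uv(1)] subA[OF uv(2)], symmetric])
    also have "(Inl ` cliques_at G u \<union> {Inr u}) \<inter> (Inl ` cliques_at G v \<union> {Inr v}) = Inl ` (cliques_at G u \<inter> cliques_at G v)"
      using uv(3) by auto
    finally have "set (ys u) \<inter> set (ys v) \<noteq> {} \<longleftrightarrow> cliques_at G u \<inter> cliques_at G v \<noteq> {}" by simp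
    also have "\<dots> \<longleftrightarrow> adj G u v"
      using clique_of_edge[OF G, of u v] is_cliqueD(3)[of G _ u v] uv(3) by (auto simp: cliques_at_def)
    finally show ?thesis .
  qed
  have inj: "inj_on \<phi> (verts G)"
  proof (rule inj_onI)
    fix u v assume uv: "u \<in> verts G" "v \<in> verts G" "\<phi> u = \<phi> v"
    then have "g ` (Inl ` cliques_at G u \<union> {Inr u}) = g ` (Inl ` cliques_at G v \<union> {Inr v})"
      using set_ys by (simp add: \<phi>_def)
    then have "Inl ` cliques_at G u \<union> {Inr u} = Inl ` cliques_at G v \<union> {Inr v}"
      using inj_on_image_eq_iff[OF g subA[OF uv(1)] subA[OF uv(2)]] by blast
    then show "u = v" by blast
  qed
  show ?thesis
    unfolding path_graph_def
  proof (intro exI conjI ballI impI)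
    show "is_tree T'" by (rule rtree_is_tree[OF R'])
    show "\<phi> ` verts G \<subseteq> paths_of T'" using ys_path by blast
    show "bij_betw \<phi> (verts G) (\<phi> ` verts G)" using inj by (simp add: bij_betw_def)
    fix u v assume uv: "u \<in> verts G" "v \<in> verts G" "u \<noteq> v"
    show "adj G u v = (verts (\<phi> u) \<inter> verts (\<phi> v) \<noteq> {})" using inter[OF uv] by (simp add: \<phi>_def)
  qed
qed

section \<open>The attachedness graph\<close>

definition rel_traces :: "'a set \<Rightarrow> 'a ugraph \<Rightarrow> 'a set set" where
  "rel_traces Q \<gamma> = {K \<inter> Q | K. relevant_clique Q \<gamma> K}"

lemma Union_rel_traces: "v \<in> \<Union> (rel_traces Q \<gamma>) \<longleftrightarrow> v \<in> Q \<and> neighboring_subgraph Q v \<gamma>"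
  unfolding rel_traces_def neighboring_subgraph_def by auto

lemma attached_iff: "attached Q \<gamma> \<gamma>' \<longleftrightarrow> \<Union> (rel_traces Q \<gamma>) \<inter> \<Union> (rel_traces Q \<gamma>') \<noteq> {}"
proof
  assume "attached Q \<gamma> \<gamma>'"
  then obtain K K' v where "relevant_clique Q \<gamma> K" "relevant_clique Q \<gamma>' K'" "v \<in> K" "v \<in> K'" "v \<in> Q"
    unfolding attached_def by blast
  then have "v \<in> \<Union> (rel_traces Q \<gamma>)" "v \<in> \<Union> (rel_traces Q \<gamma>')"
    unfolding Union_rel_traces neighboring_subgraph_def by blast+
  then show "\<Union> (rel_traces Q \<gamma>) \<inter> \<Union> (rel_traces Q \<gamma>') \<noteq> {}" by blast
next
  assume "\<Union> (rel_traces Q \<gamma>) \<inter> \<Union> (rel_traces Q \<gamma>') \<noteq> {}"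
  then obtain v where "v \<in> \<Union> (rel_traces Q \<gamma>)" "v \<in> \<Union> (rel_traces Q \<gamma>')" by blast
  then show "attached Q \<gamma> \<gamma>'"
    unfolding Union_rel_traces neighboring_subgraph_def attached_def by blast
qed

lemma dominated_iff: "dominated Q \<gamma> \<gamma>' \<longleftrightarrow> \<gamma> = \<gamma>' \<or> fam_dom (rel_traces Q \<gamma>) (rel_traces Q \<gamma>')"
proof -
  have "(\<forall>K. relevant_clique Q \<gamma> K \<longrightarrow> K \<inter> Q \<subseteq> K' \<inter> Q) \<longleftrightarrow> \<Union> (rel_traces Q \<gamma>) \<subseteq> K' \<inter> Q" for K'
    unfolding rel_traces_def by blast
  moreover have "(\<forall>K. relevant_clique Q \<gamma> K \<longrightarrow> K \<inter> K' \<inter> Q = {}) \<longleftrightarrow> \<Union> (rel_traces Q \<gamma>) \<inter> (K' \<inter> Q) = {}" for K'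
    unfolding rel_traces_def by blast
  moreover have "(\<forall>Y\<in>rel_traces Q \<gamma>'. P Y) \<longleftrightarrow> (\<forall>K'. relevant_clique Q \<gamma>' K' \<longrightarrow> P (K' \<inter> Q))" for P
    unfolding rel_traces_def by blast
  ultimately show ?thesis unfolding dominated_def fam_dom_def attached_iff by simp
qed

lemma antipodal_iff:
  "antipodal Q \<gamma> \<gamma>' \<longleftrightarrow> \<gamma> \<noteq> \<gamma>' \<and> fam_antipodal (rel_traces Q \<gamma>) (rel_traces Q \<gamma>')"
  unfolding antipodal_def attached_iff dominated_iff fam_antipodal_def by auto

lemma dominated_trans: "dominated Q x y \<Longrightarrow> dominated Q y z \<Longrightarrow> dominated Q x z"
  unfolding dominated_iff using fam_dom_trans by blast

lemma fam_dom_subset: "fam_dom A B \<Longrightarrow> \<Union> A \<subseteq> \<Union> B"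
proof -
  assume d: "fam_dom A B"
  then obtain Z where Z: "Z \<in> B" "\<Union> A \<inter> Z \<noteq> {}" unfolding fam_dom_def by auto
  then have "\<Union> A \<subseteq> Z" using d unfolding fam_dom_def by auto
  then show ?thesis using Z by blast
qed

lemma dominated_subset: "dominated Q x y \<Longrightarrow> \<Union> (rel_traces Q x) \<subseteq> \<Union> (rel_traces Q y)"
  unfolding dominated_iff using fam_dom_subset by (elim disjE) simp_all

lemma fam_coloring_card_mono:
  assumes "fam_coloring I R f" "finite I" "S \<subseteq> f ` {i \<in> I. v \<in> \<Union> (R i)}"
  shows "card S \<le> 2"
proof -
  have "card S \<le> card (f ` {i \<in> I. v \<in> \<Union> (R i)})" using assms by (intro card_mono) auto
  also have "\<dots> \<le> 2" using assms(1) by (simp only: fam_coloring_def)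
  finally show ?thesis .
qed

text \<open>Moves colourings between components and pieces, and from \<open>plus_graph G\<close>
  back to \<open>G\<close>. The witness \<open>w\<close> may differ from \<open>v\<close> because in
  the latter case \<open>v\<close> becomes \<open>Inl v\<close>.\<close>

lemma fam_coloring_pullback:
  assumes f: "fam_coloring J R' f" and fin: "finite J" and h: "inj_on h I" "h ` I \<subseteq> J"
    and ap: "\<And>i j. i \<in> I \<Longrightarrow> j \<in> I \<Longrightarrow> fam_antipodal (R i) (R j) \<Longrightarrow> fam_antipodal (R' (h i)) (R' (h j))"
    and mem: "\<And>v. \<exists>w. \<forall>i\<in>I. v \<in> \<Union> (R i) \<longrightarrow> w \<in> \<Union> (R' (h i))"
  shows "fam_coloring I R (\<lambda>i. f (h i))"
  unfolding fam_coloring_def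
proof (intro conjI ballI impI allI)
  fix i j assume ij: "i \<in> I" "j \<in> I" "i \<noteq> j" "fam_antipodal (R i) (R j)"
  then have "h i \<noteq> h j" "h i \<in> J" "h j \<in> J" using h by (auto simp: inj_on_def)
  then show "f (h i) \<noteq> f (h j)" using f ap[OF ij(1,2,4)] unfolding fam_coloring_def by blast
next
  fix v
  obtain w where w: "\<forall>i\<in>I. v \<in> \<Union> (R i) \<longrightarrow> w \<in> \<Union> (R' (h i))" using mem by blast
  show "card ((\<lambda>i. f (h i)) ` {i \<in> I. v \<in> \<Union> (R i)}) \<le> 2"
    by (rule fam_coloring_card_mono[OF f fin, of _ w]) (use w h(2) in blast)
qed

text \<open>Connectedness enters through \<open>att_ne\<close>: every component is attached to some
  vertex of \<open>Q\<close>. In this form it is checked for \<open>G\<close> and for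
  \<open>plus_graph G\<close> separately.\<close>

locale separated_graph =
  fixes G :: "'a ugraph" and Q :: "'a set"
  assumes simple: "simple_graph G" and clique: "is_clique G Q"
    and att_ne: "\<And>C. C \<in> comps G Q \<Longrightarrow> \<Union> (traces G Q C) \<noteq> {}"
begin

lemma Gamma_eq: "Gamma G Q = piece G Q ` comps G Q"
  by (auto simp: Gamma_def comps_def piece_def)

lemma rel_traces_piece: "C \<in> comps G Q \<Longrightarrow> rel_traces Q (piece G Q C) = traces G Q C"
  unfolding rel_traces_def traces_def piece_def relevant_clique_iff[OF simple clique] by blast

lemma finite_Gamma: "finite (Gamma G Q)"
  by (simp add: Gamma_eq finite_comps[OF simple])

lemma rel_traces_ne: "\<gamma> \<in> Gamma G Q \<Longrightarrow> \<Union> (rel_traces Q \<gamma>) \<noteq> {}"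
  using att_ne rel_traces_piece by (auto simp: Gamma_eq)

lemma piece_inj: "inj_on (piece G Q) (comps G Q)"
proof (rule inj_onI)
  fix C D assume CD: "C \<in> comps G Q" "D \<in> comps G Q" "piece G Q C = piece G Q D"
  then have "C \<union> Q = D \<union> Q" by (metis piece_verts)
  then show "C = D" using comps_subset[OF CD(1)] comps_subset[OF CD(2)] by blast
qed

lemma colorable_iff_Gamma:
  "colorable G Q \<longleftrightarrow> (\<exists>f :: 'a ugraph \<Rightarrow> nat. fam_coloring (Gamma G Q) (rel_traces Q) f)"
proof
  assume "colorable G Q"
  then obtain f :: "'a set \<Rightarrow> nat" where f: "fam_coloring (comps G Q) (traces G Q) f"
    by (auto simp: colorable_def)
  have i: "inv_into (comps G Q) (piece G Q) \<gamma> \<in> comps G Q"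
    "piece G Q (inv_into (comps G Q) (piece G Q) \<gamma>) = \<gamma>" if "\<gamma> \<in> Gamma G Q" for \<gamma>
    using that by (simp_all add: Gamma_eq inv_into_into f_inv_into_f)
  then have t: "rel_traces Q \<gamma> = traces G Q (inv_into (comps G Q) (piece G Q) \<gamma>)" if "\<gamma> \<in> Gamma G Q" for \<gamma>
    using rel_traces_piece that by metis
  have "fam_coloring (Gamma G Q) (rel_traces Q) (\<lambda>\<gamma>. f (inv_into (comps G Q) (piece G Q) \<gamma>))"
  proof (rule fam_coloring_pullback[OF f finite_comps[OF simple]])
    show "inj_on (inv_into (comps G Q) (piece G Q)) (Gamma G Q)" by (simp add: Gamma_eq inj_on_inv_into)
    show "inv_into (comps G Q) (piece G Q) ` Gamma G Q \<subseteq> comps G Q" using i(1) by blast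
    show "\<exists>w. \<forall>\<gamma>\<in>Gamma G Q. v \<in> \<Union> (rel_traces Q \<gamma>) \<longrightarrow>
        w \<in> \<Union> (traces G Q (inv_into (comps G Q) (piece G Q) \<gamma>))" for v
      using t by (intro exI[of _ v]) simp
  qed (use t in simp)
  then show "\<exists>f :: 'a ugraph \<Rightarrow> nat. fam_coloring (Gamma G Q) (rel_traces Q) f" by blast
next
  assume "\<exists>f :: 'a ugraph \<Rightarrow> nat. fam_coloring (Gamma G Q) (rel_traces Q) f"
  then obtain f :: "'a ugraph \<Rightarrow> nat" where f: "fam_coloring (Gamma G Q) (rel_traces Q) f" by blast
  have "fam_coloring (comps G Q) (traces G Q) (\<lambda>C. f (piece G Q C))"
  proof (rule fam_coloring_pullback[OF f finite_Gamma piece_inj])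
    show "piece G Q ` comps G Q \<subseteq> Gamma G Q" by (simp add: Gamma_eq)
    show "\<exists>w. \<forall>C\<in>comps G Q. v \<in> \<Union> (traces G Q C) \<longrightarrow> w \<in> \<Union> (rel_traces Q (piece G Q C))" for v
      using rel_traces_piece by (intro exI[of _ v]) simp
  qed (use rel_traces_piece in simp)
  then show "colorable G Q" unfolding colorable_def by blast
qed

abbreviation classes :: "'a ugraph set set" where
  "classes \<equiv> Gamma G Q // dom_equiv G Q"

definition cls_W :: "'a ugraph set \<Rightarrow> 'a set" where
  "cls_W A = (\<Union>\<gamma>\<in>A. \<Union> (rel_traces Q \<gamma>))"

definition cls_le :: "'a ugraph set \<Rightarrow> 'a ugraph set \<Rightarrow> bool" where
  "cls_le = on_reps (dominated Q)"

lemma dom_equiv_iff: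
  "(x, y) \<in> dom_equiv G Q \<longleftrightarrow> x \<in> Gamma G Q \<and> y \<in> Gamma G Q \<and> dominated Q x y \<and> dominated Q y x"
  by (simp add: dom_equiv_def)

lemma equiv: "equiv (Gamma G Q) (dom_equiv G Q)"
proof (rule equivI)
  show "refl_on (Gamma G Q) (dom_equiv G Q)" by (auto simp: refl_on_def dom_equiv_def dominated_def)
  show "sym (dom_equiv G Q)" by (auto simp: sym_def dom_equiv_def)
  show "trans (dom_equiv G Q)" unfolding trans_def dom_equiv_iff using dominated_trans by blast
  show "dom_equiv G Q \<subseteq> Gamma G Q \<times> Gamma G Q" by (auto simp: dom_equiv_def)
qed

lemma class_ne: "A \<in> classes \<Longrightarrow> \<exists>a. a \<in> A"
  using in_quotient_imp_non_empty[OF equiv] by blast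

lemma class_sub: "A \<in> classes \<Longrightarrow> a \<in> A \<Longrightarrow> a \<in> Gamma G Q"
  using in_quotient_imp_subset[OF equiv] by blast

lemma class_rel: "A \<in> classes \<Longrightarrow> a \<in> A \<Longrightarrow> a' \<in> A \<Longrightarrow> dominated Q a a'"
  using in_quotient_imp_in_rel[OF equiv, of A a a'] by (simp add: dom_equiv_iff)

lemma cls_W_rep: "A \<in> classes \<Longrightarrow> a \<in> A \<Longrightarrow> cls_W A = \<Union> (rel_traces Q a)"
proof -
  assume A: "A \<in> classes" "a \<in> A"
  have "\<Union> (rel_traces Q x) = \<Union> (rel_traces Q a)" if "x \<in> A" for x
    using dominated_subset[OF class_rel[OF A(1) that A(2)]] dominated_subset[OF class_rel[OF A that]] by (rule equalityI)
  then have "(\<Union>\<gamma>\<in>A. \<Union> (rel_traces Q \<gamma>)) = (\<Union>\<gamma>\<in>A. \<Union> (rel_traces Q a))" by (intro SUP_cong) simp_all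
  also have "\<dots> = \<Union> (rel_traces Q a)" using A(2) by blast
  finally show ?thesis unfolding cls_W_def .
qed

lemma cls_le_rep: "A \<in> classes \<Longrightarrow> B \<in> classes \<Longrightarrow> a \<in> A \<Longrightarrow> b \<in> B \<Longrightarrow> cls_le A B \<longleftrightarrow> dominated Q a b"
  unfolding cls_le_def on_reps_def using class_rel dominated_trans by meson

lemma class_eqI: "A \<in> classes \<Longrightarrow> B \<in> classes \<Longrightarrow> a \<in> A \<Longrightarrow> b \<in> B \<Longrightarrow> dominated Q a b \<Longrightarrow> dominated Q b a \<Longrightarrow> A = B"
  by (rule quotient_eqI[OF equiv]) (auto simp: dom_equiv_iff class_sub)

lemma class_of: "\<gamma> \<in> Gamma G Q \<Longrightarrow> dom_equiv G Q `` {\<gamma>} \<in> classes \<and> \<gamma> \<in> dom_equiv G Q `` {\<gamma>}"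
  by (auto simp: quotientI dom_equiv_iff dominated_def)

text \<open>Passing to classes is what makes dominance antisymmetric, as the abstract results
  demand.\<close>

sublocale attachment_order classes cls_W cls_le
proof
  show "finite classes"
    using finite_quotient[of "Gamma G Q" "dom_equiv G Q"] finite_Gamma equiv by (simp add: equiv_def)
  show "cls_W x \<noteq> {}" if "x \<in> classes" for x
    using class_ne[OF that] cls_W_rep[OF that] rel_traces_ne class_sub[OF that] by metis
  show "cls_le x x" if "x \<in> classes" for x
    using class_ne[OF that] cls_le_rep[OF that that] by (auto simp: dominated_def)
  show "cls_le x z" if "x \<in> classes" "y \<in> classes" "z \<in> classes" "cls_le x y" "cls_le y z" for x y z
    using class_ne[OF that(1)] class_ne[OF that(2)] class_ne[OF that(3)] that
      cls_le_rep[OF that(1,2)] cls_le_rep[OF that(2,3)] cls_le_rep[OF that(1,3)] dominated_trans by metis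
  show "x = y" if "x \<in> classes" "y \<in> classes" "cls_le x y" "cls_le y x" for x y
    using class_ne[OF that(1)] class_ne[OF that(2)] that
      cls_le_rep[OF that(1,2)] cls_le_rep[OF that(2,1)] class_eqI[OF that(1,2)] by metis
  show "cls_W x \<subseteq> cls_W y" if "x \<in> classes" "y \<in> classes" "cls_le x y" for x y
    using class_ne[OF that(1)] class_ne[OF that(2)] that(3)
      cls_le_rep[OF that(1,2)] cls_W_rep[OF that(1)] cls_W_rep[OF that(2)] dominated_subset by metis
qed

lemma ap_rep:
  assumes "A \<in> classes" "B \<in> classes" "a \<in> A" "b \<in> B"
  shows "ap A B \<longleftrightarrow> antipodal Q a b"
  unfolding ap_def antipodal_def attached_iff
  using cls_W_rep[OF assms(1,3)] cls_W_rep[OF assms(2,4)] cls_le_rep[OF assms] cls_le_rep[OF assms(2,1,4,3)] by simp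

lemma on_reps_antipodal: "A \<in> classes \<Longrightarrow> B \<in> classes \<Longrightarrow> on_reps (antipodal Q) A B \<longleftrightarrow> ap A B"
  unfolding on_reps_def using ap_rep class_ne by meson

lemma on_reps_attached: "A \<in> classes \<Longrightarrow> B \<in> classes \<Longrightarrow> on_reps (attached Q) A B \<longleftrightarrow> cls_W A \<inter> cls_W B \<noteq> {}"
  unfolding on_reps_def attached_iff cls_W_def by blast

lemma attachedness_graph_eq: "attachedness_graph G Q = agraph"
proof -
  have "A \<noteq> B \<and> on_reps (attached Q) A B \<and> on_reps (antipodal Q) A B \<longleftrightarrow> ap A B"
    if "A \<in> classes" "B \<in> classes" for A B
    unfolding on_reps_antipodal[OF that] on_reps_attached[OF that] using ap_irrefl that by (auto simp: ap_def)
  then have a: "{{A, B} | A B. A \<in> classes \<and> B \<in> classes \<and> A \<noteq> B \<and> on_reps (attached Q) A B \<and> on_reps (antipodal Q) A B}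
    = {{A, B} | A B. A \<in> classes \<and> B \<in> classes \<and> ap A B}" by (intro Collect_cong) metis
  have "on_reps (attached Q) A B \<and> \<not> on_reps (antipodal Q) A B \<longleftrightarrow> cls_le A B \<or> cls_le B A"
    if "A \<in> classes" "B \<in> classes" for A B
    unfolding on_reps_antipodal[OF that] on_reps_attached[OF that] using le_att[OF that] by (auto simp: ap_def)
  then have "{{A, B} | A B. A \<in> classes \<and> B \<in> classes \<and> A \<noteq> B \<and> on_reps (attached Q) A B \<and> \<not> on_reps (antipodal Q) A B}
    = {{A, B} | A B. A \<in> classes \<and> B \<in> classes \<and> A \<noteq> B \<and> (cls_le A B \<or> cls_le B A)}" by (intro Collect_cong) metis
  then show ?thesis unfolding attachedness_graph_def agraph_def Let_def a by simp
qed

lemma has_full_antipodal_triangle_iff: "has_full_antipodal_triangle G Q \<longleftrightarrow> full_triangle"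
proof
  assume "has_full_antipodal_triangle G Q"
  then obtain A B C a b c where e: "{{A, B}, {B, C}, {A, C}} \<subseteq> antip_edges agraph"
    and n: "a \<in> A" "b \<in> B" "c \<in> C" "neighboring_set G Q {a, b, c}"
    unfolding has_full_antipodal_triangle_def attachedness_graph_eq by (elim exE bexE conjE) (rule that)
  have X: "A \<in> classes" "B \<in> classes" "C \<in> classes" "ap A B" "ap B C" "ap A C"
    using e by (auto simp: antip_iff)
  obtain v where v: "v \<in> Q" "\<forall>\<gamma>\<in>{a, b, c}. neighboring_subgraph Q v \<gamma>"
    using n(4) unfolding neighboring_set_def by blast
  then have "v \<in> cls_W A" "v \<in> cls_W B" "v \<in> cls_W C"
    unfolding cls_W_rep[OF X(1) n(1)] cls_W_rep[OF X(2) n(2)] cls_W_rep[OF X(3) n(3)] Union_rel_traces by auto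
  then show full_triangle unfolding full_triangle_def using X by blast
next
  assume full_triangle
  then obtain A B C v where X: "A \<in> classes" "B \<in> classes" "C \<in> classes" "ap A B" "ap B C" "ap A C"
    and v: "v \<in> cls_W A" "v \<in> cls_W B" "v \<in> cls_W C" unfolding full_triangle_def by blast
  obtain a b c where n: "a \<in> A" "b \<in> B" "c \<in> C" using class_ne X(1-3) by meson
  have "neighboring_set G Q {a, b, c}"
    using v class_sub[OF X(1) n(1)] class_sub[OF X(2) n(2)] class_sub[OF X(3) n(3)]
    unfolding cls_W_rep[OF X(1) n(1)] cls_W_rep[OF X(2) n(2)] cls_W_rep[OF X(3) n(3)] Union_rel_traces neighboring_set_def
    by blast
  moreover have "{{A, B}, {B, C}, {A, C}} \<subseteq> antip_edges agraph" using X by (simp add: antip_iff)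
  ultimately show "has_full_antipodal_triangle G Q"
    unfolding has_full_antipodal_triangle_def attachedness_graph_eq using n by blast
qed

text \<open>A colouring of components need not be constant on classes, so each class takes the
  colour of a chosen representative. In the other direction a component takes the colour of its
  class.\<close>

lemma colorable_iff_valid: "colorable G Q \<longleftrightarrow> (\<exists>f :: 'a ugraph set \<Rightarrow> nat. valid f)"
  unfolding colorable_iff_Gamma
proof
  assume "\<exists>f :: 'a ugraph \<Rightarrow> nat. fam_coloring (Gamma G Q) (rel_traces Q) f"
  then obtain f :: "'a ugraph \<Rightarrow> nat" where f: "fam_coloring (Gamma G Q) (rel_traces Q) f" by blast
  define rep where "rep A = (SOME a. a \<in> A)" for A :: "'a ugraph set"
  have rep: "rep A \<in> A" if "A \<in> classes" for A unfolding rep_def by (rule someI_ex[OF class_ne[OF that]])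
  have "valid (\<lambda>A. f (rep A))"
    unfolding valid_def
  proof (intro conjI ballI impI allI)
    fix A B assume AB: "A \<in> classes" "B \<in> classes" "ap A B"
    then have "antipodal Q (rep A) (rep B)" using ap_rep[OF AB(1,2)] rep by blast
    then show "f (rep A) \<noteq> f (rep B)"
      using f class_sub[OF AB(1) rep[OF AB(1)]] class_sub[OF AB(2) rep[OF AB(2)]]
      unfolding fam_coloring_def antipodal_iff by blast
  next
    fix v
    show "card ((\<lambda>A. f (rep A)) ` {A \<in> classes. v \<in> cls_W A}) \<le> 2"
    proof (rule fam_coloring_card_mono[OF f finite_Gamma, of _ v], rule image_subsetI)
      fix A assume A: "A \<in> {A \<in> classes. v \<in> cls_W A}"
      then have "rep A \<in> Gamma G Q" "v \<in> \<Union> (rel_traces Q (rep A))"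
        using rep[of A] class_sub[of A "rep A"] cls_W_rep[of A "rep A"] by auto
      then show "f (rep A) \<in> f ` {i \<in> Gamma G Q. v \<in> \<Union> (rel_traces Q i)}" by blast
    qed
  qed
  then show "\<exists>f :: 'a ugraph set \<Rightarrow> nat. valid f" by blast
next
  assume "\<exists>f :: 'a ugraph set \<Rightarrow> nat. valid f"
  then obtain f :: "'a ugraph set \<Rightarrow> nat" where f: "valid f" by blast
  let ?c = "\<lambda>\<gamma>. dom_equiv G Q `` {\<gamma>}"
  have "fam_coloring (Gamma G Q) (rel_traces Q) (\<lambda>\<gamma>. f (?c \<gamma>))"
    unfolding fam_coloring_def
  proof (intro conjI ballI impI allI)
    fix x y assume xy: "x \<in> Gamma G Q" "y \<in> Gamma G Q" "x \<noteq> y" "fam_antipodal (rel_traces Q x) (rel_traces Q y)"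
    then have "ap (?c x) (?c y)" using ap_rep[of "?c x" "?c y" x y] class_of antipodal_iff by blast
    then show "f (?c x) \<noteq> f (?c y)" using f class_of xy(1,2) unfolding valid_def by blast
  next
    fix v
    have "(\<lambda>\<gamma>. f (?c \<gamma>)) ` {\<gamma> \<in> Gamma G Q. v \<in> \<Union> (rel_traces Q \<gamma>)} \<subseteq> f ` {A \<in> classes. v \<in> cls_W A}"
    proof (rule image_subsetI)
      fix x assume x: "x \<in> {\<gamma> \<in> Gamma G Q. v \<in> \<Union> (rel_traces Q \<gamma>)}"
      then have "?c x \<in> classes" "v \<in> cls_W (?c x)" using class_of[of x] cls_W_rep[of "?c x" x] by auto
      then show "f (?c x) \<in> f ` {A \<in> classes. v \<in> cls_W A}" by blast
    qed
    then have "card ((\<lambda>\<gamma>. f (?c \<gamma>)) ` {\<gamma> \<in> Gamma G Q. v \<in> \<Union> (rel_traces Q \<gamma>)}) \<le> card (f ` {A \<in> classes. v \<in> cls_W A})"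
      using fin by (intro card_mono) auto
    also have "\<dots> \<le> 2" using f by (simp only: valid_def)
    finally show "card ((\<lambda>\<gamma>. f (?c \<gamma>)) ` {\<gamma> \<in> Gamma G Q. v \<in> \<Union> (rel_traces Q \<gamma>)}) \<le> 2" .
  qed
  then show "\<exists>f :: 'a ugraph \<Rightarrow> nat. fam_coloring (Gamma G Q) (rel_traces Q) f" by blast
qed

text \<open>The facts close a circle: a valid colouring excludes full triangles and
  \<open>family_F0\<close>, the latter excludes \<open>forbidden\<close>, and without
  \<open>forbidden\<close> and full triangles a valid colouring exists.
  \<open>colorable_iff_no_F\<close> runs through the same circle.\<close>

theorem colorable_iff_no_F0:
  "colorable G Q \<longleftrightarrow> \<not> has_full_antipodal_triangle G Q \<and>
     \<not> (\<exists>H\<in>family_F0. has_csubgraph (attachedness_graph G Q) H)"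
  unfolding colorable_iff_valid has_full_antipodal_triangle_iff attachedness_graph_eq
  using valid_imp_no_full_triangle valid_imp_no_F0 no_F0_imp_not_forbidden valid_coloring_exists by blast

theorem colorable_iff_no_F:
  "colorable G Q \<longleftrightarrow> \<not> has_full_antipodal_triangle G Q \<and>
     \<not> (\<exists>H\<in>family_F. has_induced_csubgraph (attachedness_graph G Q) H)"
  unfolding colorable_iff_valid has_full_antipodal_triangle_iff attachedness_graph_eq forbidden_def[symmetric]
  using valid_imp_no_full_triangle valid_imp_no_F0 no_F0_imp_not_forbidden valid_coloring_exists by blast

text \<open>A common lower bound of the components attached to \<open>v\<close> is the hub of a wheel \<open>W0 1\<close> around
  each full antipodal triangle at \<open>v\<close>.\<close>

lemma no_full_triangle_of_lower_bounds:
  assumes low: "\<And>v. v \<in> Q \<Longrightarrow> \<exists>\<sigma>\<in>Gamma G Q. \<forall>\<gamma>\<in>Gamma G Q. v \<in> \<Union> (rel_traces Q \<gamma>) \<longrightarrow> dominated Q \<sigma> \<gamma>"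
    and nf: "\<not> forbidden"
  shows "\<not> full_triangle"
proof
  assume full_triangle
  then obtain A B C v where X: "A \<in> classes" "B \<in> classes" "C \<in> classes" "ap A B" "ap B C" "ap A C"
    and v: "v \<in> cls_W A" "v \<in> cls_W B" "v \<in> cls_W C" unfolding full_triangle_def by blast
  obtain a where "a \<in> A" using class_ne[OF X(1)] by blast
  then have "v \<in> Q" using v(1) unfolding cls_W_rep[OF X(1) \<open>a \<in> A\<close>] Union_rel_traces by blast
  then obtain \<sigma> where s: "\<sigma> \<in> Gamma G Q" "\<forall>\<gamma>\<in>Gamma G Q. v \<in> \<Union> (rel_traces Q \<gamma>) \<longrightarrow> dominated Q \<sigma> \<gamma>"
    using low by blast
  define S where "S = dom_equiv G Q `` {\<sigma>}"
  have S: "S \<in> classes" "\<sigma> \<in> S" using class_of[OF s(1)] by (simp_all add: S_def)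
  have leS: "cls_le S D" if D: "D \<in> classes" "v \<in> cls_W D" for D
  proof -
    obtain b where b: "b \<in> D" using class_ne[OF D(1)] by blast
    then show ?thesis using cls_le_rep[OF S(1) D(1) S(2) b] s(2) class_sub[OF D(1) b] D(2) cls_W_rep[OF D(1) b] by auto
  qed
  have ne: "S \<noteq> A" "S \<noteq> B" "S \<noteq> C" using leS X v by (auto simp: ap_def)
  \<comment> \<open>The triangle takes the indices \<open>0\<close>, \<open>1\<close>,
    \<open>2\<close>; the hub of \<open>W0 1\<close> has index \<open>3\<close>.\<close>
  define c where "c i = (if i = 0 then A else if i = 1 then B else if i = 2 then C else S)" for i :: nat
  have forbidden
  proof (rule forbiddenI[of "W0 1" c])
    show "W0 1 \<in> family_F" unfolding family_F_def by blast
    show "c i \<in> classes" for i using X S by (simp add: c_def)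
    fix i j assume ij: "i < j" "i \<in> cverts (W0 1)" "j \<in> cverts (W0 1)"
    then have j: "j \<le> 2 * 1 + 1" by (auto simp: cverts_family)
    have "i = 0 \<and> j = 1 \<or> i = 0 \<and> j = 2 \<or> i = 1 \<and> j = 2 \<or> i < 3 \<and> j = 3" using j ij(1) by presburger
    then consider "i = 0" "j = 1" | "i = 0" "j = 2" | "i = 1" "j = 2" | "i < 3" "j = 3" by blast
    then have "c i \<noteq> c j \<and> (({i, j} \<in> antip_edges (W0 1)) = ap (c i) (c j)) \<and>
      (({i, j} \<in> dom_edges (W0 1)) = (cls_le (c i) (c j) \<or> cls_le (c j) (c i)))"
      unfolding W0_simps[OF ij(1) j]
    proof cases
      case 4
      have "c j = S" "c i \<in> {A, B, C}" using 4 by (auto simp: c_def)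
      moreover have "cls_le S (c i)" using calculation leS X v by auto
      ultimately show "c i \<noteq> c j \<and> (j \<le> 2 * 1 \<and> (j = Suc i \<or> i = 0 \<and> j = 2 * 1)) = ap (c i) (c j) \<and>
        (j = 2 * 1 + 1) = (cls_le (c i) (c j) \<or> cls_le (c j) (c i))"
        using 4 ne by (auto simp: ap_def)
    qed (use X ap_irrefl in \<open>auto simp: c_def ap_def\<close>)
    then show "c i \<noteq> c j" "({i, j} \<in> antip_edges (W0 1)) = ap (c i) (c j)"
      "({i, j} \<in> dom_edges (W0 1)) = (cls_le (c i) (c j) \<or> cls_le (c j) (c i))" by blast+
  qed
  then show False using nf by simp
qed

end

section \<open>The graph with pendant vertices\<close>

lemma verts_plus: "verts (plus_graph G) = Inl ` verts G \<union> Inr ` verts G"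
  by (simp add: plus_graph_def)

lemma adj_plus:
  "adj (plus_graph G) (Inl u) (Inl v) \<longleftrightarrow> adj G u v"
  "adj (plus_graph G) (Inl u) (Inr v) \<longleftrightarrow> u = v \<and> v \<in> verts G"
  "adj (plus_graph G) (Inr u) (Inl v) \<longleftrightarrow> u = v \<and> v \<in> verts G"
  "\<not> adj (plus_graph G) (Inr u) (Inr v)"
proof -
  have e: "e \<in> edges (plus_graph G) \<longleftrightarrow> (\<exists>f\<in>edges G. e = Inl ` f) \<or> (\<exists>v\<in>verts G. e = {Inl v, Inr v})" for e
    by (auto simp: plus_graph_def)
  have im: "{Inl u, Inl v} = (Inl ` f :: ('a + 'a) set) \<longleftrightarrow> f = {u, v}" for u v f
  proof -
    have "{Inl u, Inl v} = (Inl ` {u, v} :: ('a + 'a) set)" by simp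
    then show ?thesis by (metis inj_Inl inj_image_eq_iff)
  qed
  have r: "Inr x \<notin> Inl ` f" for x :: 'a and f :: "'a set" by blast
  show "adj (plus_graph G) (Inl u) (Inl v) \<longleftrightarrow> adj G u v"
    unfolding adj_def e im by (auto simp: doubleton_eq_iff)
  show "adj (plus_graph G) (Inl u) (Inr v) \<longleftrightarrow> u = v \<and> v \<in> verts G"
    unfolding adj_def e using r by (auto simp: doubleton_eq_iff)
  then show "adj (plus_graph G) (Inr v) (Inl u) \<longleftrightarrow> v = u \<and> u \<in> verts G" for u v
    unfolding adj_def e using r by (auto simp: doubleton_eq_iff)
  show "\<not> adj (plus_graph G) (Inr u) (Inr v)"
    unfolding adj_def e using r by (auto simp: doubleton_eq_iff)
qed

lemma simple_plus:
  assumes "simple_graph G"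
  shows "simple_graph (plus_graph G)"
  unfolding simple_graph_def
proof (intro conjI ballI)
  show "finite (verts (plus_graph G))" using simple_graph_finite[OF assms] by (simp add: verts_plus)
  fix e assume "e \<in> edges (plus_graph G)"
  then consider f where "f \<in> edges G" "e = Inl ` f" | v where "v \<in> verts G" "e = {Inl v, Inr v}"
    by (auto simp: plus_graph_def)
  then have "e \<subseteq> verts (plus_graph G) \<and> card e = 2"
  proof cases
    case 1
    then have "f \<subseteq> verts G" "card f = 2" using assms by (auto simp: simple_graph_def)
    then show ?thesis using 1 by (auto simp: verts_plus card_image)
  next
    case 2
    then show ?thesis by (auto simp: verts_plus)
  qed
  then show "e \<subseteq> verts (plus_graph G)" "card e = 2" by blast+
qed

section \<open>Cliques, components and traces after adding pendant vertices\<close>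

locale connected_separated =
  fixes G :: "'a ugraph" and Q :: "'a set"
  assumes simple: "simple_graph G" and connected: "connected_graph G" and sep: "clique_separator G Q"
begin

abbreviation "G' \<equiv> plus_graph G"
abbreviation Q' :: "('a + 'a) set" where "Q' \<equiv> Inl ` Q"

text \<open>The pendant vertices at \<open>C\<close> remain connected to \<open>C\<close>, so they
  enlarge this component instead of forming new ones.\<close>

definition lift :: "'a set \<Rightarrow> ('a + 'a) set" where
  "lift C = Inl ` C \<union> Inr ` C"

lemma clique: "is_clique G Q" using sep by (simp add: clique_separator_iff)

lemma Q_verts: "Q \<subseteq> verts G" by (rule is_cliqueD(1)[OF clique])

lemma comp_traces_ne:
  assumes C: "C \<in> comps G Q"
  shows "\<Union> (traces G Q C) \<noteq> {}"
proof -
  obtain c w where "c \<in> C" "w \<in> Q" "adj G w c" using component_has_neighbour[OF simple connected clique C] by blast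
  moreover have "C \<inter> Q = {}" using comps_subset[OF C] by blast
  ultimately have "w \<in> \<Union> (traces G Q C)" using mem_Union_traces[OF simple, of C Q w] by blast
  then show ?thesis by blast
qed

text \<open>Keeps old cliques maximal: a clique \<open>{v}\<close> of \<open>G\<close> would be
  properly contained in \<open>{Inl v, Inr v}\<close>. A connected graph with a clique separator has
  more than one vertex and so no isolated ones.\<close>

lemma has_neighbour:
  assumes v: "v \<in> verts G"
  shows "\<exists>u. adj G v u"
proof -
  have "\<not> verts G \<subseteq> {v}"
  proof
    assume s: "verts G \<subseteq> {v}"
    have "Q \<noteq> {}" using clique_nonempty[OF clique] v by blast
    then have "verts G - Q = {}" using s Q_verts by blast
    then have "comps G Q = {}" using comps_subset[of _ G Q] comps_nonempty[of _ G Q] by blast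
    then show False using sep by (simp add: clique_separator_iff)
  qed
  then obtain u where u: "u \<in> verts G" "u \<noteq> v" by blast
  have "(adj G)\<^sup>*\<^sup>* v u" using connected v u(1) by (simp add: connected_graph_def)
  then show ?thesis using u(2) by (cases rule: converse_rtranclpE) auto
qed

lemma Inr_clique:
  assumes "pairwise_adj G' L" "Inr v \<in> L"
  shows "L \<subseteq> {Inl v, Inr v}"
proof
  fix x assume x: "x \<in> L"
  show "x \<in> {Inl v, Inr v}"
  proof (cases "x = Inr v")
    case False
    then have "adj G' (Inr v) x" using pairwise_adjD[OF assms(1,2) x] by simp
    then show ?thesis by (cases x) (auto simp: adj_plus)
  qed simp
qed

lemma pairwise_adj_Inl: "pairwise_adj G' (Inl ` K) \<longleftrightarrow> pairwise_adj G K"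
  by (auto simp: pairwise_adj_def adj_plus verts_plus)

lemma no_Inr: "(\<And>v. Inr v \<notin> L) \<Longrightarrow> L = Inl ` (Inl -` L)"
  by (auto simp: image_iff) (metis sumE)

lemma is_clique_plus:
  "is_clique G' L \<longleftrightarrow> (\<exists>K. is_clique G K \<and> L = Inl ` K) \<or> (\<exists>v\<in>verts G. L = {Inl v, Inr v})"
proof
  assume L: "is_clique G' L"
  show "(\<exists>K. is_clique G K \<and> L = Inl ` K) \<or> (\<exists>v\<in>verts G. L = {Inl v, Inr v})"
  proof (cases "\<exists>v. Inr v \<in> L")
    case True
    then obtain v where v: "Inr v \<in> L" by blast
    then have vG: "v \<in> verts G" using is_cliqueD(1)[OF L] by (auto simp: verts_plus)
    then have "pairwise_adj G' {Inl v, Inr v}" by (auto simp: pairwise_adj_def adj_plus verts_plus)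
    then have "L = {Inl v, Inr v}" using is_cliqueD(4)[OF L] Inr_clique[OF is_cliqueD(2)[OF L] v] by blast
    then show ?thesis using vG by blast
  next
    case False
    define K where "K = Inl -` L"
    have LK: "L = Inl ` K" unfolding K_def by (rule no_Inr) (use False in simp)
    have "is_clique G K"
      unfolding is_clique_def
    proof (intro conjI allI impI)
      show "pairwise_adj G K" using is_cliqueD(2)[OF L] LK pairwise_adj_Inl by simp
      fix M assume M: "pairwise_adj G M \<and> K \<subseteq> M"
      then have "pairwise_adj G' (Inl ` M)" "L \<subseteq> Inl ` M" using pairwise_adj_Inl[of M] LK by auto
      then have "Inl ` M = L" by (rule is_cliqueD(4)[OF L])
      then show "M = K" using LK by (metis inj_Inl inj_image_eq_iff)
    qed
    then show ?thesis using LK by blast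
  qed
next
  assume "(\<exists>K. is_clique G K \<and> L = Inl ` K) \<or> (\<exists>v\<in>verts G. L = {Inl v, Inr v})"
  then show "is_clique G' L"
  proof (elim disjE exE bexE conjE)
    fix K assume K: "is_clique G K" "L = Inl ` K"
    show ?thesis
      unfolding is_clique_def
    proof (intro conjI allI impI)
      show "pairwise_adj G' L" using K is_cliqueD(2)[OF K(1)] pairwise_adj_Inl by simp
      fix M assume M: "pairwise_adj G' M \<and> L \<subseteq> M"
      have "Inr v \<notin> M" for v
      proof
        assume v: "Inr v \<in> M"
        then have vG: "v \<in> verts G" using M by (auto simp: pairwise_adj_def verts_plus)
        have "M \<subseteq> {Inl v, Inr v}" using Inr_clique M v by blast
        then have Kv: "K \<subseteq> {v}" using M K(2) by auto
        obtain u where u: "adj G v u" using has_neighbour[OF vG] by blast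
        have uG: "u \<in> verts G" "u \<noteq> v" using adjD[OF simple u] by auto
        have "pairwise_adj G {v, u}" using vG uG u adj_sym[OF u] by (auto simp: pairwise_adj_def)
        then have "{v, u} = K" using is_cliqueD(4)[OF K(1)] Kv by blast
        then show False using Kv uG by blast
      qed
      then have M_eq: "M = Inl ` (Inl -` M)" by (rule no_Inr)
      have "pairwise_adj G (Inl -` M)" using pairwise_adj_Inl[of "Inl -` M"] M_eq M by simp
      moreover have "K \<subseteq> Inl -` M" using M K(2) by auto
      ultimately have "Inl -` M = K" using is_cliqueD(4)[OF K(1)] by blast
      then show "M = L" using M_eq K(2) by simp
    qed
  next
    fix v assume v: "v \<in> verts G" "L = {Inl v, Inr v}"
    show ?thesis
      unfolding is_clique_def
    proof (intro conjI allI impI)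
      show "pairwise_adj G' L" using v by (auto simp: pairwise_adj_def adj_plus verts_plus)
      fix M assume M: "pairwise_adj G' M \<and> L \<subseteq> M"
      then show "M = L" using Inr_clique[of M v] v(2) by blast
    qed
  qed
qed

lemma lift_comp:
  assumes C: "C \<in> comps G Q"
  shows "lift C \<in> comps G' Q'"
proof (rule compsI)
  have CV: "C \<subseteq> verts G - Q" by (rule comps_subset[OF C])
  show "lift C \<subseteq> verts G' - Q'" using CV by (auto simp: lift_def verts_plus)
  show "lift C \<noteq> {}" using comps_nonempty[OF C] by (auto simp: lift_def)
  have L: "conn G' (lift C) (Inl x) (Inl y)" if "conn G C x y" for x y
    using that unfolding conn_def[of G]
  proof (induction rule: rtranclp_induct)
    case (step y z)
    then have "adj G' (Inl y) (Inl z)" "Inl y \<in> lift C" "Inl z \<in> lift C" by (auto simp: adj_induced adj_plus lift_def)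
    then show ?case using step(3) conn_step[of G' "lift C"] by blast
  qed simp
  have R: "\<exists>c\<in>C. conn G' (lift C) x (Inl c)" if x: "x \<in> lift C" for x
  proof -
    from x obtain c where c: "c \<in> C" "x = Inl c \<or> x = Inr c" by (auto simp: lift_def)
    have "conn G' (lift C) (Inr c) (Inl c)" using c CV by (intro conn_adj) (auto simp: adj_plus lift_def)
    then have "conn G' (lift C) x (Inl c)" using c(2) by auto
    then show ?thesis using c(1) by blast
  qed
  show "connected_on G' (lift C)"
    unfolding connected_on_def
  proof (intro ballI)
    fix x y assume "x \<in> lift C" "y \<in> lift C"
    then obtain c e where ce: "c \<in> C" "conn G' (lift C) x (Inl c)" "e \<in> C" "conn G' (lift C) y (Inl e)" using R by meson
    have "conn G C c e" using comps_connected[OF C] ce by (simp add: connected_on_def)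
    then show "conn G' (lift C) x y" using conn_trans[OF ce(2) conn_trans[OF L conn_sym[OF ce(4)]]] by blast
  qed
  fix u w assume u: "u \<in> lift C" "adj G' u w" "w \<in> verts G' - Q'"
  show "w \<in> lift C"
  proof (cases u; cases w)
    fix a b assume ab: "u = Inl a" "w = Inl b"
    then have "a \<in> C" "adj G a b" "b \<in> verts G - Q" using u by (auto simp: lift_def adj_plus verts_plus)
    then have "b \<in> C" by (rule comps_closed[OF C])
    then show ?thesis using ab by (simp add: lift_def)
  qed (use u in \<open>auto simp: lift_def adj_plus\<close>)
qed

lemma pendant_comp:
  assumes v: "v \<in> Q"
  shows "{Inr v} \<in> comps G' Q'"
proof (rule compsI)
  show "{Inr v} \<subseteq> verts G' - Q'" using v Q_verts by (auto simp: verts_plus)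
  show "connected_on G' {Inr v}" by (simp add: connected_on_def)
  show "w \<in> {Inr v}" if "u \<in> {Inr v}" "adj G' u w" "w \<in> verts G' - Q'" for u w
    using that v by (cases w) (auto simp: adj_plus)
qed simp

lemma comps_plus: "comps G' Q' = lift ` comps G Q \<union> (\<lambda>v. {Inr v}) ` Q"
proof
  show "lift ` comps G Q \<union> (\<lambda>v. {Inr v}) ` Q \<subseteq> comps G' Q'" using lift_comp pendant_comp by blast
  show "comps G' Q' \<subseteq> lift ` comps G Q \<union> (\<lambda>v. {Inr v}) ` Q"
  proof
    fix D assume D: "D \<in> comps G' Q'"
    obtain x where x: "x \<in> D" using comps_nonempty[OF D] by blast
    have xV: "x \<in> verts G' - Q'" using comps_subset[OF D] x by blast
    have "\<exists>E \<in> lift ` comps G Q \<union> (\<lambda>v. {Inr v}) ` Q. x \<in> E"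
    proof (cases "\<exists>v\<in>Q. x = Inr v")
      case True
      then show ?thesis by blast
    next
      case False
      then obtain a where a: "a \<in> verts G - Q" "x = Inl a \<or> x = Inr a" using xV by (auto simp: verts_plus)
      then obtain C where "C \<in> comps G Q" "a \<in> C" using comps_cover[OF a(1)] by blast
      then show ?thesis using a(2) unfolding lift_def by blast
    qed
    then obtain E where E: "E \<in> lift ` comps G Q \<union> (\<lambda>v. {Inr v}) ` Q" "x \<in> E" by blast
    then have "E \<in> comps G' Q'" using lift_comp pendant_comp by blast
    then have "D = E" using comps_eq[OF D _ x E(2)] by blast
    then show "D \<in> lift ` comps G Q \<union> (\<lambda>v. {Inr v}) ` Q" using E by blast
  qed
qed

lemma traces_lift:
  assumes C: "C \<in> comps G Q"
  shows "traces G' Q' (lift C) = (`) Inl ` traces G Q C"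
proof
  have CQ: "C \<inter> Q = {}" using comps_subset[OF C] by blast
  show "traces G' Q' (lift C) \<subseteq> (`) Inl ` traces G Q C"
  proof
    fix Y assume "Y \<in> traces G' Q' (lift C)"
    then obtain L where L: "Y = L \<inter> Q'" "is_clique G' L" "L \<inter> lift C \<noteq> {}" "L \<inter> Q' \<noteq> {}" by (auto simp: traces_def)
    have "\<not> (\<exists>v. L = {Inl v, Inr v})" using L(3,4) CQ by (auto simp: lift_def)
    then have "\<exists>K. is_clique G K \<and> L = Inl ` K" using L(2) unfolding is_clique_plus by auto
    then obtain K where K: "is_clique G K" "L = Inl ` K" by blast
    have "K \<inter> C \<noteq> {}" "K \<inter> Q \<noteq> {}" using L(3,4) K(2) by (auto simp: lift_def)
    moreover have "Y = Inl ` (K \<inter> Q)" using L(1) K(2) by blast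
    ultimately show "Y \<in> (`) Inl ` traces G Q C" using K(1) unfolding traces_def by blast
  qed
  show "(`) Inl ` traces G Q C \<subseteq> traces G' Q' (lift C)"
  proof
    fix Y :: "('a + 'a) set" assume "Y \<in> (`) Inl ` traces G Q C"
    then obtain K where K: "Y = Inl ` (K \<inter> Q)" "is_clique G K" "K \<inter> C \<noteq> {}" "K \<inter> Q \<noteq> {}" by (auto simp: traces_def)
    have "is_clique G' (Inl ` K)" using K(2) unfolding is_clique_plus by blast
    moreover have "Inl ` K \<inter> lift C \<noteq> {}" "Inl ` K \<inter> Q' \<noteq> {}" using K(3,4) by (auto simp: lift_def)
    moreover have "Y = Inl ` K \<inter> Q'" using K(1) by blast
    ultimately show "Y \<in> traces G' Q' (lift C)" unfolding traces_def by blast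
  qed
qed

lemma traces_pendant:
  assumes v: "v \<in> Q"
  shows "traces G' Q' {Inr v} = {{Inl v}}"
proof -
  have "is_clique G' L \<and> L \<inter> {Inr v} \<noteq> {} \<and> L \<inter> Q' \<noteq> {} \<longleftrightarrow> L = {Inl v, Inr v}" for L
    unfolding is_clique_plus using v Q_verts by auto
  then have "traces G' Q' {Inr v} = {L \<inter> Q' | L. L = {Inl v, Inr v}}" unfolding traces_def by simp
  also have "\<dots> = {{Inl v}}" using v by auto
  finally show ?thesis .
qed

lemma Union_traces_lift: "C \<in> comps G Q \<Longrightarrow> \<Union> (traces G' Q' (lift C)) = Inl ` \<Union> (traces G Q C)"
  by (simp add: traces_lift image_Union)

lemma fam_dom_lift:
  "C \<in> comps G Q \<Longrightarrow> D \<in> comps G Q \<Longrightarrow>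
     fam_dom (traces G' Q' (lift C)) (traces G' Q' (lift D)) \<longleftrightarrow> fam_dom (traces G Q C) (traces G Q D)"
proof -
  assume CD: "C \<in> comps G Q" "D \<in> comps G Q"
  have i: "inj (Inl :: 'a \<Rightarrow> 'a + 'a)" by simp
  have 1: "Inl ` A \<subseteq> (Inl ` B :: ('a + 'a) set) \<longleftrightarrow> A \<subseteq> B" for A B :: "'a set" by (rule inj_image_subset_iff[OF i])
  have 2: "Inl ` A \<inter> (Inl ` B :: ('a + 'a) set) = {} \<longleftrightarrow> A \<inter> B = {}" for A B :: "'a set" by blast
  show ?thesis
    unfolding fam_dom_def traces_lift[OF CD(1)] traces_lift[OF CD(2)] image_Union[symmetric] ball_simps 1 2 ..
qed

lemma fam_antipodal_lift:
  "C \<in> comps G Q \<Longrightarrow> D \<in> comps G Q \<Longrightarrow>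
     fam_antipodal (traces G' Q' (lift C)) (traces G' Q' (lift D)) \<longleftrightarrow> fam_antipodal (traces G Q C) (traces G Q D)"
  unfolding fam_antipodal_def by (auto simp: fam_dom_lift Union_traces_lift)

text \<open>The only trace of a pendant component is a single vertex, which every set either
  contains or misses; dominance asks for no more once the two are attached.\<close>

lemma pendant_dom:
  assumes "v \<in> Q" "Inl v \<in> \<Union> R"
  shows "fam_dom (traces G' Q' {Inr v}) R"
  unfolding fam_dom_def traces_pendant[OF assms(1)] using assms(2) by auto

lemma pendant_not_antipodal:
  assumes "v \<in> Q"
  shows "\<not> fam_antipodal (traces G' Q' {Inr v}) R" "\<not> fam_antipodal R (traces G' Q' {Inr v})"
  using pendant_dom[OF assms, of R] traces_pendant[OF assms] unfolding fam_antipodal_def by auto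

lemma lift_inj: "inj lift"
proof (rule injI)
  fix C D assume "lift C = lift D"
  then have "Inl -` lift C = Inl -` lift D" by simp
  then show "C = D" by (simp add: lift_def vimage_Un inj_vimage_image_eq) (auto simp: lift_def)
qed

lemma colorable_plus: "colorable G' Q' \<longleftrightarrow> colorable G Q"
proof
  assume "colorable G' Q'"
  then obtain f :: "('a + 'a) set \<Rightarrow> nat" where f: "fam_coloring (comps G' Q') (traces G' Q') f" by (auto simp: colorable_def)
  have "fam_coloring (comps G Q) (traces G Q) (\<lambda>C. f (lift C))"
  proof (rule fam_coloring_pullback[OF f finite_comps[OF simple_plus[OF simple]]])
    show "inj_on lift (comps G Q)" using lift_inj inj_on_subset by blast
    show "lift ` comps G Q \<subseteq> comps G' Q'" using lift_comp by blast
    show "\<exists>w. \<forall>C\<in>comps G Q. v \<in> \<Union> (traces G Q C) \<longrightarrow> w \<in> \<Union> (traces G' Q' (lift C))" for v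
      using Union_traces_lift by (intro exI[of _ "Inl v"]) auto
  qed (use fam_antipodal_lift in blast)
  then show "colorable G Q" unfolding colorable_def by blast
next
  assume "colorable G Q"
  then obtain f :: "'a set \<Rightarrow> nat" where f: "fam_coloring (comps G Q) (traces G Q) f" by (auto simp: colorable_def)
  define N where "N v = {C \<in> comps G Q. v \<in> \<Union> (traces G Q C)}" for v
  \<comment> \<open>The pendant component at \<open>v\<close> copies a colour already present at
    \<open>v\<close> and so adds none. The default \<open>0\<close> applies when no component of
    \<open>G - Q\<close> is attached to \<open>v\<close>.\<close>
  define pc where "pc v = (if N v = {} then 0 else f (SOME C. C \<in> N v))" for v
  define g where "g D = (if D \<in> lift ` comps G Q then f (the_inv lift D) else pc (THE v. D = {Inr v}))" for D
  have gl: "g (lift C) = f C" if "C \<in> comps G Q" for C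
    using that the_inv_f_f[OF lift_inj] by (simp add: g_def)
  have gp: "g {Inr v} = pc v" if "v \<in> Q" for v
  proof -
    have "{Inr v} \<notin> lift ` comps G Q" using comps_nonempty[of _ G Q] by (auto simp: lift_def)
    moreover have "(THE u. {Inr v} = ({Inr u} :: ('a + 'a) set)) = v" by (rule the_equality) auto
    ultimately show ?thesis by (simp add: g_def)
  qed
  have "fam_coloring (comps G' Q') (traces G' Q') g"
    unfolding fam_coloring_def
  proof (intro conjI ballI impI allI)
    fix D E assume DE: "D \<in> comps G' Q'" "E \<in> comps G' Q'" "D \<noteq> E" "fam_antipodal (traces G' Q' D) (traces G' Q' E)"
    then obtain C C' where C: "C \<in> comps G Q" "D = lift C" "C' \<in> comps G Q" "E = lift C'"
      using pendant_not_antipodal unfolding comps_plus by blast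
    then have "fam_antipodal (traces G Q C) (traces G Q C')" "C \<noteq> C'" using DE fam_antipodal_lift by auto
    then have "f C \<noteq> f C'" using f C(1,3) unfolding fam_coloring_def by blast
    then show "g D \<noteq> g E" using gl C by simp
  next
    fix x
    show "card (g ` {D \<in> comps G' Q'. x \<in> \<Union> (traces G' Q' D)}) \<le> 2"
    proof (cases x)
      case (Inl v)
      have mem: "g D \<in> insert (pc v) (f ` N v)" if D: "D \<in> comps G' Q'" "x \<in> \<Union> (traces G' Q' D)" for D
      proof -
        from D(1) consider C where "C \<in> comps G Q" "D = lift C" | u where "u \<in> Q" "D = {Inr u}" unfolding comps_plus by blast
        then show ?thesis
        proof cases
          case 1
          then have "C \<in> N v" using D(2) Inl Union_traces_lift[OF 1(1)] by (auto simp: N_def)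
          then show ?thesis using gl 1 by auto
        next
          case 2
          then have "u = v" using D(2) Inl traces_pendant by auto
          then show ?thesis using gp 2 by simp
        qed
      qed
      show ?thesis
      proof (cases "N v = {}")
        case True
        then have "g ` {D \<in> comps G' Q'. x \<in> \<Union> (traces G' Q' D)} \<subseteq> {pc v, pc v}"
          using mem by (intro image_subsetI) auto
        then show ?thesis by (rule card_le_2_of_subset_pair)
      next
        case False
        then have "(SOME C. C \<in> N v) \<in> N v" by (simp add: some_in_eq)
        then have "pc v \<in> f ` N v" using False by (simp add: pc_def)
        then have "insert (pc v) (f ` N v) = f ` N v" by (rule insert_absorb)
        then have "g ` {D \<in> comps G' Q'. x \<in> \<Union> (traces G' Q' D)} \<subseteq> f ` N v"
          using mem by (intro image_subsetI) simp
        then show ?thesis using fam_coloring_card_mono[OF f finite_comps[OF simple]] unfolding N_def by blast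
      qed
    next
      case (Inr v)
      have "{D \<in> comps G' Q'. x \<in> \<Union> (traces G' Q' D)} = {}" using Inr by (auto simp: traces_def)
      then show ?thesis by (metis card.empty image_empty le0)
    qed
  qed
  then show "colorable G' Q'" unfolding colorable_def by blast
qed

sublocale base: separated_graph G Q
  by unfold_locales (rule simple clique comp_traces_ne; assumption?)+

sublocale plus: separated_graph G' Q'
proof
  show "simple_graph G'" by (rule simple_plus[OF simple])
  show "is_clique G' Q'" using clique unfolding is_clique_plus by blast
  show "\<Union> (traces G' Q' D) \<noteq> {}" if "D \<in> comps G' Q'" for D
  proof -
    from that consider C where "C \<in> comps G Q" "D = lift C" | u where "u \<in> Q" "D = {Inr u}" unfolding comps_plus by blast
    then show ?thesis
    proof cases
      case 1
      then show ?thesis using Union_traces_lift[OF 1(1)] comp_traces_ne[OF 1(1)] by simp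
    qed (simp add: traces_pendant)
  qed
qed

text \<open>The pendant component at \<open>v\<close> is the common lower bound that
  \<open>no_full_triangle_of_lower_bounds\<close> asks for.\<close>

lemma plus_no_full_triangle: "\<not> plus.forbidden \<Longrightarrow> \<not> plus.full_triangle"
proof (rule plus.no_full_triangle_of_lower_bounds)
  fix x assume "x \<in> Q'"
  then obtain v where v: "v \<in> Q" "x = Inl v" by blast
  have p: "{Inr v} \<in> comps G' Q'" by (rule pendant_comp[OF v(1)])
  show "\<exists>\<sigma>\<in>Gamma G' Q'. \<forall>\<gamma>\<in>Gamma G' Q'. x \<in> \<Union> (rel_traces Q' \<gamma>) \<longrightarrow> dominated Q' \<sigma> \<gamma>"
  proof (intro bexI ballI impI)
    show "piece G' Q' {Inr v} \<in> Gamma G' Q'" using p plus.Gamma_eq by blast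
    fix \<gamma> assume "\<gamma> \<in> Gamma G' Q'" "x \<in> \<Union> (rel_traces Q' \<gamma>)"
    then show "dominated Q' (piece G' Q' {Inr v}) \<gamma>"
      using pendant_dom[OF v(1)] v(2) plus.rel_traces_piece[OF p] unfolding dominated_iff by simp
  qed
qed

lemma colorable_iff_plus_no_F0:
  "colorable G Q \<longleftrightarrow> \<not> (\<exists>H\<in>family_F0. has_csubgraph (attachedness_graph G' Q') H)"
  using plus.colorable_iff_no_F0 plus_no_full_triangle plus.no_F0_imp_not_forbidden
  unfolding colorable_plus plus.has_full_antipodal_triangle_iff plus.attachedness_graph_eq by blast

lemma colorable_iff_plus_no_F:
  "colorable G Q \<longleftrightarrow> \<not> (\<exists>H\<in>family_F. has_induced_csubgraph (attachedness_graph G' Q') H)"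
  using plus.colorable_iff_no_F plus_no_full_triangle
  unfolding colorable_plus plus.has_full_antipodal_triangle_iff plus.attachedness_graph_eq plus.forbidden_def by blast

end

section \<open>The equivalences for connected chordal graphs\<close>

theorem path_graph_iff_colorable:
  assumes G: "simple_graph G" "connected_graph G" "chordal G"
  shows "path_graph G \<longleftrightarrow> (\<forall>Q. clique_separator G Q \<longrightarrow> colorable G Q)"
proof
  have "verts G \<noteq> {}" using G(2) by (simp add: connected_graph_def)
  then show "path_graph G \<Longrightarrow> \<forall>Q. clique_separator G Q \<longrightarrow> colorable G Q"
    using path_graph_colorable[OF G(1)] by (simp add: clique_separator_iff)
  show "\<forall>Q. clique_separator G Q \<longrightarrow> colorable G Q \<Longrightarrow> path_graph G"
    using clique_path_tree_exists[OF G] clique_path_tree_imp_path_graph[OF G(1)] by blast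
qed

theorem theorem5:
  fixes G :: "'a ugraph"
  assumes "simple_graph G" and "connected_graph G" and "chordal G"
  shows
   "(path_graph G \<longleftrightarrow>
      (\<forall>Q. clique_separator G Q \<longrightarrow>
         \<not> has_full_antipodal_triangle G Q \<and>
         \<not> (\<exists>H\<in>family_F0. has_csubgraph (attachedness_graph G Q) H))) \<and>
    (path_graph G \<longleftrightarrow>
      (\<forall>Q. clique_separator G Q \<longrightarrow>
         \<not> (\<exists>H\<in>family_F0. has_csubgraph (attachedness_graph (plus_graph G) (Inl ` Q)) H))) \<and>
    (path_graph G \<longleftrightarrow>
      (\<forall>Q. clique_separator G Q \<longrightarrow>
         \<not> has_full_antipodal_triangle G Q \<and>
         \<not> (\<exists>H\<in>family_F. has_induced_csubgraph (attachedness_graph G Q) H))) \<and>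
    (path_graph G \<longleftrightarrow>
      (\<forall>Q. clique_separator G Q \<longrightarrow>
         \<not> (\<exists>H\<in>family_F. has_induced_csubgraph (attachedness_graph (plus_graph G) (Inl ` Q)) H)))"
proof -
  have loc: "connected_separated G Q" if "clique_separator G Q" for Q
    using assms(1,2) that by (rule connected_separated.intro)
  have sep: "separated_graph G Q" if Q: "clique_separator G Q" for Q
  proof
    show "is_clique G Q" using Q by (simp add: clique_separator_iff)
    show "\<Union> (traces G Q C) \<noteq> {}" if "C \<in> comps G Q" for C
      by (rule connected_separated.comp_traces_ne[OF loc[OF Q] that])
  qed (rule assms(1))
  show ?thesis
    unfolding path_graph_iff_colorable[OF assms]
    using separated_graph.colorable_iff_no_F0[OF sep] separated_graph.colorable_iff_no_F[OF sep]
      connected_separated.colorable_iff_plus_no_F0[OF loc] connected_separated.colorable_iff_plus_no_F[OF loc]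
    by simp
qed

end
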